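(* Let $S=Z(f)$ be a non-irreducible $(2,2)$-type surface of $\mathbb{P}^1\times\mathbb{P}^2$. Then $S$ is never a stable surface. Moreover, $S$ is strictly semi-stable if and only if one of the following holds: (1) $f=f_1f_2$, where $Z(f_1)\in\vert(1,0)\vert$, $Z(f_2)\in\vert(1,2)\vert$, the generic fibres of $Z(f_2)$ over $\mathbb{P}^1$ are smooth, and $C=Z(f_1)\cap Z(f_2)$ is a smooth curve. Also, in this case $f$ degenerates to $x_0x_1(\alpha y_0y_2+\beta y_1^2)$ for some $\alpha\neq0$, $\beta\neq0$. (2) $f=f_1f_2$, where $Z(f_1)\in\vert(1,1)\vert$, $Z(f_2)\in\vert(1,1)\vert$, and for each $[\alpha_0,\alpha_1]\in\mathbb{P}^1$ the fibres of $Z(f_1)$ and $Z(f_2)$ over $[\alpha_0,\alpha_1]$ are different lines in $\mathbb{P}^2$. Moreover, in this case $f$ degenerates to $(\alpha_2x_0y_2+\beta_1x_1y_1)(\gamma_1x_0y_1+\delta_0x_1y_0)$ for some constants $\alpha_2,\beta_1,\gamma_1,\delta_0\in\mathbb{C}$.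
   Context: Work over $\mathbb{C}$. $\vert(a,b)\vert$ denotes the linear system of effective divisors $Z(g)$ of $\mathbb{P}^1\times\mathbb{P}^2$ with $0\ne g\in\mathbb{C}[x_0,x_1]_a\otimes\mathbb{C}[y_0,y_1,y_2]_b$. A $(2,2)$-type surface is an element $S=Z(f)$ of $\vert(2,2)\vert$, $0\neq f\in V=\mathbb{C}[x_0,x_1]_2\otimes\mathbb{C}[y_0,y_1,y_2]_2$; it is non-irreducible if $f$ is a reducible polynomial. Fibres over $\mathbb{P}^1$ are taken with respect to the first projection and regarded as subschemes of $\mathbb{P}^2$. Intersections $Z(f_1)\cap Z(f_2)$ are scheme-theoretic. Stability: $G=\mathrm{SL}(2,\mathbb{C})\times\mathrm{SL}(3,\mathbb{C})$ acts linearly on $V$. $S=Z(f)$ is semi-stable if $0\notin\overline{G\cdot f}$; stable (properly stable) if $G\cdot f$ is closed in $V$ and the stabilizer of $f$ is finite; strictly semi-stable if semi-stable but not stable. Equivalently (Hilbert–Mumford), $S$ is not semi-stable (resp. not stable) iff for some non-trivial one-parameter subgroup $\lambda$ of $G$ one has $\lim_{t\to0}\lambda(t)\cdot f=0$ (resp. $\lim_{t\to0}\lambda(t)\cdot f$ exists). One semi-stable surface (or its equation) degenerates to another if the second lies in the closure of the $G$-orbit of the first. *)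

theory Defs
  imports
    "HOL-Analysis.Analysis"
    "HOL-Library.Poly_Mapping"
    "HOL-Computational_Algebra.Factorial_Ring"
begin

text \<open>
  The polynomial ring \<open>\<complex>[x\<^sub>0, x\<^sub>1, y\<^sub>0, y\<^sub>1, y\<^sub>2]\<close>. The variables are indexed by the five-element
  type \<open>2 + 3\<close>: \<open>Inl i\<close> stands for \<open>x\<^sub>i\<close> and \<open>Inr j\<close> for \<open>y\<^sub>j\<close>. In the index types \<open>2\<close> and \<open>3\<close>
  (used also for vectors and matrices) the elements are \<open>0, 1\<close> and \<open>0, 1, 2\<close>.
\<close>

type_synonym mono = "(2 + 3) \<Rightarrow>\<^sub>0 nat"
type_synonym cpoly = "mono \<Rightarrow>\<^sub>0 complex"

definition Const :: "complex \<Rightarrow> cpoly" where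
  "Const c = Poly_Mapping.single 0 c"

definition Var :: "2 + 3 \<Rightarrow> cpoly" where
  "Var v = Poly_Mapping.single (Poly_Mapping.single v 1) 1"

definition X :: "2 \<Rightarrow> cpoly" where "X i = Var (Inl i)"

definition Y :: "3 \<Rightarrow> cpoly" where "Y j = Var (Inr j)"

text \<open>Universal property: extend \<open>c\<close> on constants and \<open>s\<close> on variables to all polynomials.\<close>

definition extend_hom :: "(complex \<Rightarrow> 'b) \<Rightarrow> (2 + 3 \<Rightarrow> 'b) \<Rightarrow> cpoly \<Rightarrow> 'b::comm_semiring_1" where
  "extend_hom c s p =
     (\<Sum>m\<in>Poly_Mapping.keys p.
        c (Poly_Mapping.lookup p m) * (\<Prod>v\<in>UNIV. s v ^ Poly_Mapping.lookup m v))"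

definition peval :: "complex^2 \<Rightarrow> complex^3 \<Rightarrow> cpoly \<Rightarrow> complex" where
  "peval a b = extend_hom id (case_sum (($) a) (($) b))"

definition psubst :: "(2 + 3 \<Rightarrow> cpoly) \<Rightarrow> cpoly \<Rightarrow> cpoly" where
  "psubst = extend_hom Const"

definition partial :: "2 + 3 \<Rightarrow> cpoly \<Rightarrow> cpoly" where
  "partial v p =
     (\<Sum>m\<in>Poly_Mapping.keys p.
        Poly_Mapping.single (m - Poly_Mapping.single v 1)
          (of_nat (Poly_Mapping.lookup m v) * Poly_Mapping.lookup p m))"

text \<open>The space \<open>\<complex>[x\<^sub>0, x\<^sub>1]\<^sub>a \<otimes> \<complex>[y\<^sub>0, y\<^sub>1, y\<^sub>2]\<^sub>b\<close> of bihomogeneous polynomials of bidegree \<open>(a, b)\<close>.\<close>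

definition bihom :: "nat \<Rightarrow> nat \<Rightarrow> cpoly set" where
  "bihom a b = {p. \<forall>m\<in>Poly_Mapping.keys p.
     (\<Sum>i\<in>UNIV. Poly_Mapping.lookup m (Inl i)) = a \<and>
     (\<Sum>j\<in>UNIV. Poly_Mapping.lookup m (Inr j)) = b}"

abbreviation V :: "cpoly set" where "V \<equiv> bihom 2 2"

text \<open>
  A divisor \<open>Z(g)\<close> is represented by its equation \<open>g\<close>, so that \<open>g \<in> linear_system a b\<close> says
  \<open>Z(g) \<in> |(a,b)|\<close>. Points of projective space are represented by nonzero coordinate vectors.
\<close>

definition linear_system :: "nat \<Rightarrow> nat \<Rightarrow> cpoly set" where
  "linear_system a b = bihom a b - {0}"

text \<open>The equation in the \<open>y\<^sub>j\<close> of the fibre of \<open>Z(g)\<close> over \<open>[\<alpha>\<^sub>0, \<alpha>\<^sub>1]\<close>, a subscheme of \<open>\<pp>\<^sup>2\<close>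
  (all of \<open>\<pp>\<^sup>2\<close> if the equation vanishes).\<close>

definition fibre :: "complex^2 \<Rightarrow> cpoly \<Rightarrow> cpoly" where
  "fibre \<alpha> g = psubst (case_sum (\<lambda>i. Const (\<alpha> $ i)) Y) g"

text \<open>Smoothness is the Jacobian criterion. Here \<open>q\<close> is a form in the \<open>y\<^sub>j\<close> only, so the value
  chosen for the \<open>x\<^sub>i\<close> is immaterial.\<close>

definition smooth_plane_curve :: "cpoly \<Rightarrow> bool" where
  "smooth_plane_curve q \<longleftrightarrow>
     q \<noteq> 0 \<and> (\<forall>y. y \<noteq> 0 \<and> peval 0 y q = 0 \<longrightarrow> (\<exists>j. peval 0 y (partial (Inr j) q) \<noteq> 0))"

text \<open>Generic: over all points of a nonempty Zariski-open subset of \<open>\<pp>\<^sup>1\<close>, the complement of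
  the zero set of a nonzero form \<open>h\<close> in \<open>x\<^sub>0, x\<^sub>1\<close>.\<close>

definition generic_fibres_smooth :: "cpoly \<Rightarrow> bool" where
  "generic_fibres_smooth g \<longleftrightarrow>
     (\<exists>d. \<exists>h\<in>linear_system d 0.
        \<forall>\<alpha>. \<alpha> \<noteq> 0 \<and> peval \<alpha> 0 h \<noteq> 0 \<longrightarrow> smooth_plane_curve (fibre \<alpha> g))"

definition jacobian :: "cpoly^'k \<Rightarrow> complex^2 \<Rightarrow> complex^3 \<Rightarrow> complex^(2 + 3)^'k" where
  "jacobian gs x y = (\<chi> i v. peval x y (partial v (gs $ i)))"

text \<open>The scheme \<open>Z(g) \<inter> Z(h)\<close> in \<open>\<pp>\<^sup>1 \<times> \<pp>\<^sup>2\<close> is a smooth curve, i.e.\ smooth of codimension 2. The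
  Jacobian matrix may be taken in the five homogeneous coordinates, because
  \<open>(\<complex>\<^sup>2 - 0) \<times> (\<complex>\<^sup>3 - 0) \<rightarrow> \<pp>\<^sup>1 \<times> \<pp>\<^sup>2\<close> is a smooth morphism.\<close>

definition smooth_curve_intersection :: "cpoly \<Rightarrow> cpoly \<Rightarrow> bool" where
  "smooth_curve_intersection g h \<longleftrightarrow>
     (\<forall>x y. x \<noteq> 0 \<and> y \<noteq> 0 \<and> peval x y g = 0 \<and> peval x y h = 0
        \<longrightarrow> rank (jacobian (vector [g, h] :: cpoly^2) x y) = 2)"

definition plane_zeros :: "cpoly \<Rightarrow> (complex^3) set" where
  "plane_zeros q = {y. y \<noteq> 0 \<and> peval 0 y q = 0}"

definition fibres_different_lines :: "cpoly \<Rightarrow> cpoly \<Rightarrow> bool" where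
  "fibres_different_lines g h \<longleftrightarrow>
     (\<forall>\<alpha>. \<alpha> \<noteq> 0 \<longrightarrow>
        fibre \<alpha> g \<in> linear_system 0 1 \<and> fibre \<alpha> h \<in> linear_system 0 1 \<and>
        plane_zeros (fibre \<alpha> g) \<noteq> plane_zeros (fibre \<alpha> h))"

type_synonym matpair = "(complex^2^2) \<times> (complex^3^3)"

definition G :: "matpair set" where
  "G = {(A, B). det A = 1 \<and> det B = 1}"

text \<open>The action \<open>(g \<cdot> f)(x, y) = f(A\<^sup>-\<^sup>1 x, B\<^sup>-\<^sup>1 y)\<close> of \<open>g = (A, B)\<close>.\<close>

definition act :: "matpair \<Rightarrow> cpoly \<Rightarrow> cpoly" where
  "act g = psubst (case_sum
     (\<lambda>i. \<Sum>k\<in>UNIV. Const (matrix_inv (fst g) $ i $ k) * X k)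
     (\<lambda>j. \<Sum>k\<in>UNIV. Const (matrix_inv (snd g) $ j $ k) * Y k))"

definition orbit :: "cpoly \<Rightarrow> cpoly set" where
  "orbit f = (\<lambda>g. act g f) ` G"

definition stabilizer :: "cpoly \<Rightarrow> matpair set" where
  "stabilizer f = {g \<in> G. act g f = f}"

text \<open>The Zariski topology on \<open>V\<close>. Polynomial functions are the polynomial expressions in the
  coefficients of the argument. (For orbits, Zariski and classical closures coincide.)\<close>

inductive_set poly_functions :: "(cpoly \<Rightarrow> complex) set" where
  const: "(\<lambda>_. c) \<in> poly_functions"
| coefficient: "(\<lambda>p. Poly_Mapping.lookup p m) \<in> poly_functions"
| add: "\<phi> \<in> poly_functions \<Longrightarrow> \<psi> \<in> poly_functions \<Longrightarrow> (\<lambda>p. \<phi> p + \<psi> p) \<in> poly_functions"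
| mult: "\<phi> \<in> poly_functions \<Longrightarrow> \<psi> \<in> poly_functions \<Longrightarrow> (\<lambda>p. \<phi> p * \<psi> p) \<in> poly_functions"

definition V_closure :: "cpoly set \<Rightarrow> cpoly set" where
  "V_closure S = {p \<in> V. \<forall>\<phi>\<in>poly_functions. (\<forall>s\<in>S. \<phi> s = 0) \<longrightarrow> \<phi> p = 0}"

definition git_semistable :: "cpoly \<Rightarrow> bool" where
  "git_semistable f \<longleftrightarrow> 0 \<notin> V_closure (orbit f)"

definition git_stable :: "cpoly \<Rightarrow> bool" where
  "git_stable f \<longleftrightarrow> V_closure (orbit f) = orbit f \<and> finite (stabilizer f)"

definition strictly_semistable :: "cpoly \<Rightarrow> bool" where
  "strictly_semistable f \<longleftrightarrow> git_semistable f \<and> \<not> git_stable f"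

definition degenerates :: "cpoly \<Rightarrow> cpoly \<Rightarrow> bool" where
  "degenerates f f' \<longleftrightarrow> git_semistable f \<and> git_semistable f' \<and> f' \<in> V_closure (orbit f)"

definition type1_factors :: "cpoly \<Rightarrow> cpoly \<Rightarrow> bool" where
  "type1_factors f1 f2 \<longleftrightarrow>
     f1 \<in> linear_system 1 0 \<and> f2 \<in> linear_system 1 2 \<and>
     generic_fibres_smooth f2 \<and> smooth_curve_intersection f1 f2"

definition type2_factors :: "cpoly \<Rightarrow> cpoly \<Rightarrow> bool" where
  "type2_factors f1 f2 \<longleftrightarrow>
     f1 \<in> linear_system 1 1 \<and> f2 \<in> linear_system 1 1 \<and> fibres_different_lines f1 f2"

end

theory Submission
  imports Defs "HOL-Computational_Algebra.Polynomial"
begin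

text \<open>
  Write \<open>f = x\<^sub>0\<^sup>2 P + x\<^sub>0 x\<^sub>1 Q + x\<^sub>1\<^sup>2 R\<close> with conics \<open>P, Q, R\<close>. The cubic form
  \<open>det (x P + y Q + z R)\<close> is an \<open>SL\<^sub>3\<close>-invariant of \<open>f\<close>, and contracting it with the \<open>SL\<^sub>2\<close>-invariant
  quadratic form yields a linear form whose discriminant is an invariant of degree 6 of \<open>f\<close>. It does
  not vanish at \<open>x\<^sub>0 (x\<^sub>0 P + x\<^sub>1 Q)\<close> with \<open>det Q \<noteq> 0\<close>, nor at
  \<open>(x\<^sub>0 y\<^sub>2 + x\<^sub>1 y\<^sub>1) (x\<^sub>0 y\<^sub>1 + x\<^sub>1 y\<^sub>0)\<close>, the normal form of all products of two \<open>(1,1)\<close>-forms whose fibres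
  are different lines throughout. In all other reducible cases a one-parameter subgroup moves \<open>f\<close> to \<open>0\<close>.
  The semi-stable cases degenerate to forms that are fixed by a torus, so they are not stable.
\<close>

section \<open>Homomorphisms and derivations on the polynomial ring\<close>

text \<open>Semi-stability concerns the whole closure of an orbit. It is proved by one polynomial
  function that is constant on the orbit and takes another value at 0, and refuted by an explicit
  limit; only the elementary direction of Hilbert-Mumford enters. On reducible forms the two tools
  meet exactly. For a (1,0)-factor, f is moved to x0 (x0 P + x1 N), where N is the fibre of the
  second factor over the zero of the first. The invariant is then -9 (det N)^2, and if it vanishes a
  kernel vector of N supplies the destabilizing weights. Case (1) is therefore translated into det N
  being nonzero. For two (1,1)-factors, let L(a) and M(a) be the fibres over a. Two pencils of lines
  in a three-dimensional space share a member L(a) = M(b). If fibres over the same point are never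
  proportional, then a, b are independent and M(a), L(a), L(b) form a basis. Taking these as y0, y1,
  y2 produces the normal form of case (2), up to a scalar k forced by det = 1; its invariant is -(5
  k^6 / 4)^2. If the fibres over some point are proportional, that point and the common line dictate
  the weights.\<close>

lemma keys_sum_single: "p = (\<Sum>m\<in>Poly_Mapping.keys p. Poly_Mapping.single m (Poly_Mapping.lookup p m))"
  by (rule poly_mapping_eqI)
    (simp add: lookup_sum lookup_single when_def in_keys_iff sum.delta)

lemma cpoly_single_induct [case_names single add]:
  assumes "\<And>m a. P (Poly_Mapping.single m a)" "\<And>p q. P p \<Longrightarrow> P q \<Longrightarrow> P (p + q)"
  shows "P (p :: 'a::comm_monoid_add \<Rightarrow>\<^sub>0 'b::comm_monoid_add)"
proof -
  have "P (\<Sum>m\<in>A. Poly_Mapping.single m (Poly_Mapping.lookup p m))" if "finite A" for A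
    using that
  proof (induction A)
    case empty
    then show ?case using assms(1)[of 0 0] by simp
  next
    case (insert x A)
    then show ?case by (simp add: assms)
  qed
  then show ?thesis
    using keys_sum_single[of p] by (metis finite_keys)
qed

lemma Const_0 [simp]: "Const 0 = 0"
  and Const_1 [simp]: "Const 1 = 1"
  and Const_add: "Const (a + b) = Const a + Const b"
  and Const_mult: "Const (a * b) = Const a * Const b"
  and Const_uminus: "Const (- a) = - Const a"
  and Const_diff: "Const (a - b) = Const a - Const b"
  by (simp_all add: Const_def single_add mult_single single_uminus single_diff)

lemma Const_sum: "Const (sum g A) = (\<Sum>i\<in>A. Const (g i))"
  by (induction A rule: infinite_finite_induct) (auto simp: Const_add)

lemma lookup_Const_mult: "Poly_Mapping.lookup (Const a * p) m = a * Poly_Mapping.lookup p m"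
proof (induction p rule: cpoly_single_induct)
  case (single n b)
  show ?case by (simp add: Const_def mult_single lookup_single when_def)
next
  case (add p q)
  then show ?case by (simp add: distrib_left lookup_add)
qed

lemma single_power: "Poly_Mapping.single m a ^ n
    = Poly_Mapping.single (\<Sum>i<n. m) (a ^ n)" for a :: complex and m :: mono
  by (induction n) (simp_all add: mult_single add.commute)

lemma single_eq_Const_prod_Var:
  "Poly_Mapping.single m a = Const a * (\<Prod>v\<in>UNIV. Var v ^ Poly_Mapping.lookup m v)"
proof -
  have "(\<Prod>v\<in>A. Var v ^ Poly_Mapping.lookup m v)
      = Poly_Mapping.single (\<Sum>v\<in>A. Poly_Mapping.single v (Poly_Mapping.lookup m v)) 1"
    if "finite A" for A
    using that
  proof (induction A)
    case (insert v A)
    have "(\<Sum>i<n. Poly_Mapping.single v 1) = Poly_Mapping.single v n" for n :: nat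
      by (induction n) (auto simp flip: single_add)
    then have "Var v ^ n = Poly_Mapping.single (Poly_Mapping.single v n) 1" for n
      by (simp add: Var_def single_power)
    with insert show ?case by (simp add: mult_single)
  qed auto
  moreover have "(\<Sum>v\<in>UNIV. Poly_Mapping.single v (Poly_Mapping.lookup m v)) = m"
    by (rule poly_mapping_eqI) (simp add: lookup_sum lookup_single when_def)
  ultimately show ?thesis
    by (simp add: Const_def mult_single)
qed

lemma cpoly_induct [case_names Const Var add mult]:
  assumes "\<And>a. P (Const a)" "\<And>v. P (Var v)"
    and "\<And>p q. P p \<Longrightarrow> P q \<Longrightarrow> P (p + q)" and "\<And>p q. P p \<Longrightarrow> P q \<Longrightarrow> P (p * q)"
  shows "P p"
proof (induction p rule: cpoly_single_induct)
  case (single m a)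
  have pow: "P (Var v ^ n)" for v n
    by (induction n) (use assms(1)[of 1] assms in auto)
  have "P (\<Prod>v\<in>A. Var v ^ Poly_Mapping.lookup m v)" if "finite A" for A
    using that by (induction A) (use assms(1)[of 1] assms pow in auto)
  then show ?case
    unfolding single_eq_Const_prod_Var by (intro assms) auto
qed (rule assms)

text \<open>One proof of the universal property serves three targets: the complex numbers for
  evaluation, \<open>cpoly\<close> for substitution, and \<open>cpoly poly\<close> for the grading
  by weights.\<close>

locale scalar_hom =
  fixes c :: "complex \<Rightarrow> 'b::comm_semiring_1"
  assumes zero [simp]: "c 0 = 0" and one [simp]: "c 1 = 1"
    and add: "c (a + b) = c a + c b" and mult: "c (a * b) = c a * c b"
begin

text \<open>Terms of p and q may cancel in p + q, so the three sets of keys differ; summing over a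
  common finite superset makes the sums comparable.\<close>

lemma extend_hom_superset:
  assumes "finite A" "Poly_Mapping.keys p \<subseteq> A"
  shows "extend_hom c s p
    = (\<Sum>m\<in>A. c (Poly_Mapping.lookup p m) * (\<Prod>v\<in>UNIV. s v ^ Poly_Mapping.lookup m v))"
  unfolding extend_hom_def
  using assms by (intro sum.mono_neutral_left) (auto simp: in_keys_iff)

lemma extend_hom_single:
  "extend_hom c s (Poly_Mapping.single m a) = c a * (\<Prod>v\<in>UNIV. s v ^ Poly_Mapping.lookup m v)"
  by (subst extend_hom_superset[of "{m}"]) auto

lemma extend_hom_add: "extend_hom c s (p + q) = extend_hom c s p + extend_hom c s q"
proof -
  let ?A = "Poly_Mapping.keys p \<union> Poly_Mapping.keys q"
  have "Poly_Mapping.keys (p + q) \<subseteq> ?A" by (rule Poly_Mapping.keys_add)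
  then show ?thesis
    by (simp add: extend_hom_superset[of ?A] lookup_add add distrib_right sum.distrib)
qed

lemma extend_hom_mult: "extend_hom c s (p * q) = extend_hom c s p * extend_hom c s q"
proof (induction p rule: cpoly_single_induct)
  case (single m a)
  show ?case
  proof (induction q rule: cpoly_single_induct)
    case (single n b)
    show ?case
      by (simp add: mult_single extend_hom_single mult lookup_add power_add prod.distrib mult_ac)
  qed (simp add: distrib_left extend_hom_add)
qed (simp add: distrib_right extend_hom_add)

lemma extend_hom_Const [simp]: "extend_hom c s (Const a) = c a"
  by (simp add: Const_def extend_hom_single)

lemma extend_hom_0 [simp]: "extend_hom c s 0 = 0"
  and extend_hom_1 [simp]: "extend_hom c s 1 = 1"
  using extend_hom_Const[of s 0] extend_hom_Const[of s 1] by simp_all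

lemma extend_hom_Var [simp]: "extend_hom c s (Var v) = s v"
proof -
  have "(\<Prod>w\<in>UNIV. s w ^ Poly_Mapping.lookup (Poly_Mapping.single v 1) w)
      = (\<Prod>w\<in>UNIV. if w = v then s v else 1)"
    by (intro prod.cong) (auto simp: lookup_single when_def)
  then show ?thesis
    by (simp add: Var_def extend_hom_single)
qed

lemma extend_hom_sum: "extend_hom c s (sum g A) = (\<Sum>i\<in>A. extend_hom c s (g i))"
  by (induction A rule: infinite_finite_induct) (auto simp: extend_hom_add)

lemma extend_hom_power: "extend_hom c s (p ^ n) = extend_hom c s p ^ n"
  by (induction n) (auto simp: extend_hom_mult)

end

interpretation eval: scalar_hom "id :: complex \<Rightarrow> complex"
  by unfold_locales auto

interpretation subst: scalar_hom Const
  by unfold_locales (auto simp: Const_add Const_mult)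

lemma peval_simps [simp]:
  "peval x y 0 = 0" "peval x y 1 = 1" "peval x y (Const a) = a"
  "peval x y (X i) = x $ i" "peval x y (Y j) = y $ j"
  "peval x y (p + q) = peval x y p + peval x y q"
  "peval x y (p * q) = peval x y p * peval x y q"
  "peval x y (p ^ n) = peval x y p ^ n"
  "peval x y (sum g A) = (\<Sum>i\<in>A. peval x y (g i))"
  by (simp_all add: peval_def X_def Y_def eval.extend_hom_add eval.extend_hom_mult
      eval.extend_hom_power eval.extend_hom_sum)

lemma psubst_simps [simp]:
  "psubst s 0 = 0" "psubst s 1 = 1" "psubst s (Const a) = Const a"
  "psubst s (Var v) = s v" "psubst s (X i) = s (Inl i)" "psubst s (Y j) = s (Inr j)"
  "psubst s (p + q) = psubst s p + psubst s q"
  "psubst s (p * q) = psubst s p * psubst s q"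
  "psubst s (p ^ n) = psubst s p ^ n"
  "psubst s (sum g A) = (\<Sum>i\<in>A. psubst s (g i))"
  by (simp_all add: psubst_def X_def Y_def subst.extend_hom_add subst.extend_hom_mult
      subst.extend_hom_power subst.extend_hom_sum)

lemma psubst_psubst: "psubst s (psubst t p) = psubst (\<lambda>v. psubst s (t v)) p"
  by (induction p rule: cpoly_induct) auto

lemma psubst_Var: "psubst Var p = p"
  by (induction p rule: cpoly_induct) auto

section \<open>Formal partial derivatives and the product rule\<close>

lemma partial_superset:
  assumes "finite A" "Poly_Mapping.keys p \<subseteq> A"
  shows "partial v p = (\<Sum>m\<in>A. Poly_Mapping.single (m - Poly_Mapping.single v 1)
          (of_nat (Poly_Mapping.lookup m v) * Poly_Mapping.lookup p m))"
  unfolding partial_def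
  using assms by (intro sum.mono_neutral_left) (auto simp: in_keys_iff)

lemma partial_single: "partial v (Poly_Mapping.single m a)
    = Poly_Mapping.single (m - Poly_Mapping.single v 1) (of_nat (Poly_Mapping.lookup m v) * a)"
  by (subst partial_superset[of "{m}"]) auto

lemma partial_add: "partial v (p + q) = partial v p + partial v q"
proof -
  let ?A = "Poly_Mapping.keys p \<union> Poly_Mapping.keys q"
  have "Poly_Mapping.keys (p + q) \<subseteq> ?A" by (rule Poly_Mapping.keys_add)
  then show ?thesis
    by (simp add: partial_superset[of ?A] lookup_add distrib_left single_add sum.distrib)
qed

text \<open>Subtraction of exponents is truncated, so removing one factor \<open>v\<close> is
  compatible with products only where \<open>v\<close> occurs.\<close>

lemma mono_diff_add:
  assumes "Poly_Mapping.lookup m v \<noteq> 0"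
  shows "(m + n) - Poly_Mapping.single v 1 = (m - Poly_Mapping.single v (1::nat)) + n"
  using assms
  by (intro poly_mapping_eqI) (auto simp: lookup_add lookup_minus lookup_single when_def)

lemma partial_mult: "partial v (p * q) = partial v p * q + p * partial v q"
proof (induction p rule: cpoly_single_induct)
  case (single m a)
  show ?case
  proof (induction q rule: cpoly_single_induct)
    case (single n b)
    show ?case
      \<comment> \<open>If \<open>v\<close> does not occur in a monomial, its exponent 0 appears as
        a factor of the coefficient and kills the term in which truncation would matter.\<close>
      using mono_diff_add[of m v n] mono_diff_add[of n v m]
      by (cases "Poly_Mapping.lookup m v = 0"; cases "Poly_Mapping.lookup n v = 0")
        (simp_all add: mult_single partial_single lookup_add add.commute[of n m]
          add.commute[of "n - Poly_Mapping.single v 1" m] algebra_simps flip: single_add)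
  qed (simp add: algebra_simps partial_add)
qed (simp add: algebra_simps partial_add)

lemma partial_Const [simp]: "partial v (Const a) = 0"
  by (simp add: Const_def partial_single)

lemma partial_Var [simp]: "partial v (Var w) = (if v = w then 1 else 0)"
  by (auto simp: Var_def partial_single lookup_single)

lemma partial_sum: "partial v (sum g A) = (\<Sum>i\<in>A. partial v (g i))"
  by (induction A rule: infinite_finite_induct)
    (use partial_Const[of v 0] in \<open>auto simp: partial_add simp del: partial_Const\<close>)

lemma partial_XY [simp]:
  "partial (Inl i) (X i') = (if i = i' then 1 else 0)"
  "partial (Inr j) (Y j') = (if j = j' then 1 else 0)"
  "partial (Inl i) (Y j) = 0" "partial (Inr j) (X i) = 0"
  by (simp_all add: X_def Y_def)

text \<open>Any linear order on the variables will do: it induces one on monomials, which makes the type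
  \<open>cpoly\<close> an instance of \<open>idom\<close>.\<close>

instantiation sum :: (linorder, linorder) linorder
begin

definition less_eq_sum :: "'a + 'b \<Rightarrow> 'a + 'b \<Rightarrow> bool" where
  "less_eq_sum u v = (case u of
     Inl a \<Rightarrow> (case v of Inl b \<Rightarrow> a \<le> b | Inr b \<Rightarrow> True)
   | Inr a \<Rightarrow> (case v of Inl b \<Rightarrow> False | Inr b \<Rightarrow> a \<le> b))"

definition less_sum :: "'a + 'b \<Rightarrow> 'a + 'b \<Rightarrow> bool" where
  "less_sum u v \<longleftrightarrow> u \<le> v \<and> \<not> v \<le> u"

instance
  by standard (auto simp: less_eq_sum_def less_sum_def split: sum.splits)

end

section \<open>Bihomogeneous polynomials\<close>

definition mono_weight :: "(2 + 3 \<Rightarrow> nat) \<Rightarrow> mono \<Rightarrow> nat" where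
  "mono_weight w m = (\<Sum>v\<in>UNIV. w v * Poly_Mapping.lookup m v)"

text \<open>Introduces an auxiliary variable that records the weight of each monomial; a polynomial
  is homogeneous for \<open>w\<close> iff its image is a monomial in that variable.\<close>

definition weight_hom :: "(2 + 3 \<Rightarrow> nat) \<Rightarrow> cpoly \<Rightarrow> cpoly poly" where
  "weight_hom w = extend_hom (\<lambda>a. [:Const a:]) (\<lambda>v. monom (Var v) (w v))"

interpretation weight: scalar_hom "\<lambda>a. [:Const a:] :: cpoly poly"
  by unfold_locales (auto simp: Const_add Const_mult one_pCons)

lemma weight_hom_single:
  "weight_hom w (Poly_Mapping.single m a) = monom (Poly_Mapping.single m a) (mono_weight w m)"
proof -
  have "(\<Prod>v\<in>A. monom (Var v) (w v) ^ Poly_Mapping.lookup m v)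
     = monom (\<Prod>v\<in>A. Var v ^ Poly_Mapping.lookup m v) (\<Sum>v\<in>A. w v * Poly_Mapping.lookup m v)"
    if "finite A" for A
    using that by (induction A) (simp_all add: monom_power mult_monom)
  then show ?thesis
    unfolding weight_hom_def weight.extend_hom_single mono_weight_def
    by (simp add: single_eq_Const_prod_Var[of m a] smult_monom)
qed

lemma lookup_coeff_weight_hom:
  "Poly_Mapping.lookup (coeff (weight_hom w p) k) m
    = (if mono_weight w m = k then Poly_Mapping.lookup p m else 0)"
proof (induction p rule: cpoly_single_induct)
  case (single n a)
  then show ?case by (auto simp: weight_hom_single lookup_single when_def)
next
  case (add p q)
  then show ?case
    by (simp add: weight_hom_def weight.extend_hom_add lookup_add)
qed

lemma weight_hom_homogeneous:
  assumes "\<And>m. m \<in> Poly_Mapping.keys p \<Longrightarrow> mono_weight w m = n"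
  shows "weight_hom w p = monom p n"
  by (rule poly_eqI, rule poly_mapping_eqI)
    (use assms in \<open>auto simp: lookup_coeff_weight_hom in_keys_iff\<close>)

text \<open>Both the degree and the order of vanishing at 0 are additive, and order is at most
  degree. For a monomial the two agree, which forces agreement in each factor, and a polynomial
  whose order equals its degree is a monomial.\<close>

lemma mult_eq_monomD:
  fixes p q :: "'a::idom poly"
  assumes "p * q = monom c n" "c \<noteq> 0"
  obtains a b i j where "p = monom a i" "q = monom b j" "i + j = n"
proof -
  have nz: "p \<noteq> 0" "q \<noteq> 0" using assms by (auto simp: monom_eq_0_iff)
  have deg: "degree p + degree q = n"
    using degree_mult_eq[OF nz] assms by (simp add: degree_monom_eq)
  have "order 0 (p * q) = order 0 p + order 0 q"
    using nz by (intro order_mult) auto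
  then have ord: "order 0 p + order 0 q = n"
    using assms by (simp add: order_0_monom)
  have le: "order 0 r \<le> degree r" if "r \<noteq> 0" for r :: "'a poly"
    using order_degree[OF that] .
  have eq: "order 0 p = degree p" "order 0 q = degree q"
    using deg ord le[OF nz(1)] le[OF nz(2)] by linarith+
  have "\<exists>a. r = monom a (degree r)" if r: "r \<noteq> 0" "order 0 r = degree r" for r :: "'a poly"
  proof -
    have "monom 1 (degree r) dvd r" using r by (simp add: monom_1_dvd_iff)
    then obtain s where s: "r = monom 1 (degree r) * s" by (auto simp: dvd_def)
    with r have "s \<noteq> 0" by auto
    with s have "degree s = 0"
      by (metis add_cancel_right_right degree_monom_eq degree_mult_eq monom_eq_0_iff zero_neq_one)
    then obtain a where "s = [:a:]" by (meson degree_eq_zeroE)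
    then have "r = monom a (degree r)"
      using s by (metis monom_0 mult_monom add.right_neutral mult_1)
    then show ?thesis by blast
  qed
  from this[OF nz(1) eq(1)] this[OF nz(2) eq(2)] deg that show thesis by blast
qed

lemma homogeneous_factors:
  fixes p q :: cpoly
  assumes "p * q \<noteq> 0" and "\<And>m. m \<in> Poly_Mapping.keys (p * q) \<Longrightarrow> mono_weight w m = n"
  obtains i j where "i + j = n"
    "\<And>m. m \<in> Poly_Mapping.keys p \<Longrightarrow> mono_weight w m = i"
    "\<And>m. m \<in> Poly_Mapping.keys q \<Longrightarrow> mono_weight w m = j"
proof -
  have "weight_hom w p * weight_hom w q = monom (p * q) n"
    using weight_hom_homogeneous[of "p * q" w n] assms(2) by (simp add: weight_hom_def weight.extend_hom_mult)
  then obtain a b i j where ab: "weight_hom w p = monom a i" "weight_hom w q = monom b j" "i + j = n"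
    using mult_eq_monomD[OF _ assms(1)] by metis
  have "mono_weight w m = i" if "weight_hom w r = monom c i" "m \<in> Poly_Mapping.keys r" for r c m i
    using that lookup_coeff_weight_hom[of w r "mono_weight w m" m]
    by (auto simp: in_keys_iff split: if_splits)
  with ab that show thesis by blast
qed

lemma UNIV_sum_split: "sum g (UNIV :: (2 + 3) set) = (\<Sum>i\<in>UNIV. g (Inl i)) + (\<Sum>j\<in>UNIV. g (Inr j))"
  by (subst UNIV_sum) (subst sum.union_disjoint, auto simp: sum.reindex)

lemma bihom_weight:
  "p \<in> bihom a b \<longleftrightarrow> (\<forall>m\<in>Poly_Mapping.keys p.
     mono_weight (case_sum (\<lambda>_. 1) (\<lambda>_. 0)) m = a \<and> mono_weight (case_sum (\<lambda>_. 0) (\<lambda>_. 1)) m = b)"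
  by (simp add: bihom_def mono_weight_def UNIV_sum_split)

text \<open>The degrees in x and in y are two weightings; homogeneity of the factors is obtained for
  each of them separately.\<close>

lemma bihom_factors:
  fixes p q :: cpoly
  assumes "p * q \<in> bihom a b" "p * q \<noteq> 0"
  obtains a1 a2 b1 b2 where "p \<in> bihom a1 b1" "q \<in> bihom a2 b2" "a1 + a2 = a" "b1 + b2 = b"
proof -
  let ?x = "case_sum (\<lambda>_. 1) (\<lambda>_. 0) :: 2 + 3 \<Rightarrow> nat"
  let ?y = "case_sum (\<lambda>_. 0) (\<lambda>_. 1) :: 2 + 3 \<Rightarrow> nat"
  obtain a1 a2 where a: "a1 + a2 = a"
    "\<And>m. m \<in> Poly_Mapping.keys p \<Longrightarrow> mono_weight ?x m = a1"
    "\<And>m. m \<in> Poly_Mapping.keys q \<Longrightarrow> mono_weight ?x m = a2"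
    by (rule homogeneous_factors[OF assms(2), of ?x a]) (use assms(1) in \<open>auto simp: bihom_weight\<close>)
  obtain b1 b2 where b: "b1 + b2 = b"
    "\<And>m. m \<in> Poly_Mapping.keys p \<Longrightarrow> mono_weight ?y m = b1"
    "\<And>m. m \<in> Poly_Mapping.keys q \<Longrightarrow> mono_weight ?y m = b2"
    by (rule homogeneous_factors[OF assms(2), of ?y b]) (use assms(1) in \<open>auto simp: bihom_weight\<close>)
  from a b show thesis
    by (intro that[of a1 b1 a2 b2]) (auto simp: bihom_weight)
qed

section \<open>Closure properties and decomposition of the bihomogeneous spaces\<close>

lemma bihom_0 [simp]: "0 \<in> bihom a b"
  by (simp add: bihom_def)

lemma bihom_add: "p \<in> bihom a b \<Longrightarrow> q \<in> bihom a b \<Longrightarrow> p + q \<in> bihom a b"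
  unfolding bihom_def using Poly_Mapping.keys_add[of p q] by blast

lemma bihom_sum: "(\<And>i. i \<in> A \<Longrightarrow> g i \<in> bihom a b) \<Longrightarrow> sum g A \<in> bihom a b"
  by (induction A rule: infinite_finite_induct) (auto intro: bihom_add)

lemma bihom_mult:
  assumes "p \<in> bihom a b" "q \<in> bihom c d"
  shows "p * q \<in> bihom (a + c) (b + d)"
proof -
  have "\<exists>k\<in>Poly_Mapping.keys p. \<exists>l\<in>Poly_Mapping.keys q. m = k + l"
    if "m \<in> Poly_Mapping.keys (p * q)" for m
    using keys_mult[of p q] that by blast
  then show ?thesis
    using assms unfolding bihom_def by (fastforce simp: lookup_add sum.distrib)
qed

lemma bihom_Const [simp]: "Const c \<in> bihom 0 0"
  by (auto simp: bihom_def Const_def)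

lemma bihom_Const_mult: "p \<in> bihom a b \<Longrightarrow> Const c * p \<in> bihom a b"
  using bihom_mult[OF bihom_Const[of c], of p a b] by simp

lemma bihom_X [simp]: "X i \<in> bihom 1 0"
  and bihom_Y [simp]: "Y j \<in> bihom 0 1"
  by (simp_all add: bihom_def X_def Y_def Var_def lookup_single when_def)

lemma bihom_induct [consumes 1, case_names zero single add]:
  assumes p: "p \<in> bihom a b" and P0: "P 0"
    and single: "\<And>m c. (\<Sum>i\<in>UNIV. Poly_Mapping.lookup m (Inl i)) = a \<Longrightarrow>
      (\<Sum>j\<in>UNIV. Poly_Mapping.lookup m (Inr j)) = b \<Longrightarrow> P (Poly_Mapping.single m c)"
    and add: "\<And>q r. P q \<Longrightarrow> P r \<Longrightarrow> P (q + r)"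
  shows "P p"
proof -
  have "P (\<Sum>m\<in>A. Poly_Mapping.single m (Poly_Mapping.lookup p m))"
    if "finite A" "A \<subseteq> Poly_Mapping.keys p" for A
    using that by (induction A) (use assms in \<open>auto simp: bihom_def\<close>)
  then show ?thesis
    using keys_sum_single[of p] by (metis finite_keys subset_refl)
qed

lemma single_Var_mult:
  assumes "Poly_Mapping.lookup m v \<noteq> 0"
  shows "Poly_Mapping.single m c = Var v * Poly_Mapping.single (m - Poly_Mapping.single v 1) c"
proof -
  have "Poly_Mapping.single v 1 + (m - Poly_Mapping.single v 1) = m"
    by (rule poly_mapping_eqI) (use assms in \<open>auto simp: lookup_add lookup_minus lookup_single when_def\<close>)
  then show ?thesis by (simp add: Var_def mult_single)
qed

lemma UNIV_2: "(UNIV :: 2 set) = {0, 1}"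
  and UNIV_3': "(UNIV :: 3 set) = {0, 1, 2}"
  using Cartesian_Space.UNIV_2 Cartesian_Space.UNIV_3 by auto

lemma bihom_0_0: "p \<in> bihom 0 0 \<Longrightarrow> \<exists>c. p = Const c"
proof (induction p rule: bihom_induct)
  case zero
  show ?case by (metis Const_0)
next
  case (single m c)
  then have "Poly_Mapping.lookup m v = 0" for v by (cases v) auto
  then have "m = 0" by (intro poly_mapping_eqI) simp
  then show ?case by (auto simp: Const_def)
next
  case (add q r)
  then show ?case by (metis Const_add)
qed

text \<open>A monomial of positive degree in x contains some x variable, which can be split off.
  Together with the analogue for y this lowers every bidegree to (0,0), where only constants
  remain.\<close>

lemma bihom_Suc_X:
  "p \<in> bihom (Suc a) b \<Longrightarrow> \<exists>q. (\<forall>i. q i \<in> bihom a b) \<and> p = (\<Sum>i\<in>UNIV. X i * q i)"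
proof (induction p rule: bihom_induct)
  case zero
  show ?case by (rule exI[of _ "\<lambda>_. 0"]) simp
next
  case (single m c)
  then obtain i where i: "Poly_Mapping.lookup m (Inl i) \<noteq> 0"
    by (metis (no_types, lifting) nat.distinct(1) sum.not_neutral_contains_not_neutral)
  let ?n = "m - Poly_Mapping.single (Inl i) 1"
  let ?s = "Poly_Mapping.single ?n c"
  have "(\<Sum>k\<in>UNIV. Poly_Mapping.lookup m (Inl k))
      = Suc (\<Sum>k\<in>UNIV. Poly_Mapping.lookup ?n (Inl k))"
    using i by (simp add: sum.remove[of _ i] lookup_minus lookup_single)
  then have s: "?s \<in> bihom a b"
    using single by (auto simp: bihom_def lookup_minus lookup_single)
  have "Poly_Mapping.single m c = (\<Sum>k\<in>UNIV. X k * (if k = i then ?s else 0))"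
    using single_Var_mult[OF i] by (simp add: X_def if_distrib cong: if_cong)
  with s show ?case by (intro exI[of _ "\<lambda>k. if k = i then ?s else 0"]) simp
next
  case (add p q)
  then obtain f g where fg: "\<And>i. f i \<in> bihom a b" "p = (\<Sum>i\<in>UNIV. X i * f i)"
    "\<And>i. g i \<in> bihom a b" "q = (\<Sum>i\<in>UNIV. X i * g i)" by auto
  then show ?case
    by (intro exI[of _ "\<lambda>i. f i + g i"]) (simp add: bihom_add distrib_left sum.distrib)
qed

lemma bihom_Suc_Y:
  "p \<in> bihom a (Suc b) \<Longrightarrow> \<exists>q. (\<forall>j. q j \<in> bihom a b) \<and> p = (\<Sum>j\<in>UNIV. Y j * q j)"
proof (induction p rule: bihom_induct)
  case zero
  show ?case by (rule exI[of _ "\<lambda>_. 0"]) simp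
next
  case (single m c)
  then obtain i where i: "Poly_Mapping.lookup m (Inr i) \<noteq> 0"
    by (metis (no_types, lifting) nat.distinct(1) sum.not_neutral_contains_not_neutral)
  let ?n = "m - Poly_Mapping.single (Inr i) 1"
  let ?s = "Poly_Mapping.single ?n c"
  have "(\<Sum>k\<in>UNIV. Poly_Mapping.lookup m (Inr k))
      = Suc (\<Sum>k\<in>UNIV. Poly_Mapping.lookup ?n (Inr k))"
    using i by (simp add: sum.remove[of _ i] lookup_minus lookup_single)
  then have s: "?s \<in> bihom a b"
    using single by (auto simp: bihom_def lookup_minus lookup_single)
  have "Poly_Mapping.single m c = (\<Sum>k\<in>UNIV. Y k * (if k = i then ?s else 0))"
    using single_Var_mult[OF i] by (simp add: Y_def if_distrib cong: if_cong)
  with s show ?case by (intro exI[of _ "\<lambda>k. if k = i then ?s else 0"]) simp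
next
  case (add p q)
  then obtain f g where fg: "\<And>i. f i \<in> bihom a b" "p = (\<Sum>i\<in>UNIV. Y i * f i)"
    "\<And>i. g i \<in> bihom a b" "q = (\<Sum>i\<in>UNIV. Y i * g i)" by auto
  then show ?case
    by (intro exI[of _ "\<lambda>i. f i + g i"]) (simp add: bihom_add distrib_left sum.distrib)
qed

section \<open>The group action on (2,2)-forms\<close>

definition lx :: "complex^2 \<Rightarrow> cpoly" where
  "lx u = (\<Sum>i\<in>UNIV. Const (u $ i) * X i)"

definition ly :: "complex^3 \<Rightarrow> cpoly" where
  "ly v = (\<Sum>j\<in>UNIV. Const (v $ j) * Y j)"

text \<open>The sum runs over ordered pairs, so \<open>M\<close> acts as a Gram matrix: an
  off-diagonal coefficient of the form is the sum of two entries, and \<open>M\<close> is determined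
  only if it is symmetric.\<close>

definition qf :: "complex^3^3 \<Rightarrow> cpoly" where
  "qf M = (\<Sum>j\<in>UNIV. \<Sum>k\<in>UNIV. Const (M $ j $ k) * Y j * Y k)"

definition quad :: "complex^3^3 \<Rightarrow> complex^3^3 \<Rightarrow> complex^3^3 \<Rightarrow> cpoly" where
  "quad P Q R = (X 0)\<^sup>2 * qf P + X 0 * X 1 * qf Q + (X 1)\<^sup>2 * qf R"

definition comb :: "complex \<Rightarrow> complex^3^3 \<Rightarrow> complex \<Rightarrow> complex^3^3 \<Rightarrow> complex \<Rightarrow> complex^3^3 \<Rightarrow> complex^3^3" where
  "comb a P b Q c R = (\<chi> i j. a * P $ i $ j + b * Q $ i $ j + c * R $ i $ j)"

abbreviation sym_mat :: "complex^3^3 \<Rightarrow> bool" where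
  "sym_mat M \<equiv> transpose M = M"

lemma sym_matD:
  assumes "sym_mat M"
  shows "M $ i $ j = M $ j $ i"
  using arg_cong[OF assms, of "\<lambda>A. A $ j $ i"] by (simp add: transpose_def)

lemma sym_matI: "(\<And>i j. M $ i $ j = M $ j $ i) \<Longrightarrow> sym_mat M"
  by (simp add: transpose_def vec_eq_iff)

lemma sum_2': "sum g (UNIV :: 2 set) = g 0 + g 1"
  and sum_3': "sum h (UNIV :: 3 set) = h 0 + h 1 + h 2"
  by (subst UNIV_2, simp) (subst UNIV_3', simp add: add.assoc)

lemma exhaust_2': "(i::2) = 0 \<or> i = 1"
  and exhaust_3': "(j::3) = 0 \<or> j = 1 \<or> j = 2"
  by (metis UNIV_2 UNIV_I empty_iff insert_iff, metis UNIV_3' UNIV_I empty_iff insert_iff)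

lemma forall_2': "(\<forall>i::2. P i) \<longleftrightarrow> P 0 \<and> P 1"
  and forall_3': "(\<forall>i::3. Q i) \<longleftrightarrow> Q 0 \<and> Q 1 \<and> Q 2"
  by (metis UNIV_2 UNIV_I empty_iff insert_iff, metis UNIV_3' UNIV_I empty_iff insert_iff)

lemma vec2_eq_0: "(u :: complex^2) = 0 \<longleftrightarrow> u $ 0 = 0 \<and> u $ 1 = 0"
  and vec3_eq_0: "(v :: complex^3) = 0 \<longleftrightarrow> v $ 0 = 0 \<and> v $ 1 = 0 \<and> v $ 2 = 0"
  by (auto simp: vec_eq_iff forall_2' forall_3')

lemma det_2': "det (A :: complex^2^2) = A$0$0 * A$1$1 - A$0$1 * A$1$0"
proof -
  \<comment> \<open>The library expansion uses the indices 1 and 2; in the type \<open>2\<close> the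
    latter is the element 0.\<close>
  have "(2::2) = 0" by simp
  then show ?thesis using det_2[of A] unfolding \<open>(2::2) = 0\<close> by (simp add: mult.commute)
qed

lemma det_3': "det (A :: complex^3^3) = A$0$0 * A$1$1 * A$2$2 + A$0$1 * A$1$2 * A$2$0
   + A$0$2 * A$1$0 * A$2$1 - A$0$0 * A$1$2 * A$2$1 - A$0$1 * A$1$0 * A$2$2 - A$0$2 * A$1$1 * A$2$0"
proof -
  have "(3::3) = 0" by simp
  then show ?thesis using det_3[of A] unfolding \<open>(3::3) = 0\<close> by (simp add: algebra_simps)
qed

lemma qf_comb: "qf (comb a P b Q c R) = Const a * qf P + Const b * qf Q + Const c * qf R"
  by (simp add: qf_def comb_def sum_distrib_left distrib_right Const_add Const_mult sum.distrib mult.assoc)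

lemma sym_comb: "sym_mat P \<Longrightarrow> sym_mat Q \<Longrightarrow> sym_mat R \<Longrightarrow> sym_mat (comb a P b Q c R)"
  by (simp add: comb_def transpose_def vec_eq_iff)

lemma qf_0 [simp]: "qf 0 = 0"
  by (simp add: qf_def)

lemma ly_add: "ly (v + w) = ly v + ly w"
  and ly_scale: "ly (c *s v) = Const c * ly v"
  and ly_0 [simp]: "ly 0 = 0"
  by (simp_all add: ly_def Const_add Const_mult sum.distrib sum_distrib_left algebra_simps)

lemma qf_congruence: "(\<Sum>j\<in>UNIV. \<Sum>k\<in>UNIV. Const (M $ j $ k) * ly (D $ j) * ly (D $ k))
    = qf (transpose D ** M ** D)"
proof -
  have "qf (transpose D ** M ** D) = (\<Sum>j\<in>UNIV. \<Sum>k\<in>UNIV. \<Sum>l\<in>UNIV. \<Sum>m\<in>UNIV.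
      Const (D $ m $ j * M $ m $ l * D $ l $ k) * Y j * Y k)"
    by (simp add: qf_def matrix_matrix_mult_def transpose_def Const_sum sum_distrib_right)
  also have "\<dots> = (\<Sum>m\<in>UNIV. \<Sum>l\<in>UNIV. \<Sum>j\<in>UNIV. \<Sum>k\<in>UNIV.
      Const (D $ m $ j * M $ m $ l * D $ l $ k) * Y j * Y k)"
    (is "?sum1 = ?sum2")
  proof -
    let ?F = "\<lambda>j k l m. Const (D $ m $ j * M $ m $ l * D $ l $ k) * Y j * Y k"
    have "?sum1 = (\<Sum>j\<in>UNIV. \<Sum>l\<in>UNIV. \<Sum>k\<in>UNIV. \<Sum>m\<in>UNIV. ?F j k l m)"
      by (rule sum.cong[OF refl], rule sum.swap)
    also have "\<dots> = (\<Sum>l\<in>UNIV. \<Sum>j\<in>UNIV. \<Sum>k\<in>UNIV. \<Sum>m\<in>UNIV. ?F j k l m)"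
      by (rule sum.swap)
    also have "\<dots> = (\<Sum>l\<in>UNIV. \<Sum>j\<in>UNIV. \<Sum>m\<in>UNIV. \<Sum>k\<in>UNIV. ?F j k l m)"
      by (rule sum.cong[OF refl], rule sum.cong[OF refl], rule sum.swap)
    also have "\<dots> = (\<Sum>l\<in>UNIV. \<Sum>m\<in>UNIV. \<Sum>j\<in>UNIV. \<Sum>k\<in>UNIV. ?F j k l m)"
      by (rule sum.cong[OF refl], rule sum.swap)
    also have "\<dots> = ?sum2"
      by (rule sum.swap)
    finally show ?thesis .
  qed
  also have "\<dots> = (\<Sum>m\<in>UNIV. \<Sum>l\<in>UNIV. Const (M $ m $ l) * ly (D $ m) * ly (D $ l))"
    by (simp add: ly_def Const_mult sum_distrib_left sum_distrib_right mult_ac)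
  finally show ?thesis ..
qed

section \<open>The action by linear substitution and its orbits\<close>

definition gact :: "complex^2^2 \<Rightarrow> complex^3^3 \<Rightarrow> cpoly \<Rightarrow> cpoly" where
  "gact C D = psubst (case_sum (\<lambda>i. lx (C $ i)) (\<lambda>j. ly (D $ j)))"

lemma gact_simps [simp]:
  "gact C D 0 = 0" "gact C D 1 = 1" "gact C D (Const a) = Const a"
  "gact C D (X i) = lx (C $ i)" "gact C D (Y j) = ly (D $ j)"
  "gact C D (p + q) = gact C D p + gact C D q"
  "gact C D (p * q) = gact C D p * gact C D q"
  "gact C D (p ^ n) = gact C D p ^ n"
  "gact C D (sum g A) = (\<Sum>i\<in>A. gact C D (g i))"
  by (simp_all add: gact_def)

lemma gact_lx [simp]: "gact C D (lx u) = lx (u v* C)"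
  unfolding lx_def[of u]
  by (simp add: lx_def vector_matrix_mult_def Const_add Const_mult sum_distrib_left sum_distrib_right
      sum_2' algebra_simps)

lemma gact_ly [simp]: "gact C D (ly v) = ly (v v* D)"
  unfolding ly_def[of v]
  by (simp add: ly_def vector_matrix_mult_def Const_add Const_mult sum_distrib_left sum_distrib_right
      sum_3' algebra_simps)

lemma gact_qf [simp]: "gact C D (qf M) = qf (transpose D ** M ** D)"
  unfolding qf_congruence[symmetric] by (simp add: qf_def)

text \<open>Substitution reverses composition, so \<open>gact\<close> is a right action;
  \<open>act\<close> is turned into a left action by the inverse matrices.\<close>

lemma gact_gact: "gact C D (gact C' D' p) = gact (C' ** C) (D' ** D) p"
proof -
  have "(\<lambda>v. gact C D (case_sum (\<lambda>i. lx (C' $ i)) (\<lambda>j. ly (D' $ j)) v))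
      = case_sum (\<lambda>i. lx ((C' ** C) $ i)) (\<lambda>j. ly ((D' ** D) $ j))"
    by (rule ext) (auto simp: vector_matrix_mult_def matrix_matrix_mult_def mult.commute
        intro!: arg_cong[where f = lx] arg_cong[where f = ly] split: sum.split)
  then show ?thesis
    by (simp add: gact_def psubst_psubst)
qed

lemma gact_1 [simp]: "gact (mat 1) (mat 1) p = p"
proof -
  have "case_sum (\<lambda>i. lx (mat 1 $ i)) (\<lambda>j. ly (mat 1 $ j)) = Var"
  proof (rule ext)
    have "Const (mat 1 $ i $ k) * X k = (if k = i then X i else 0)" for i k
      by (auto simp: mat_def)
    moreover have "Const (mat 1 $ i $ k) * Y k = (if k = i then Y i else 0)" for i k
      by (auto simp: mat_def)
    ultimately show "case_sum (\<lambda>i. lx (mat 1 $ i)) (\<lambda>j. ly (mat 1 $ j)) v = Var v" for v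
      by (simp add: lx_def ly_def X_def Y_def split: sum.split)
  qed
  then show ?thesis by (simp add: gact_def psubst_Var)
qed

text \<open>The triple transforms like the coefficients of a binary quadratic form under x0 -> a x0
  + b x1, x1 -> c x0 + d x1, while each conic is changed by congruence with
  \<open>D\<close>.\<close>

lemma gact_quad: "gact C D (quad P Q R) = (let P' = transpose D ** P ** D;
     Q' = transpose D ** Q ** D; R' = transpose D ** R ** D;
     a = C$0$0; b = C$0$1; c = C$1$0; d = C$1$1 in
   quad (comb (a\<^sup>2) P' (a * c) Q' (c\<^sup>2) R') (comb (2 * a * b) P' (a * d + b * c) Q' (2 * c * d) R')
     (comb (b\<^sup>2) P' (b * d) Q' (d\<^sup>2) R'))"
proof -
  have "Const 2 = 2" by (metis Const_1 Const_add one_add_one)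
  then show ?thesis
    unfolding Let_def
    by (simp add: quad_def qf_comb lx_def sum_2' power2_eq_square Const_mult Const_add algebra_simps)
qed

lemma sym_congruence: "sym_mat M \<Longrightarrow> sym_mat (transpose D ** M ** D)"
  by (simp add: matrix_transpose_mul matrix_mul_assoc)

lemma act_eq_gact: "act g = gact (matrix_inv (fst g)) (matrix_inv (snd g))"
  by (simp add: act_def gact_def lx_def ly_def)

lemma matrix_inv_inverse:
  fixes A :: "complex^'n^'n"
  assumes "det A \<noteq> 0"
  shows "A ** matrix_inv A = mat 1" "matrix_inv A ** A = mat 1"
proof -
  have "\<exists>B. A ** B = mat 1 \<and> B ** A = mat 1"
    using assms by (simp add: invertible_det_nz[symmetric] invertible_def)
  from someI_ex[OF this] show "A ** matrix_inv A = mat 1" "matrix_inv A ** A = mat 1"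
    by (simp_all add: matrix_inv_def)
qed

lemma matrix_inv_unique:
  fixes A B :: "complex^'n^'n"
  assumes "A ** B = mat 1"
  shows "matrix_inv A = B"
proof -
  have "det A * det B = 1" using arg_cong[OF assms, of det] by (simp add: det_mul)
  then have "matrix_inv A ** A = mat 1" by (intro matrix_inv_inverse) auto
  then have "matrix_inv A ** (A ** B) = B" by (simp add: matrix_mul_assoc)
  with assms show ?thesis by simp
qed

lemma det_1_inverse:
  fixes A :: "complex^'n^'n"
  assumes "det A = 1"
  shows "A ** matrix_inv A = mat 1" "matrix_inv A ** A = mat 1" "det (matrix_inv A) = 1"
    "matrix_inv (matrix_inv A) = A"
proof -
  show *: "A ** matrix_inv A = mat 1" "matrix_inv A ** A = mat 1"
    using assms by (simp_all add: matrix_inv_inverse)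
  show "det (matrix_inv A) = 1"
    using arg_cong[OF *(1), of det] assms by (simp add: det_mul)
  show "matrix_inv (matrix_inv A) = A"
    by (rule matrix_inv_unique) (rule *)
qed

text \<open>Inversion permutes both special linear groups, so the inverses in \<open>act\<close> may
  be dropped when only orbits matter.\<close>

lemma orbit_eq: "orbit f = {gact C D f | C D. det C = 1 \<and> det D = 1}"
proof (intro set_eqI iffI)
  fix p assume "p \<in> orbit f"
  then show "p \<in> {gact C D f | C D. det C = 1 \<and> det D = 1}"
    by (auto simp: orbit_def G_def act_eq_gact) (metis det_1_inverse(3))
next
  fix p assume "p \<in> {gact C D f | C D. det C = 1 \<and> det D = 1}"
  then obtain C D where CD: "p = gact C D f" "det C = 1" "det D = 1" by auto
  then have "p = act (matrix_inv C, matrix_inv D) f" "(matrix_inv C, matrix_inv D) \<in> G"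
    by (simp_all add: act_eq_gact det_1_inverse G_def)
  then show "p \<in> orbit f" by (auto simp: orbit_def)
qed

lemma orbit_gact:
  assumes "det C = 1" "det D = 1"
  shows "orbit (gact C D f) = orbit f"
proof -
  have sub: "orbit (gact C D f) \<subseteq> orbit f" if "det C = 1" "det D = 1" for C D f
  proof
    fix p assume "p \<in> orbit (gact C D f)"
    then obtain C' D' where p: "p = gact C' D' (gact C D f)" "det C' = 1" "det D' = 1"
      by (auto simp: orbit_eq)
    with that have "p = gact (C ** C') (D ** D') f" "det (C ** C') = 1" "det (D ** D') = 1"
      by (simp_all add: gact_gact det_mul)
    then show "p \<in> orbit f" unfolding orbit_eq by blast
  qed
  have "gact (matrix_inv C) (matrix_inv D) (gact C D f) = f"
    using assms by (simp add: gact_gact det_1_inverse)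
  then have "orbit f \<subseteq> orbit (gact C D f)"
    using sub[of "matrix_inv C" "matrix_inv D" "gact C D f"] assms by (simp add: det_1_inverse)
  with sub[OF assms] show ?thesis by blast
qed

lemma orbit_self: "f \<in> orbit f"
  unfolding orbit_eq using gact_1[of f] by (metis (mono_tags, lifting) det_I mem_Collect_eq)

lemma semistable_gact:
  "det C = 1 \<Longrightarrow> det D = 1 \<Longrightarrow> git_semistable (gact C D f) \<longleftrightarrow> git_semistable f"
  by (simp add: git_semistable_def orbit_gact)

section \<open>Coefficients of (2,2)-forms\<close>

definition bimono :: "nat \<Rightarrow> nat \<Rightarrow> 3 \<Rightarrow> 3 \<Rightarrow> mono" where
  "bimono a b j k = Poly_Mapping.single (Inl 0) a + Poly_Mapping.single (Inl 1) b
     + Poly_Mapping.single (Inr j) 1 + Poly_Mapping.single (Inr k) 1"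

lemma lookup_bimono_Inl:
  "Poly_Mapping.lookup (bimono a b j k) (Inl 0) = a" "Poly_Mapping.lookup (bimono a b j k) (Inl 1) = b"
  unfolding bimono_def lookup_add by (simp_all add: lookup_single)

lemma lookup_bimono_Inr:
  "Poly_Mapping.lookup (bimono a b j k) (Inr l) = (if l = j then 1 else 0) + (if l = k then 1 else 0)"
  unfolding bimono_def lookup_add lookup_single when_def by simp

lemmas lookup_bimono = lookup_bimono_Inl lookup_bimono_Inr

lemma bimono_eq_iff: "bimono a b j k = bimono a' b' j' k' \<longleftrightarrow>
   a = a' \<and> b = b' \<and> (j = j' \<and> k = k' \<or> j = k' \<and> k = j')"
proof
  assume "bimono a b j k = bimono a' b' j' k'"
  then have eq: "Poly_Mapping.lookup (bimono a b j k) v = Poly_Mapping.lookup (bimono a' b' j' k') v" for v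
    by simp
  have Y: "(if l = j then 1 else 0) + (if l = k then 1 else 0)
      = (if l = j' then 1 else 0) + (if l = k' then 1 else 0::nat)" for l
    using eq[of "Inr l"] by (simp add: lookup_bimono)
  have "j = j' \<or> j = k'" using Y[of j] by (auto split: if_splits)
  then have "j = j' \<and> k = k' \<or> j = k' \<and> k = j'"
    using Y[of k] by (auto split: if_splits)
  then show "a = a' \<and> b = b' \<and> (j = j' \<and> k = k' \<or> j = k' \<and> k = j')"
    using eq[of "Inl 0"] eq[of "Inl 1"] by (simp add: lookup_bimono)
next
  assume "a = a' \<and> b = b' \<and> (j = j' \<and> k = k' \<or> j = k' \<and> k = j')"
  then show "bimono a b j k = bimono a' b' j' k'"
    by (auto simp: bimono_def add_ac)
qed

lemma monomial_eq_bimono: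
  "X 0 ^ a * X 1 ^ b * (Y j * Y k) = Poly_Mapping.single (bimono a b j k) 1"
proof -
  have "(\<Sum>i<n. Poly_Mapping.single v 1) = Poly_Mapping.single v n" for n :: nat and v :: "2 + 3"
    by (induction n) (auto simp flip: single_add)
  then have "Var v ^ n = Poly_Mapping.single (Poly_Mapping.single v n) 1" for n v
    by (simp add: Var_def single_power)
  then show ?thesis
    by (simp add: X_def Y_def bimono_def mult_single add_ac)
      (simp add: Var_def mult_single add_ac)
qed

lemma lookup_monomial_qf:
  "Poly_Mapping.lookup (X 0 ^ a * X 1 ^ b * qf M) (bimono a' b' j k)
    = (if a = a' \<and> b = b' then if j = k then M $ j $ j else M $ j $ k + M $ k $ j else 0)"
proof -
  have "X 0 ^ a * X 1 ^ b * qf M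
      = (\<Sum>l\<in>UNIV. \<Sum>m\<in>UNIV. Const (M $ l $ m) * (X 0 ^ a * X 1 ^ b * (Y l * Y m)))"
    by (simp add: qf_def sum_distrib_left mult_ac)
  then have eq: "Poly_Mapping.lookup (X 0 ^ a * X 1 ^ b * qf M) (bimono a' b' j k)
     = (\<Sum>l\<in>UNIV. \<Sum>m\<in>UNIV. M $ l $ m *
          (if a = a' \<and> b = b' \<and> (l = j \<and> m = k \<or> l = k \<and> m = j) then 1 else 0))"
    unfolding monomial_eq_bimono
    by (simp add: lookup_sum lookup_Const_mult lookup_single when_def bimono_eq_iff)
  show ?thesis
  proof (cases "a = a' \<and> b = b'")
    case True
    show ?thesis
      using exhaust_3'[of j] exhaust_3'[of k] unfolding eq
      by (elim disjE) (simp_all add: True sum_3')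
  qed (auto simp: eq)
qed

lemma lookup_quad:
  "Poly_Mapping.lookup (quad P Q R) (bimono 2 0 j k) = (if j = k then P $ j $ j else P $ j $ k + P $ k $ j)"
  "Poly_Mapping.lookup (quad P Q R) (bimono 1 1 j k) = (if j = k then Q $ j $ j else Q $ j $ k + Q $ k $ j)"
  "Poly_Mapping.lookup (quad P Q R) (bimono 0 2 j k) = (if j = k then R $ j $ j else R $ j $ k + R $ k $ j)"
  using lookup_monomial_qf[of 2 0 P] lookup_monomial_qf[of 1 1 Q] lookup_monomial_qf[of 0 2 R]
  unfolding quad_def by (simp_all add: lookup_add)

section \<open>An invariant of degree 6\<close>

lemma lx_bihom [simp]: "lx u \<in> bihom 1 0"
  and ly_bihom [simp]: "ly v \<in> bihom 0 1"
  unfolding lx_def ly_def by (intro bihom_sum bihom_Const_mult bihom_X bihom_Y)+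

lemma qf_bihom [simp]: "qf M \<in> bihom 0 2"
  unfolding qf_def mult.assoc
  using bihom_mult[OF bihom_Y bihom_Y] by (intro bihom_sum bihom_Const_mult) (simp add: numeral_2_eq_2)

lemma quad_in_V [simp]: "quad P Q R \<in> V"
proof -
  have "X i * X k * qf M \<in> bihom (1 + 1 + 0) (0 + 0 + 2)" for i k M
    by (intro bihom_mult bihom_X qf_bihom)
  then have "X i * X k * qf M \<in> V" for i k M
    by (simp only: one_add_one add_0_left add_0_right)
  then show ?thesis
    unfolding quad_def power2_eq_square by (intro bihom_add)
qed

lemma bihom_0_1: "p \<in> bihom 0 1 \<Longrightarrow> \<exists>v. p = ly v"
proof -
  assume "p \<in> bihom 0 1"
  then obtain q where q: "\<And>j. q j \<in> bihom 0 0" "p = (\<Sum>j\<in>UNIV. Y j * q j)"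
    using bihom_Suc_Y[of p 0 0] by auto
  have "\<forall>j. \<exists>c. q j = Const c" using q(1) bihom_0_0 by blast
  then obtain c where c: "\<And>j. q j = Const (c j)" by (auto dest: choice)
  with q(2) show ?thesis
    by (intro exI[of _ "\<chi> j. c j"]) (simp add: ly_def c mult.commute)
qed

lemma bihom_1_0: "p \<in> bihom 1 0 \<Longrightarrow> \<exists>u. p = lx u"
proof -
  assume "p \<in> bihom 1 0"
  then obtain q where q: "\<And>j. q j \<in> bihom 0 0" "p = (\<Sum>j\<in>UNIV. X j * q j)"
    using bihom_Suc_X[of p 0 0] by auto
  have "\<forall>j. \<exists>c. q j = Const c" using q(1) bihom_0_0 by blast
  then obtain c where c: "\<And>j. q j = Const (c j)" by (auto dest: choice)
  with q(2) show ?thesis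
    by (intro exI[of _ "\<chi> j. c j"]) (simp add: lx_def c mult.commute)
qed

lemma bihom_0_2: "p \<in> bihom 0 2 \<Longrightarrow> \<exists>M. sym_mat M \<and> p = qf M"
proof -
  assume "p \<in> bihom 0 2"
  then obtain q where q: "\<And>j. q j \<in> bihom 0 1" "p = (\<Sum>j\<in>UNIV. Y j * q j)"
    using bihom_Suc_Y[of p 0 1] by (auto simp: numeral_2_eq_2)
  have "\<forall>j. \<exists>c. q j = ly c" using q(1) bihom_0_1 by blast
  then obtain c where c: "\<And>j. q j = ly (c j)" by (auto dest: choice)
  \<comment> \<open>\<open>S\<close> is p with all coefficients halved. Writing p = S + S and
    exchanging the summation indices in one copy symmetrizes the matrix.\<close>
  define S where "S = (\<Sum>j\<in>UNIV. \<Sum>k\<in>UNIV. Const (c j $ k / 2) * Y j * Y k)"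
  have "p = S + S"
    unfolding q(2) c ly_def S_def sum_distrib_left sum.distrib[symmetric]
    by (intro sum.cong refl) (simp add: algebra_simps flip: distrib_left Const_add)
  moreover have "S = (\<Sum>j\<in>UNIV. \<Sum>k\<in>UNIV. Const (c k $ j / 2) * Y j * Y k)"
    unfolding S_def by (subst sum.swap) (simp add: mult_ac)
  ultimately have "p = S + (\<Sum>j\<in>UNIV. \<Sum>k\<in>UNIV. Const (c k $ j / 2) * Y j * Y k)"
    by simp
  also have "\<dots> = qf (\<chi> j k. c j $ k / 2 + c k $ j / 2)"
    unfolding S_def qf_def by (simp add: Const_add distrib_right sum.distrib)
  finally show ?thesis
    by (intro exI[of _ "\<chi> j k. c j $ k / 2 + c k $ j / 2"] conjI)
      (auto intro!: sym_matI simp: add.commute)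
qed

lemma bihom_Suc_X':
  assumes "p \<in> bihom (Suc a) b"
  obtains q r where "q \<in> bihom a b" "r \<in> bihom a b" "p = X 0 * q + X 1 * r"
  using bihom_Suc_X[OF assms] by (auto simp: sum_2')

lemma bihom_1_1: "p \<in> bihom 1 1 \<Longrightarrow> \<exists>L M. p = X 0 * ly L + X 1 * ly M"
  using bihom_Suc_X'[of p 0 1] bihom_0_1 by (metis One_nat_def)

lemma bihom_1_2: "p \<in> bihom 1 2 \<Longrightarrow> \<exists>P Q. sym_mat P \<and> sym_mat Q \<and> p = X 0 * qf P + X 1 * qf Q"
  using bihom_Suc_X'[of p 0 2] bihom_0_2 by (metis One_nat_def)

lemma bihom_2_0: "p \<in> bihom 2 0 \<Longrightarrow>
  \<exists>a b c. p = Const a * (X 0)\<^sup>2 + Const b * (X 0 * X 1) + Const c * (X 1)\<^sup>2"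
proof -
  assume "p \<in> bihom 2 0"
  then obtain q r where qr: "q \<in> bihom 1 0" "r \<in> bihom 1 0" "p = X 0 * q + X 1 * r"
    using bihom_Suc_X'[of p 1 0] by (auto simp: numeral_2_eq_2)
  obtain u v where "q = lx u" "r = lx v" using bihom_1_0 qr(1,2) by metis
  with qr(3) have "p = Const (u $ 0) * (X 0)\<^sup>2 + Const (u $ 1 + v $ 0) * (X 0 * X 1) + Const (v $ 1) * (X 1)\<^sup>2"
    by (simp add: lx_def sum_2' Const_add power2_eq_square algebra_simps)
  then show ?thesis by blast
qed

lemma bihom_2_1: "p \<in> bihom 2 1 \<Longrightarrow>
  \<exists>A B C. p = (X 0)\<^sup>2 * ly A + X 0 * X 1 * ly B + (X 1)\<^sup>2 * ly C"
proof -
  assume "p \<in> bihom 2 1"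
  then obtain q r where qr: "q \<in> bihom 1 1" "r \<in> bihom 1 1" "p = X 0 * q + X 1 * r"
    using bihom_Suc_X'[of p 1 1] by (auto simp: numeral_2_eq_2)
  obtain A B C D where "q = X 0 * ly A + X 1 * ly B" "r = X 0 * ly C + X 1 * ly D"
    using bihom_1_1 qr(1,2) by metis
  with qr(3) have "p = (X 0)\<^sup>2 * ly A + X 0 * X 1 * ly (B + C) + (X 1)\<^sup>2 * ly D"
    by (simp add: ly_add power2_eq_square algebra_simps)
  then show ?thesis by blast
qed

lemma peval_lx [simp]: "peval x y (lx u) = (\<Sum>i\<in>UNIV. u $ i * x $ i)"
  and peval_ly [simp]: "peval x y (ly v) = (\<Sum>j\<in>UNIV. v $ j * y $ j)"
  and peval_qf: "peval x y (qf M) = (\<Sum>j\<in>UNIV. y $ j * (M *v y) $ j)"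
  by (simp_all add: lx_def ly_def qf_def matrix_vector_mult_def sum_distrib_left mult_ac)

lemma partial_lx: "partial (Inl i) (lx u) = Const (u $ i)" "partial (Inr j) (lx u) = 0"
  by (simp_all add: lx_def partial_sum partial_mult if_distrib cong: if_cong)

lemma partial_qf_x: "partial (Inl i) (qf M) = 0"
  by (simp add: qf_def partial_sum partial_mult)

lemma peval_partial_qf:
  assumes "sym_mat M"
  shows "peval x y (partial (Inr j) (qf M)) = 2 * (M *v y) $ j"
proof -
  have "peval x y (partial (Inr j) (qf M))
    = (\<Sum>l\<in>UNIV. \<Sum>k\<in>UNIV. (if l = j then M $ l $ k * y $ k else 0) + (if k = j then M $ l $ k * y $ l else 0))"
    unfolding qf_def partial_sum peval_simps
    by (intro sum.cong refl) (auto simp: partial_mult)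
  also have "\<dots> = (\<Sum>k\<in>UNIV. M $ j $ k * y $ k) + (\<Sum>l\<in>UNIV. M $ l $ j * y $ l)"
    by (simp add: sum.distrib sum.delta sum.swap[of "\<lambda>l k. if l = j then M $ l $ k * y $ k else 0"])
  also have "\<dots> = 2 * (M *v y) $ j"
    using sym_matD[OF assms] by (simp add: matrix_vector_mult_def)
  finally show ?thesis .
qed

section \<open>Ternary cubics and the discriminant of their contraction\<close>

definition cubic_form :: "(complex \<Rightarrow> complex \<Rightarrow> complex \<Rightarrow> complex) \<Rightarrow> bool" where
  "cubic_form F \<longleftrightarrow> (\<exists>p q r s t u v w m n. \<forall>x y z. F x y z =
     p * x^3 + q * y^3 + r * z^3 + s * (x^2 * y) + t * (x * y^2) + u * (x^2 * z) + v * (x * z^2)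
       + w * (y^2 * z) + m * (y * z^2) + n * (x * y * z))"

lemma cubic_form_mult: "cubic_form (\<lambda>x y z. (x * a + y * b + z * c) * (x * d + y * e + z * f) * (x * g + y * h + z * i))"
  unfolding cubic_form_def
  by (rule exI[of _ "a * d * g"], rule exI[of _ "b * e * h"], rule exI[of _ "c * f * i"],
      rule exI[of _ "a * d * h + a * e * g + b * d * g"], rule exI[of _ "a * e * h + b * d * h + b * e * g"],
      rule exI[of _ "a * d * i + a * f * g + c * d * g"], rule exI[of _ "a * f * i + c * d * i + c * f * g"],
      rule exI[of _ "b * e * i + b * f * h + c * e * h"], rule exI[of _ "b * f * i + c * e * i + c * f * h"],
      rule exI[of _ "a * e * i + a * f * h + b * d * i + b * f * g + c * d * h + c * e * g"])
    (simp add: power2_eq_square power3_eq_cube algebra_simps)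

lemma cubic_form_lin:
  assumes "cubic_form F" "cubic_form H"
  shows "cubic_form (\<lambda>x y z. F x y z + c * H x y z)"
proof -
  obtain p q r s t u v w m n where F:
    "\<forall>x y z. F x y z = p * x^3 + q * y^3 + r * z^3 + s * (x^2 * y) + t * (x * y^2) + u * (x^2 * z)
       + v * (x * z^2) + w * (y^2 * z) + m * (y * z^2) + n * (x * y * z)"
    using assms(1) unfolding cubic_form_def by (elim exE that)
  obtain p' q' r' s' t' u' v' w' m' n' where H:
    "\<forall>x y z. H x y z = p' * x^3 + q' * y^3 + r' * z^3 + s' * (x^2 * y) + t' * (x * y^2) + u' * (x^2 * z)
       + v' * (x * z^2) + w' * (y^2 * z) + m' * (y * z^2) + n' * (x * y * z)"
    using assms(2) unfolding cubic_form_def by (elim exE that)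
  show ?thesis unfolding cubic_form_def
    by (rule exI[of _ "p + c * p'"],
      rule exI[of _ "q + c * q'"],
      rule exI[of _ "r + c * r'"],
      rule exI[of _ "s + c * s'"],
      rule exI[of _ "t + c * t'"],
      rule exI[of _ "u + c * u'"],
      rule exI[of _ "v + c * v'"],
      rule exI[of _ "w + c * w'"],
      rule exI[of _ "m + c * m'"],
      rule exI[of _ "n + c * n'"])
      (simp add: F H algebra_simps)
qed

definition det_form :: "complex^3^3 \<Rightarrow> complex^3^3 \<Rightarrow> complex^3^3 \<Rightarrow> complex \<Rightarrow> complex \<Rightarrow> complex \<Rightarrow> complex" where
  "det_form P Q R x y z = det (comb x P y Q z R)"

text \<open>Each of the six Leibniz terms is a product of three linear forms in x, y, z. Mere
  existence of the ten coefficients suffices later, since \<open>invariant\<close> recovers them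
  from values.\<close>

lemma cubic_det_form: "cubic_form (det_form P Q R)"
proof -
  let ?m = "\<lambda>i j k l m n x y z. (x * P$i$j + y * Q$i$j + z * R$i$j) * (x * P$k$l + y * Q$k$l + z * R$k$l)
     * (x * P$m$n + y * Q$m$n + z * R$m$n)"
  have "det_form P Q R = (\<lambda>x y z. ?m 0 0 1 1 2 2 x y z + 1 * ?m 0 1 1 2 2 0 x y z + 1 * ?m 0 2 1 0 2 1 x y z
     + (-1) * ?m 0 0 1 2 2 1 x y z + (-1) * ?m 0 1 1 0 2 2 x y z + (-1) * ?m 0 2 1 1 2 0 x y z)"
    by (intro ext) (simp add: det_form_def det_3' comb_def)
  then show ?thesis
    by (simp only:) (intro cubic_form_lin cubic_form_mult)
qed

text \<open>The group \<open>SL\<^sub>2\<close> acts on \<open>(x, y, z)\<close>, the coordinates on binary quadratic forms, preserving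
  the conic \<open>x z - y\<^sup>2\<close>. The dual operator \<open>4 \<partial>\<^sub>x \<partial>\<^sub>z - \<partial>\<^sub>y\<^sup>2\<close> maps a cubic to a linear form (up to the
  factor 2 this is \<open>l0 x + l1 y + l2 z\<close>), whose discriminant is the invariant. The coefficients
  of the cubic are written as polarizations, that is, through its values.\<close>

definition invariant :: "(complex \<Rightarrow> complex \<Rightarrow> complex \<Rightarrow> complex) \<Rightarrow> complex" where
  "invariant F = (let
      s = (F 1 1 0 - F 1 (-1) 0) / 2 - F 0 1 0; t = (F 1 1 0 - F (-1) 1 0) / 2 - F 1 0 0;
      u = (F 1 0 1 - F 1 0 (-1)) / 2 - F 0 0 1; v = (F 1 0 1 - F (-1) 0 1) / 2 - F 1 0 0;
      w = (F 0 1 1 - F 0 1 (-1)) / 2 - F 0 0 1; m = (F 0 1 1 - F 0 (-1) 1) / 2 - F 0 1 0;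
      n = F 1 1 1 - F 1 0 0 - F 0 1 0 - F 0 0 1 - s - t - u - v - w - m;
      l0 = 4 * u - t; l1 = 2 * n - 3 * F 0 1 0; l2 = 4 * v - w
    in 4 * l0 * l2 - l1\<^sup>2)"

lemma invariant_coeffs:
  assumes "\<And>x y z. F x y z = p * x^3 + q * y^3 + r * z^3 + s * (x^2 * y) + t * (x * y^2) + u * (x^2 * z) + v * (x * z^2)
       + w * (y^2 * z) + m * (y * z^2) + n * (x * y * z)"
  shows "invariant F = 4 * (4 * u - t) * (4 * v - w) - (2 * n - 3 * q)\<^sup>2"
proof -
  have eqs: "(F 1 1 0 - F 1 (-1) 0) / 2 - F 0 1 0 = s" "(F 1 1 0 - F (-1) 1 0) / 2 - F 1 0 0 = t"
    "(F 1 0 1 - F 1 0 (-1)) / 2 - F 0 0 1 = u" "(F 1 0 1 - F (-1) 0 1) / 2 - F 1 0 0 = v"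
    "(F 0 1 1 - F 0 1 (-1)) / 2 - F 0 0 1 = w" "(F 0 1 1 - F 0 (-1) 1) / 2 - F 0 1 0 = m"
    "F 1 1 1 - F 1 0 0 - F 0 1 0 - F 0 0 1 - s - t - u - v - w - m = n" "F 0 1 0 = q"
    by (simp_all add: assms field_simps)
  show ?thesis
    \<comment> \<open>The expression for n contains the six mixed coefficients before it, so these
      are rewritten first.\<close>
    unfolding invariant_def Let_def eqs(1-6) unfolding eqs(7) unfolding eqs(8) ..
qed

text \<open>The substitution is the symmetric square of an element of SL_2. Contraction commutes
  with it up to det^2, and the discriminant changes by another det^2; all these powers are
  1.\<close>

lemma invariant_SL2:
  assumes "cubic_form F" and det: "a * d - b * c = 1"
  shows "invariant (\<lambda>x y z. F (a\<^sup>2 * x + 2 * a * b * y + b\<^sup>2 * z) (a * c * x + (a * d + b * c) * y + b * d * z)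
     (c\<^sup>2 * x + 2 * c * d * y + d\<^sup>2 * z)) = invariant F"
    (is "invariant ?F = _")
proof -
  obtain p q r s t u v w m n where
    "\<forall>x y z. F x y z = p * x^3 + q * y^3 + r * z^3 + s * (x^2 * y) + t * (x * y^2) + u * (x^2 * z)
       + v * (x * z^2) + w * (y^2 * z) + m * (y * z^2) + n * (x * y * z)"
    using assms(1) unfolding cubic_form_def by (elim exE that)
  then have F: "F x y z = p * x^3 + q * y^3 + r * z^3 + s * (x^2 * y) + t * (x * y^2) + u * (x^2 * z)
       + v * (x * z^2) + w * (y^2 * z) + m * (y * z^2) + n * (x * y * z)" for x y z
    by blast
  \<comment> \<open>With names for the nine entries the cubic is expanded as under an arbitrary
    linear substitution; their expressions in a, b, c, d enter only in the identities below.\<close>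
  define a1 b1 c1 a2 b2 c2 a3 b3 c3 where lin: "a1 = a\<^sup>2" "b1 = 2 * a * b" "c1 = b\<^sup>2"
    "a2 = a * c" "b2 = a * d + b * c" "c2 = b * d" "a3 = c\<^sup>2" "b3 = 2 * c * d" "c3 = d\<^sup>2"
  define p' where "p' = p * (a1 * a1 * a1) + q * (a2 * a2 * a2) + r * (a3 * a3 * a3) + s * (a1 * a1 * a2) + t * (a1 *
      a2 * a2) + u * (a1 * a1 * a3) + v * (a1 * a3 * a3) + w * (a2 * a2 * a3) + m * (a2 * a3 * a3) +
      n * (a1 * a2 * a3)"
  define q' where "q' = p * (b1 * b1 * b1) + q * (b2 * b2 * b2) + r * (b3 * b3 * b3) + s * (b1 * b1 * b2) + t * (b1 *
      b2 * b2) + u * (b1 * b1 * b3) + v * (b1 * b3 * b3) + w * (b2 * b2 * b3) + m * (b2 * b3 * b3) +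
      n * (b1 * b2 * b3)"
  define r' where "r' = p * (c1 * c1 * c1) + q * (c2 * c2 * c2) + r * (c3 * c3 * c3) + s * (c1 * c1 * c2) + t * (c1 *
      c2 * c2) + u * (c1 * c1 * c3) + v * (c1 * c3 * c3) + w * (c2 * c2 * c3) + m * (c2 * c3 * c3) +
      n * (c1 * c2 * c3)"
  define s' where "s' = p * (3 * a1 * a1 * b1) + q * (3 * a2 * a2 * b2) + r * (3 * a3 * a3 * b3) + s * (a1 * a1 * b2 +
      2 * a1 * a2 * b1) + t * (2 * a1 * a2 * b2 + a2 * a2 * b1) + u * (a1 * a1 * b3 + 2 * a1 * a3 *
      b1) + v * (2 * a1 * a3 * b3 + a3 * a3 * b1) + w * (a2 * a2 * b3 + 2 * a2 * a3 * b2) + m * (2 *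
      a2 * a3 * b3 + a3 * a3 * b2) + n * (a1 * a2 * b3 + a1 * a3 * b2 + a2 * a3 * b1)"
  define t' where "t' = p * (3 * a1 * b1 * b1) + q * (3 * a2 * b2 * b2) + r * (3 * a3 * b3 * b3) + s * (2 * a1 * b1 *
      b2 + a2 * b1 * b1) + t * (a1 * b2 * b2 + 2 * a2 * b1 * b2) + u * (2 * a1 * b1 * b3 + a3 * b1 *
      b1) + v * (a1 * b3 * b3 + 2 * a3 * b1 * b3) + w * (2 * a2 * b2 * b3 + a3 * b2 * b2) + m * (a2 *
      b3 * b3 + 2 * a3 * b2 * b3) + n * (a1 * b2 * b3 + a2 * b1 * b3 + a3 * b1 * b2)"
  define u' where "u' = p * (3 * a1 * a1 * c1) + q * (3 * a2 * a2 * c2) + r * (3 * a3 * a3 * c3) + s * (a1 * a1 * c2 +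
      2 * a1 * a2 * c1) + t * (2 * a1 * a2 * c2 + a2 * a2 * c1) + u * (a1 * a1 * c3 + 2 * a1 * a3 *
      c1) + v * (2 * a1 * a3 * c3 + a3 * a3 * c1) + w * (a2 * a2 * c3 + 2 * a2 * a3 * c2) + m * (2 *
      a2 * a3 * c3 + a3 * a3 * c2) + n * (a1 * a2 * c3 + a1 * a3 * c2 + a2 * a3 * c1)"
  define v' where "v' = p * (3 * a1 * c1 * c1) + q * (3 * a2 * c2 * c2) + r * (3 * a3 * c3 * c3) + s * (2 * a1 * c1 *
      c2 + a2 * c1 * c1) + t * (a1 * c2 * c2 + 2 * a2 * c1 * c2) + u * (2 * a1 * c1 * c3 + a3 * c1 *
      c1) + v * (a1 * c3 * c3 + 2 * a3 * c1 * c3) + w * (2 * a2 * c2 * c3 + a3 * c2 * c2) + m * (a2 *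
      c3 * c3 + 2 * a3 * c2 * c3) + n * (a1 * c2 * c3 + a2 * c1 * c3 + a3 * c1 * c2)"
  define w' where "w' = p * (3 * b1 * b1 * c1) + q * (3 * b2 * b2 * c2) + r * (3 * b3 * b3 * c3) + s * (b1 * b1 * c2 +
      2 * b1 * b2 * c1) + t * (2 * b1 * b2 * c2 + b2 * b2 * c1) + u * (b1 * b1 * c3 + 2 * b1 * b3 *
      c1) + v * (2 * b1 * b3 * c3 + b3 * b3 * c1) + w * (b2 * b2 * c3 + 2 * b2 * b3 * c2) + m * (2 *
      b2 * b3 * c3 + b3 * b3 * c2) + n * (b1 * b2 * c3 + b1 * b3 * c2 + b2 * b3 * c1)"
  define m' where "m' = p * (3 * b1 * c1 * c1) + q * (3 * b2 * c2 * c2) + r * (3 * b3 * c3 * c3) + s * (2 * b1 * c1 *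
      c2 + b2 * c1 * c1) + t * (b1 * c2 * c2 + 2 * b2 * c1 * c2) + u * (2 * b1 * c1 * c3 + b3 * c1 *
      c1) + v * (b1 * c3 * c3 + 2 * b3 * c1 * c3) + w * (2 * b2 * c2 * c3 + b3 * c2 * c2) + m * (b2 *
      c3 * c3 + 2 * b3 * c2 * c3) + n * (b1 * c2 * c3 + b2 * c1 * c3 + b3 * c1 * c2)"
  define n' where "n' = p * (6 * a1 * b1 * c1) + q * (6 * a2 * b2 * c2) + r * (6 * a3 * b3 * c3) + s * (2 * a1 * b1 *
      c2 + 2 * a1 * b2 * c1 + 2 * a2 * b1 * c1) + t * (2 * a1 * b2 * c2 + 2 * a2 * b1 * c2 + 2 * a2 *
      b2 * c1) + u * (2 * a1 * b1 * c3 + 2 * a1 * b3 * c1 + 2 * a3 * b1 * c1) + v * (2 * a1 * b3 * c3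
      + 2 * a3 * b1 * c3 + 2 * a3 * b3 * c1) + w * (2 * a2 * b2 * c3 + 2 * a2 * b3 * c2 + 2 * a3 * b2
      * c2) + m * (2 * a2 * b3 * c3 + 2 * a3 * b2 * c3 + 2 * a3 * b3 * c2) + n * (a1 * b2 * c3 + a1 *
      b3 * c2 + a2 * b1 * c3 + a2 * b3 * c1 + a3 * b1 * c2 + a3 * b2 * c1)"
  note coeffs = p'_def q'_def r'_def s'_def t'_def u'_def v'_def w'_def m'_def n'_def
  have "F (a1 * x + b1 * y + c1 * z) (a2 * x + b2 * y + c2 * z) (a3 * x + b3 * y + c3 * z)
     = p' * x^3 + q' * y^3 + r' * z^3 + s' * (x^2 * y) + t' * (x * y^2) + u' * (x^2 * z)
       + v' * (x * z^2) + w' * (y^2 * z) + m' * (y * z^2) + n' * (x * y * z)" for x y z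
    unfolding F coeffs by (simp add: power2_eq_square power3_eq_cube algebra_simps)
  then have "invariant ?F = 4 * (4 * u' - t') * (4 * v' - w') - (2 * n' - 3 * q')\<^sup>2"
    unfolding lin by (rule invariant_coeffs)
  \<comment> \<open>This and the next two identities state equivariance: the contraction of the new
    cubic is det^2 times the old linear form composed with the substitution.\<close>
  moreover have "4 * u' - t' = (a * d - b * c)\<^sup>2 * (a\<^sup>2 * (4 * u - t) + a * c * (2 * n - 3 * q) + c\<^sup>2 * (4 * v - w))"
    unfolding coeffs lin by algebra
  moreover have "2 * n' - 3 * q' = (a * d - b * c)\<^sup>2 *
      (2 * a * b * (4 * u - t) + (a * d + b * c) * (2 * n - 3 * q) + 2 * c * d * (4 * v - w))"
    unfolding coeffs lin by algebra
  moreover have "4 * v' - w' = (a * d - b * c)\<^sup>2 * (b\<^sup>2 * (4 * u - t) + b * d * (2 * n - 3 * q) + d\<^sup>2 * (4 * v - w))"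
    unfolding coeffs lin by algebra
  \<comment> \<open>The discriminant is the quadratic form dual to the conic x z - y^2, hence it is
    multiplied by det^2.\<close>
  moreover have "4 * (a\<^sup>2 * l + a * c * k + c\<^sup>2 * h) * (b\<^sup>2 * l + b * d * k + d\<^sup>2 * h)
      - (2 * a * b * l + (a * d + b * c) * k + 2 * c * d * h)\<^sup>2 = (a * d - b * c)\<^sup>2 * (4 * l * h - k\<^sup>2)" for h k l
    by algebra
  ultimately have "invariant ?F = 4 * (4 * u - t) * (4 * v - w) - (2 * n - 3 * q)\<^sup>2"
    by (simp add: det)
  then show ?thesis using invariant_coeffs[OF F] by simp
qed

section \<open>Semi-stability and one-parameter subgroups\<close>

abbreviation quad_invariant :: "complex^3^3 \<Rightarrow> complex^3^3 \<Rightarrow> complex^3^3 \<Rightarrow> complex" where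
  "quad_invariant P Q R \<equiv> invariant (det_form P Q R)"

text \<open>\<open>D\<close> multiplies every determinant in the net of conics by (det D)^2 = 1, and
  \<open>C\<close> only substitutes in the coordinates x, y, z of the net, which is covered by
  \<open>invariant_SL2\<close>.\<close>

lemma quad_invariant_gact:
  assumes "det C = 1" "det D = 1" and sym: "sym_mat P" "sym_mat Q" "sym_mat R"
  obtains P' Q' R' where "gact C D (quad P Q R) = quad P' Q' R'"
    "quad_invariant P' Q' R' = quad_invariant P Q R" "sym_mat P'" "sym_mat Q'" "sym_mat R'"
proof -
  define a b c d where abcd: "a = C$0$0" "b = C$0$1" "c = C$1$0" "d = C$1$1"
  let ?T = "\<lambda>M. transpose D ** M ** D"
  let ?P = "comb (a\<^sup>2) (?T P) (a * c) (?T Q) (c\<^sup>2) (?T R)"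
  let ?Q = "comb (2 * a * b) (?T P) (a * d + b * c) (?T Q) (2 * c * d) (?T R)"
  let ?R = "comb (b\<^sup>2) (?T P) (b * d) (?T Q) (d\<^sup>2) (?T R)"
  have ad: "a * d - b * c = 1" using assms(1) by (simp add: abcd det_2')
  have comb: "comb x (?T P) y (?T Q) z (?T R) = ?T (comb x P y Q z R)" for x y z
    by (simp add: comb_def matrix_matrix_mult_def transpose_def vec_eq_iff sum_3' algebra_simps)
  have "det_form ?P ?Q ?R x y z = det_form P Q R (a\<^sup>2 * x + 2 * a * b * y + b\<^sup>2 * z)
      (a * c * x + (a * d + b * c) * y + b * d * z) (c\<^sup>2 * x + 2 * c * d * y + d\<^sup>2 * z)" for x y z
  proof -
    have "comb x ?P y ?Q z ?R = comb (a\<^sup>2 * x + 2 * a * b * y + b\<^sup>2 * z) (?T P)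
      (a * c * x + (a * d + b * c) * y + b * d * z) (?T Q) (c\<^sup>2 * x + 2 * c * d * y + d\<^sup>2 * z) (?T R)"
      by (simp add: comb_def vec_eq_iff algebra_simps)
    then show ?thesis
      unfolding det_form_def by (simp add: comb det_mul assms(2))
  qed
  then have "det_form ?P ?Q ?R = (\<lambda>x y z. det_form P Q R (a\<^sup>2 * x + 2 * a * b * y + b\<^sup>2 * z)
      (a * c * x + (a * d + b * c) * y + b * d * z) (c\<^sup>2 * x + 2 * c * d * y + d\<^sup>2 * z))"
    by (intro ext)
  then have "quad_invariant ?P ?Q ?R = quad_invariant P Q R"
    using invariant_SL2[OF cubic_det_form ad] by simp
  moreover have "gact C D (quad P Q R) = quad ?P ?Q ?R"
    by (simp add: gact_quad abcd Let_def)
  ultimately show thesis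
    by (intro that[of ?P ?Q ?R]) (simp_all add: sym sym_comb sym_congruence)
qed

section \<open>The invariant as a polynomial function\<close>

lemma poly_functions_diff:
  assumes "\<phi> \<in> poly_functions" "\<psi> \<in> poly_functions"
  shows "(\<lambda>p. \<phi> p - \<psi> p) \<in> poly_functions"
  using poly_functions.add[OF assms(1) poly_functions.mult[OF poly_functions.const[of "-1"] assms(2)]]
  by simp

lemma poly_functions_divide:
  assumes "\<phi> \<in> poly_functions"
  shows "(\<lambda>p. \<phi> p / c) \<in> poly_functions"
  using poly_functions.mult[OF poly_functions.const[of "inverse c"] assms] by (simp add: field_simps)

lemma poly_functions_power:
  assumes "\<phi> \<in> poly_functions"
  shows "(\<lambda>p. \<phi> p ^ n) \<in> poly_functions"
  by (induction n) (auto intro: poly_functions.const poly_functions.mult assms)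

text \<open>The factor 1/2 undoes the doubling of off-diagonal entries in \<open>qf\<close>. Being
  linear in the coefficients, these matrices turn the invariant into a member of
  \<open>poly_functions\<close>.\<close>

definition coeff_mat :: "nat \<Rightarrow> nat \<Rightarrow> cpoly \<Rightarrow> complex^3^3" where
  "coeff_mat a b p = (\<chi> j k. if j = k then Poly_Mapping.lookup p (bimono a b j k)
      else 1/2 * Poly_Mapping.lookup p (bimono a b j k))"

lemma coeff_mat_quad:
  assumes "sym_mat P" "sym_mat Q" "sym_mat R"
  shows "coeff_mat 2 0 (quad P Q R) = P" "coeff_mat 1 1 (quad P Q R) = Q" "coeff_mat 0 2 (quad P Q R) = R"
  using assms[THEN sym_matD] by (simp_all add: coeff_mat_def lookup_quad
      lookup_quad(2)[unfolded One_nat_def] vec_eq_iff)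

lemma coeff_mat_poly_functions: "(\<lambda>p. coeff_mat a b p $ j $ k) \<in> poly_functions"
  unfolding coeff_mat_def
  by (cases "j = k") (auto intro!: poly_functions.intros poly_functions_divide)

lemma det_form_poly_functions:
  "(\<lambda>p. det_form (coeff_mat 2 0 p) (coeff_mat 1 1 p) (coeff_mat 0 2 p) x y z) \<in> poly_functions"
proof -
  have "(\<lambda>p. comb x (coeff_mat 2 0 p) y (coeff_mat 1 1 p) z (coeff_mat 0 2 p) $ i $ j) \<in> poly_functions" for i j
    unfolding comb_def by (auto intro!: poly_functions.intros coeff_mat_poly_functions)
  then show ?thesis
    unfolding det_form_def det_3' by (intro poly_functions.intros poly_functions_diff)
qed

lemma invariant_poly_functions:
  "(\<lambda>p. quad_invariant (coeff_mat 2 0 p) (coeff_mat 1 1 p) (coeff_mat 0 2 p)) \<in> poly_functions"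
  unfolding invariant_def Let_def
  by (intro poly_functions_diff poly_functions_divide poly_functions_power poly_functions.intros
      det_form_poly_functions)

text \<open>The function "invariant minus its value at f" vanishes on the orbit but not at 0, so it
  separates 0 from the closure.\<close>

lemma semistable_if_invariant:
  assumes "sym_mat P" "sym_mat Q" "sym_mat R" "quad_invariant P Q R \<noteq> 0"
  shows "git_semistable (quad P Q R)"
proof -
  let ?I = "\<lambda>p. quad_invariant (coeff_mat 2 0 p) (coeff_mat 1 1 p) (coeff_mat 0 2 p)"
  let ?\<phi> = "\<lambda>p. ?I p - quad_invariant P Q R"
  have poly: "?\<phi> \<in> poly_functions"
    by (intro poly_functions_diff invariant_poly_functions poly_functions.const)
  have orbit: "?\<phi> s = 0" if s: "s \<in> orbit (quad P Q R)" for s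
  proof -
    from s obtain C D where CD: "s = gact C D (quad P Q R)" "det C = 1" "det D = 1"
      by (auto simp: orbit_eq)
    obtain P' Q' R' where *: "gact C D (quad P Q R) = quad P' Q' R'"
      "quad_invariant P' Q' R' = quad_invariant P Q R"
      "sym_mat P'" "sym_mat Q'" "sym_mat R'"
      by (rule quad_invariant_gact[OF CD(2,3) assms(1-3)])
    then show ?thesis by (simp add: CD(1) * coeff_mat_quad coeff_mat_quad(2)[unfolded One_nat_def])
  qed
  have nz: "?\<phi> 0 \<noteq> 0"
  proof -
    have "coeff_mat a b 0 = 0" for a b by (simp add: coeff_mat_def vec_eq_iff)
    moreover have "quad_invariant 0 0 0 = 0"
      by (simp add: invariant_def det_form_def det_3' comb_def)
    ultimately show ?thesis using assms(4) by simp
  qed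
  show ?thesis
    unfolding git_semistable_def
  proof
    assume "0 \<in> V_closure (orbit (quad P Q R))"
    then have "\<forall>\<phi>\<in>poly_functions. (\<forall>s\<in>orbit (quad P Q R). \<phi> s = 0) \<longrightarrow> \<phi> 0 = 0"
      by (simp add: V_closure_def)
    from mp[OF bspec[OF this poly] ballI[OF orbit]] nz show False by contradiction
  qed
qed

section \<open>Limits along one-parameter subgroups\<close>

lemma poly_functions_isCont:
  assumes "\<phi> \<in> poly_functions" and "\<And>m. isCont (\<lambda>t. Poly_Mapping.lookup (p t) m) 0"
  shows "isCont (\<lambda>t::complex. \<phi> (p t)) 0"
  using assms by (induction) (auto intro!: continuous_intros)

text \<open>A polynomial function that vanishes on \<open>S\<close> vanishes along the punctured
  path, hence by continuity at its end point. This derives membership in the Zariski closure from a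
  classical limit.\<close>

lemma closure_limit:
  assumes "\<And>m. isCont (\<lambda>t. Poly_Mapping.lookup (p t) m) 0" "\<And>t. t \<noteq> 0 \<Longrightarrow> p t \<in> S" "p (0::complex) \<in> V"
  shows "p 0 \<in> V_closure S"
proof -
  have "\<phi> (p 0) = 0" if "\<phi> \<in> poly_functions" "\<forall>s\<in>S. \<phi> s = 0" for \<phi>
  proof -
    have "isCont (\<lambda>t. \<phi> (p t)) 0" using poly_functions_isCont that(1) assms(1) .
    then have "((\<lambda>t. \<phi> (p t)) \<longlongrightarrow> \<phi> (p 0)) (at 0)" by (simp add: isCont_def)
    moreover have "((\<lambda>t. \<phi> (p t)) \<longlongrightarrow> 0) (at 0)"
      by (rule tendsto_eventually) (use that(2) assms(2) in \<open>auto simp: eventually_at intro!: exI[of _ 1]\<close>)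
    ultimately show ?thesis by (rule tendsto_unique[rotated]) auto
  qed
  with assms(3) show ?thesis by (simp add: V_closure_def)
qed

lemma lookup_quad_isCont:
  assumes "\<And>j k. isCont (\<lambda>t. P t $ j $ k) 0" "\<And>j k. isCont (\<lambda>t. Q t $ j $ k) 0"
    "\<And>j k. isCont (\<lambda>t. R t $ j $ k) (0::complex)"
  shows "isCont (\<lambda>t. Poly_Mapping.lookup (quad (P t) (Q t) (R t)) m) 0"
proof -
  have "isCont (\<lambda>t. Poly_Mapping.lookup (q * qf (M t)) m) 0"
    if "\<And>j k. isCont (\<lambda>t. M t $ j $ k) (0::complex)" for q M
  proof -
    have "q * qf (M t) = (\<Sum>j\<in>UNIV. \<Sum>k\<in>UNIV. Const (M t $ j $ k) * (q * (Y j * Y k)))" for t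
      by (simp add: qf_def sum_distrib_left mult_ac)
    then show ?thesis
      by (simp add: lookup_sum lookup_Const_mult that)
  qed
  with assms show ?thesis
    unfolding quad_def lookup_add by (intro continuous_add) auto
qed

text \<open>Junk value: for negative \<open>w\<close> the exponent \<open>nat w\<close> is \<open>0\<close>; this only concerns vanishing entries.\<close>

definition weight_limit :: "int \<Rightarrow> (3 \<Rightarrow> int) \<Rightarrow> complex \<Rightarrow> complex^3^3 \<Rightarrow> complex^3^3" where
  "weight_limit a b t M = (\<chi> j k. t ^ nat (a + b j + b k) * M $ j $ k)"

definition diag2 :: "complex \<Rightarrow> complex^2^2" where
  "diag2 s = (\<chi> i k. if i = k then if i = 0 then s else inverse s else 0)"

definition diag3 :: "(3 \<Rightarrow> complex) \<Rightarrow> complex^3^3" where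
  "diag3 d = (\<chi> i k. if i = k then d i else 0)"

lemma det_diag2: "s \<noteq> 0 \<Longrightarrow> det (diag2 s) = 1"
  by (simp add: det_2' diag2_def)

lemma det_diag3: "det (diag3 d) = d 0 * d 1 * d 2"
  by (simp add: det_3' diag3_def)

lemma gact_diag_quad:
  "gact (diag2 s) (diag3 d) (quad P Q R) = quad (\<chi> j k. s\<^sup>2 * d j * d k * P $ j $ k)
     (\<chi> j k. s * inverse s * d j * d k * Q $ j $ k) (\<chi> j k. (inverse s)\<^sup>2 * d j * d k * R $ j $ k)"
proof -
  have T: "transpose (diag3 d) ** M ** diag3 d = (\<chi> j k. d j * d k * M $ j $ k)" for M
    by (simp add: diag3_def matrix_matrix_mult_def transpose_def vec_eq_iff if_distrib
        if_distribR mult_ac cong: if_cong)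
  show ?thesis
    unfolding gact_quad T Let_def
    by (intro arg_cong3[where f = quad]) (simp_all add: diag2_def comb_def vec_eq_iff mult_ac)
qed

text \<open>The torus element with entries t^a, t^(-a) and t^(b j) scales the coefficient of x0^2
  y_j y_k by t^(2a + b j + b k), and similarly for the other two conics. Nonnegative weights extend
  the path to t = 0, and since 0^0 = 1 the limit keeps exactly the entries of weight 0.\<close>

lemma one_parameter_limit:
  assumes sum: "b 0 + b 1 + b 2 = (0::int)"
    and P: "\<And>j k. P $ j $ k \<noteq> 0 \<Longrightarrow> 2 * a + b j + b k \<ge> 0"
    and Q: "\<And>j k. Q $ j $ k \<noteq> 0 \<Longrightarrow> b j + b k \<ge> 0"
    and R: "\<And>j k. R $ j $ k \<noteq> 0 \<Longrightarrow> - 2 * a + b j + b k \<ge> 0"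
  shows "quad (weight_limit (2 * a) b 0 P) (weight_limit 0 b 0 Q) (weight_limit (- 2 * a) b 0 R)
    \<in> V_closure (orbit (quad P Q R))"
proof (rule closure_limit[where p = "\<lambda>t. quad (weight_limit (2 * a) b t P) (weight_limit 0 b t Q) (weight_limit (- 2 * a) b t R)"])
  show "isCont (\<lambda>t. Poly_Mapping.lookup (quad (weight_limit (2 * a) b t P) (weight_limit 0 b t Q)
      (weight_limit (- 2 * a) b t R)) m) 0" for m
    by (rule lookup_quad_isCont) (auto simp: weight_limit_def intro!: continuous_intros)
next
  fix t :: complex assume t: "t \<noteq> 0"
  have wl: "weight_limit c b t M = (\<chi> j k. t powi c * t powi b j * t powi b k * M $ j $ k)"
    if nonneg: "\<And>j k. M $ j $ k \<noteq> 0 \<Longrightarrow> c + b j + b k \<ge> 0" for c M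
  proof -
    have "t ^ nat (c + b j + b k) * M $ j $ k = t powi c * t powi b j * t powi b k * M $ j $ k" for j k
    proof (cases "M $ j $ k = 0")
      case False
      then have "t ^ nat (c + b j + b k) = t powi (c + b j + b k)"
        using nonneg by (simp add: power_int_def)
      with t show ?thesis by (simp add: power_int_add)
    qed simp
    then show ?thesis by (simp add: weight_limit_def vec_eq_iff)
  qed
  have sq: "t powi (2 * a) = (t powi a)\<^sup>2"
    using t by (simp only: mult_2 power_int_add power2_eq_square simp_thms)
  then have sq': "t powi (- (2 * a)) = (inverse (t powi a))\<^sup>2"
    by (simp only: power_int_minus power_inverse)
  have "weight_limit (2 * a) b t P = (\<chi> j k. (t powi a)\<^sup>2 * t powi b j * t powi b k * P $ j $ k)"
    by (subst wl) (use P sq in simp_all)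
  moreover have "weight_limit 0 b t Q = (\<chi> j k. t powi a * inverse (t powi a) * t powi b j * t powi b k * Q $ j $ k)"
    by (subst wl) (use Q t in simp_all)
  moreover have "weight_limit (- 2 * a) b t R = (\<chi> j k. (inverse (t powi a))\<^sup>2 * t powi b j * t powi b k * R $ j $ k)"
    using wl[of R "- 2 * a"] R sq' by simp
  ultimately have "quad (weight_limit (2 * a) b t P) (weight_limit 0 b t Q) (weight_limit (- 2 * a) b t R)
      = gact (diag2 (t powi a)) (diag3 (\<lambda>j. t powi b j)) (quad P Q R)"
    by (simp add: gact_diag_quad)
  moreover have "det (diag2 (t powi a)) = 1" using t by (simp add: det_diag2)
  moreover have "det (diag3 (\<lambda>j. t powi b j)) = 1"
    using t sum by (simp add: det_diag3 flip: power_int_add)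
  ultimately show "quad (weight_limit (2 * a) b t P) (weight_limit 0 b t Q) (weight_limit (- 2 * a) b t R)
      \<in> orbit (quad P Q R)"
    unfolding orbit_eq by blast
qed simp

text \<open>With strictly positive weights nothing survives in the limit. Every destabilization
  below is an application of this with explicit weights.\<close>

lemma not_semistable_if_weights:
  assumes sum: "b 0 + b 1 + b 2 = (0::int)"
    and P: "\<And>j k. P $ j $ k \<noteq> 0 \<Longrightarrow> 2 * a + b j + b k > 0"
    and Q: "\<And>j k. Q $ j $ k \<noteq> 0 \<Longrightarrow> b j + b k > 0"
    and R: "\<And>j k. R $ j $ k \<noteq> 0 \<Longrightarrow> - 2 * a + b j + b k > 0"
  shows "\<not> git_semistable (quad P Q R)"
proof -
  have 0: "weight_limit c b 0 M = 0" if "\<And>j k. M $ j $ k \<noteq> 0 \<Longrightarrow> c + b j + b k > 0" for c M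
    using that by (auto simp: weight_limit_def vec_eq_iff power_0_left) (meson not_le)
  have "quad (weight_limit (2 * a) b 0 P) (weight_limit 0 b 0 Q) (weight_limit (- 2 * a) b 0 R)
      \<in> V_closure (orbit (quad P Q R))"
    by (rule one_parameter_limit) (use assms in force)+
  moreover have "weight_limit (2 * a) b 0 P = 0" "weight_limit 0 b 0 Q = 0" "weight_limit (- 2 * a) b 0 R = 0"
    by (intro 0; use P Q R in force)+
  ultimately show ?thesis
    by (simp add: git_semistable_def quad_def)
qed

text \<open>A closed orbit with 0 in its closure contains 0; but the orbit of 0 is a single
  point.\<close>

lemma not_stable_if_not_semistable:
  assumes "f \<noteq> 0" "\<not> git_semistable f"
  shows "\<not> git_stable f"
proof
  assume "git_stable f"
  with assms have "0 \<in> orbit f" by (simp add: git_semistable_def git_stable_def)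
  then obtain C D where CD: "gact C D f = 0" "det C = 1" "det D = 1" by (auto simp: orbit_eq)
  then have "f \<in> orbit (0 :: cpoly)"
    using orbit_self[of f] orbit_gact[OF CD(2,3), of f] by simp
  then show False using assms(1) by (auto simp: orbit_eq)
qed

text \<open>If the orbit of \<open>f\<close> were closed it would contain \<open>h\<close>, and the
  stabilizers of \<open>f\<close> and \<open>h\<close> would be conjugate.\<close>

lemma not_stable_if_infinite_stabilizer:
  assumes h: "h \<in> V_closure (orbit f)"
    and inf: "infinite {(C, D). det C = 1 \<and> det D = 1 \<and> gact C D h = h}" (is "infinite ?A")
  shows "\<not> git_stable f"
proof
  assume "git_stable f"
  with h have "h \<in> orbit f" and fin: "finite (stabilizer f)" by (auto simp: git_stable_def)
  then obtain C D where CD: "h = gact C D f" "det C = 1" "det D = 1" by (auto simp: orbit_eq)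
  let ?C = "matrix_inv C" and ?D = "matrix_inv D"
  \<comment> \<open>Conjugation by the element that carries \<open>f\<close> to \<open>h\<close>;
    the outer inverses compensate those in \<open>act\<close>, through which
    \<open>stabilizer\<close> is defined.\<close>
  let ?g = "\<lambda>(A, B). (matrix_inv (C ** A ** ?C), matrix_inv (D ** B ** ?D))"
  have f: "f = gact ?C ?D h" using CD by (simp add: gact_gact det_1_inverse)
  have "inj_on ?g ?A"
  proof (rule inj_on_inverseI[where g = "\<lambda>(A, B). (?C ** matrix_inv A ** C, ?D ** matrix_inv B ** D)"])
    have "?C ** matrix_inv (matrix_inv (C ** A ** ?C)) ** C = A" if "det A = 1" for A
    proof -
      have "matrix_inv (matrix_inv (C ** A ** ?C)) = C ** A ** ?C"
        by (rule det_1_inverse(4)) (simp add: det_mul that CD det_1_inverse)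
      then have "?C ** matrix_inv (matrix_inv (C ** A ** ?C)) ** C = (?C ** C) ** A ** (?C ** C)"
        by (simp add: matrix_mul_assoc)
      then show ?thesis using CD by (simp add: det_1_inverse)
    qed
    moreover have "?D ** matrix_inv (matrix_inv (D ** A ** ?D)) ** D = A" if "det A = 1" for A
    proof -
      have "matrix_inv (matrix_inv (D ** A ** ?D)) = D ** A ** ?D"
        by (rule det_1_inverse(4)) (simp add: det_mul that CD det_1_inverse)
      then have "?D ** matrix_inv (matrix_inv (D ** A ** ?D)) ** D = (?D ** D) ** A ** (?D ** D)"
        by (simp add: matrix_mul_assoc)
      then show ?thesis using CD by (simp add: det_1_inverse)
    qed
    ultimately show "(\<lambda>(A, B). (?C ** matrix_inv A ** C, ?D ** matrix_inv B ** D)) (?g x) = x"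
      if "x \<in> ?A" for x
      using that by auto
  qed
  moreover have "?g ` ?A \<subseteq> stabilizer f"
  proof clarify
    fix A B assume AB: "det A = 1" "det B = 1" "gact A B h = h"
    have d: "det (C ** A ** ?C) = 1" "det (D ** B ** ?D) = 1"
      using AB CD by (simp_all add: det_mul det_1_inverse)
    have "gact (C ** A ** ?C) (D ** B ** ?D) f = gact ?C ?D (gact A B (gact C D f))"
      by (simp add: gact_gact matrix_mul_assoc)
    also have "\<dots> = f" by (simp only: AB(3) CD(1)[symmetric] f[symmetric])
    finally show "(matrix_inv (C ** A ** ?C), matrix_inv (D ** B ** ?D)) \<in> stabilizer f"
      using d by (simp add: stabilizer_def G_def act_eq_gact det_1_inverse)
  qed
  ultimately have "finite ?A" using fin by (meson finite_imageD finite_subset)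
  with inf show False by contradiction
qed

section \<open>Products of bidegrees (1,0) and (1,2)\<close>

lemma det_eq_0_iff_kernel: "det (A :: complex^'n^'n) = 0 \<longleftrightarrow> (\<exists>x. x \<noteq> 0 \<and> A *v x = 0)"
  using matrix_left_invertible_ker[of A] invertible_left_inverse[of A] invertible_det_nz[of A] by blast

lemma rank_2_iff:
  fixes A :: "complex^'n^2"
  shows "rank A = 2 \<longleftrightarrow> A $ 0 \<noteq> 0 \<and> (\<forall>c. A $ 1 \<noteq> c *s A $ 0)"
proof -
  have "rows A = {A $ 1, A $ 0}"
    unfolding rows_def row_def by (auto simp: vec_nth_inverse) (metis exhaust_2')+
  then have "rank A = vec.dim (insert (A $ 1) {A $ 0})"
    by (simp add: row_rank_def_gen)
  also have "\<dots> = (if A $ 1 \<in> vec.span {A $ 0} then vec.dim {A $ 0} else vec.dim {A $ 0} + 1)"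
    by (rule vec.dim_insert)
  finally show ?thesis
    by (auto simp: vec.span_singleton)
qed

lemma SL3_first_column:
  fixes k :: "complex^3"
  assumes "k \<noteq> 0"
  obtains D :: "complex^3^3" where "det D = 1" "\<And>i. D $ i $ 0 = k $ i"
proof -
  define m where "m r s t = (\<chi> i::3. if i = 0 then r else if i = 1 then s else (t :: complex^3))" for r s t
  define v where "v a b c = (\<chi> i::3. if i = 0 then a else if i = 1 then b else (c :: complex))" for a b c
  have "\<exists>D :: complex^3^3. det D = 1 \<and> (\<forall>i. D $ i $ 0 = k $ i)"
  proof -
    consider "k $ 0 \<noteq> 0" | "k $ 1 \<noteq> 0" | "k $ 2 \<noteq> 0" using assms vec3_eq_0 by blast
    then show ?thesis
    proof cases
      case 1
      then show ?thesis
        by (intro exI[of _ "m (v (k$0) 0 0) (v (k$1) (inverse (k$0)) 0) (v (k$2) 0 1)"])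
          (simp add: det_3' m_def v_def forall_3')
    next
      case 2
      then show ?thesis
        by (intro exI[of _ "m (v (k$0) 0 1) (v (k$1) 0 0) (v (k$2) (inverse (k$1)) 0)"])
          (simp add: det_3' m_def v_def forall_3')
    next
      case 3
      then show ?thesis
        by (intro exI[of _ "m (v (k$0) (inverse (k$2)) 0) (v (k$1) 0 1) (v (k$2) 0 0)"])
          (simp add: det_3' m_def v_def forall_3')
    qed
  qed
  then show thesis using that by blast
qed

text \<open>If v is the first row of a unimodular matrix, the inverse of that matrix carries v to
  the first coordinate form.\<close>

lemma SL3_linear_form:
  fixes v :: "complex^3"
  assumes "v \<noteq> 0"
  obtains D :: "complex^3^3" where "det D = 1" "v v* D = axis 0 1"
proof -
  obtain E :: "complex^3^3" where E: "det E = 1" "\<And>i. E $ i $ 0 = v $ i"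
    using SL3_first_column[OF assms] by blast
  let ?D = "matrix_inv (transpose E)"
  have T: "det (transpose E) = 1" using E by (simp add: det_transpose)
  have v: "v = axis 0 1 v* transpose E"
    by (simp add: vec_eq_iff vector_matrix_mult_def transpose_def E axis_def sum_3')
  then have "v v* ?D = axis 0 1 v* (transpose E ** ?D)"
    by (subst v) (simp only: vector_matrix_mul_assoc)
  then show thesis using T that[of ?D] by (simp add: det_1_inverse)
qed

text \<open>The second column of \<open>C\<close> has to be a zero of u. Fixing it as (-u1, u0)
  makes the conic attached to x0 x1 below equal to \<open>zero_fibre\<close>; r and s are Bezout
  coefficients that give determinant 1.\<close>

lemma SL2_linear_form:
  fixes u :: "complex^2"
  assumes "u \<noteq> 0"
  obtains C :: "complex^2^2" where "det C = 1" "u v* C = axis 0 1" "C $ 0 $ 1 = - u $ 1" "C $ 1 $ 1 = u $ 0"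
proof -
  obtain r s where rs: "r * u $ 0 + s * u $ 1 = 1"
  proof (cases "u $ 0 = 0")
    case True
    with assms have "u $ 1 \<noteq> 0" by (simp add: vec2_eq_0)
    then show ?thesis using that[of 0 "inverse (u $ 1)"] by simp
  next
    case False
    then show ?thesis using that[of "inverse (u $ 0)" 0] by simp
  qed
  let ?C = "(\<chi> i k. if k = 0 then if i = 0 then r else s else if i = 0 then - u $ 1 else u $ 0) :: complex^2^2"
  have "det ?C = 1" using rs by (simp add: det_2' algebra_simps)
  moreover have "u v* ?C = axis 0 1"
    using rs by (simp add: vec_eq_iff forall_2' vector_matrix_mult_def sum_2' axis_def algebra_simps)
  ultimately show thesis using that[of ?C] by simp
qed

lemma lx_axis [simp]: "lx (axis i 1) = X i"
  and ly_axis [simp]: "ly (axis j 1) = Y j"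
proof -
  have "Const (axis i 1 $ k) * X k = (if k = i then X i else 0)" for k
    by (auto simp: axis_def)
  then show "lx (axis i 1) = X i" by (simp add: lx_def)
  have "Const (axis j 1 $ k) * Y k = (if k = j then Y j else 0)" for k
    by (auto simp: axis_def)
  then show "ly (axis j 1) = Y j" by (simp add: ly_def)
qed

lemma ly_eq_0_iff: "ly v = 0 \<longleftrightarrow> v = 0"
proof
  assume "ly v = 0"
  then have "peval 0 (axis j 1) (ly v) = 0" for j by simp
  then show "v = 0" by (simp add: axis_def if_distrib vec_eq_iff cong: if_cong)
qed simp

lemma matrix_vector_mult_3: "(A *v x) $ i = A $ i $ 0 * x $ 0 + A $ i $ 1 * x $ 1 + A $ i $ 2 * x $ 2"
  for A :: "complex^3^3"
  by (simp add: matrix_vector_mult_def sum_3')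

lemma sym_0 [simp]: "sym_mat 0"
  by (simp add: transpose_def vec_eq_iff)

text \<open>The fibre over the zero of the linear form \<open>u\<close>.\<close>

abbreviation zero_fibre :: "complex^2 \<Rightarrow> complex^3^3 \<Rightarrow> complex^3^3 \<Rightarrow> complex^3^3" where
  "zero_fibre u P Q \<equiv> comb (- u $ 1) P (u $ 0) Q 0 0"

text \<open>Once u has become x0, its zero is [0,1], so the coefficient of x1 in the second factor
  is the fibre over that zero.\<close>

lemma linear_factor_normal_form:
  assumes "u \<noteq> 0" and sym: "sym_mat P" "sym_mat Q"
  obtains C P' where "det C = 1" "sym_mat P'"
    "gact C (mat 1) (lx u * (X 0 * qf P + X 1 * qf Q)) = quad P' (zero_fibre u P Q) 0"
proof -
  obtain C :: "complex^2^2" where C: "det C = 1" "u v* C = axis 0 1" "C $ 0 $ 1 = - u $ 1" "C $ 1 $ 1 = u $ 0"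
    using SL2_linear_form[OF assms(1)] .
  have "gact C (mat 1) (lx u * (X 0 * qf P + X 1 * qf Q))
      = quad (comb (C $ 0 $ 0) P (C $ 1 $ 0) Q 0 0) (zero_fibre u P Q) 0"
    by (simp add: C quad_def qf_comb lx_def[of "C $ _"] sum_2' Const_uminus power2_eq_square algebra_simps)
  then show thesis
    by (rule that[OF C(1) sym_comb[OF sym sym_0]])
qed

text \<open>A hyperbolic pair \<open>e\<close>, \<open>e'\<close> spans the complement of a non-isotropic vector.\<close>

lemma nondegenerate_normal_form:
  assumes M: "sym_mat M" "det M \<noteq> 0"
  obtains D h k where "det D = 1" "h \<noteq> 0" "k \<noteq> 0"
    "transpose D ** M ** D = (\<chi> i j. if i = 1 \<and> j = 1 then k else if i = 0 \<and> j = 2 \<or> i = 2 \<and> j = 0 then h else 0)"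
proof -
  define B where "B v w = (\<Sum>i\<in>UNIV. v $ i * (M *v w) $ i)" for v w
  have B_sym: "B v w = B w v" for v w
    using sym_matD[OF M(1), of 0 1] sym_matD[OF M(1), of 0 2] sym_matD[OF M(1), of 1 2]
    by (simp add: B_def sum_3' matrix_vector_mult_3 algebra_simps)
  have B_add: "B v (w + c *s w') = B v w + c * B v w'" for v w w' c
    by (simp add: B_def sum_3' matrix_vector_mult_3 algebra_simps)
  obtain e where e: "e \<noteq> 0" "B e e = 0"
  proof (cases "M $ 0 $ 0 = 0")
    case True
    then have "B (axis 0 1) (axis 0 1) = 0"
      by (simp add: B_def sum_3' matrix_vector_mult_3 axis_def)
    moreover have "axis (0::3) (1::complex) \<noteq> 0" by (simp add: axis_eq_0_iff)
    ultimately show ?thesis using that by blast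
  next
    case False
    \<comment> \<open>An isotropic vector (r, 1, 0) is found on the line y2 = 0, where the form
      restricts to a binary quadratic.\<close>
    define a b c where abc: "a = M $ 0 $ 0" "b = M $ 0 $ 1" "c = M $ 1 $ 1"
    define r where "r = (- b + csqrt (b\<^sup>2 - a * c)) / a"
    have "a * r + b = csqrt (b\<^sup>2 - a * c)" using False by (simp add: r_def abc)
    then have "(a * r + b)\<^sup>2 = b\<^sup>2 - a * c" by simp
    then have "a * (a * r\<^sup>2 + 2 * b * r + c) = 0" by (simp add: power2_eq_square algebra_simps)
    then have root: "a * r\<^sup>2 + 2 * b * r + c = 0" using False abc by simp
    let ?e = "\<chi> i::3. if i = 0 then r else if i = 1 then 1 else 0"
    have "?e $ 1 \<noteq> 0" by simp
    then have "?e \<noteq> 0" by (metis zero_index)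
    moreover have "B ?e ?e = 0"
      using root sym_matD[OF M(1), of 0 1]
      by (simp add: abc B_def sum_3' matrix_vector_mult_3 power2_eq_square algebra_simps)
    ultimately show ?thesis using that by blast
  qed
  have "M *v e \<noteq> 0" using e(1) M(2) det_eq_0_iff_kernel by blast
  then obtain j where j: "(M *v e) $ j \<noteq> 0" by (auto simp: vec_eq_iff)
  define d where "d = axis j (1::complex)"
  have Bd: "B d e \<noteq> 0" using j by (simp add: B_def d_def axis_def if_distrib if_distribR cong: if_cong)
  \<comment> \<open>Solves B(d, d) + 2 c B(d, e) = 0, so that d + c e becomes isotropic.\<close>
  define c where "c = - B d d / (2 * B d e)"
  define e' where "e' = d + c *s e"
  have e'e: "B e e' = B d e" by (simp add: e'_def B_add e B_sym[of e d])
  have "B e' e' = B e' d + c * B e' e"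
    using B_add[of e' d c e] by (simp only: e'_def)
  also have "\<dots> = B d d + 2 * c * B d e"
    by (simp only: B_sym[of e'] e'e) (simp add: e'_def B_add)
  also have "\<dots> = 0" using Bd by (simp add: c_def)
  finally have e'e': "B e' e' = 0" .
  define p q where "p = M *v e" and "q = M *v e'"
  \<comment> \<open>The cross product of M e and M e' is orthogonal to e and e' with respect to
    \<open>B\<close>.\<close>
  define w where "w = (\<chi> i::3. if i = 0 then p $ 1 * q $ 2 - p $ 2 * q $ 1
     else if i = 1 then p $ 2 * q $ 0 - p $ 0 * q $ 2 else p $ 0 * q $ 1 - p $ 1 * q $ 0)"
  define h0 where "h0 = B d e"
  have w: "B w e = 0" "B w e' = 0"
    by (simp_all add: B_def w_def sum_3' algebra_simps flip: p_def q_def)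
  define D0 where "D0 c = (\<chi> i j::3. if j = 0 then e $ i else if j = 1 then c * w $ i else e' $ i)" for c
  have Bpq: "B v e = v $ 0 * p $ 0 + v $ 1 * p $ 1 + v $ 2 * p $ 2"
    "B v e' = v $ 0 * q $ 0 + v $ 1 * q $ 1 + v $ 2 * q $ 2" for v
    by (simp_all add: B_def p_def q_def sum_3')
  \<comment> \<open>Lagrange's identity for the scalar product of two cross products. It shows which
    multiple of w yields determinant 1.\<close>
  have "det (D0 c) = c * (B e e' * B e' e - B e e * B e' e')" for c
    unfolding Bpq by (simp add: D0_def det_3' w_def algebra_simps)
  then have det: "det (D0 c) = c * h0\<^sup>2" for c
    by (simp add: e e'e B_sym[of e' e] h0_def power2_eq_square)
  define D where "D = D0 (inverse (h0\<^sup>2))"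
  have h0: "h0 \<noteq> 0" using Bd by (simp add: h0_def)
  then have D: "det D = 1" by (simp add: D_def det)
  define k where "k = (inverse (h0\<^sup>2))\<^sup>2 * B w w"
  have eq: "transpose D ** M ** D = (\<chi> i j. if i = 1 \<and> j = 1 then k else if i = 0 \<and> j = 2 \<or> i = 2 \<and> j = 0 then h0 else 0)"
  proof -
    have TMD: "(transpose D ** M ** D) $ i $ j = B (column i D) (column j D)" for i j
      by (simp add: B_def matrix_matrix_mult_def transpose_def column_def matrix_vector_mult_def
          sum_3' algebra_simps)
    have col: "column 0 D = e" "column 1 D = inverse (h0\<^sup>2) *s w" "column 2 D = e'"
      by (simp_all add: D_def D0_def column_def vec_eq_iff)
    have scale: "B v (c *s v') = c * B v v'" "B (c *s v) v' = c * B v v'" for v v' c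
      by (simp_all add: B_def sum_3' matrix_vector_mult_3 algebra_simps)
    show ?thesis
      by (simp add: vec_eq_iff forall_3' TMD col scale e e'e e'e' w B_sym[of e' e] B_sym[of e w]
          B_sym[of e' w] k_def h0_def power2_eq_square)
  qed
  have "det (transpose D ** M ** D) \<noteq> 0"
    using D M(2) by (simp add: det_mul det_transpose)
  then have "k \<noteq> 0" unfolding eq by (auto simp: det_3')
  with that D h0 eq show thesis by blast
qed

text \<open>A kernel vector of the singular conic is moved to the first basis vector; the conic then
  no longer involves y0.\<close>

lemma singular_zero_fibre_not_semistable:
  assumes sym: "sym_mat M" and "det M = 0"
  shows "\<not> git_semistable (quad P M 0)"
proof -
  obtain k where k: "k \<noteq> 0" "M *v k = 0" using assms det_eq_0_iff_kernel by blast
  obtain D :: "complex^3^3" where D: "det D = 1" "\<And>i. D $ i $ 0 = k $ i" using SL3_first_column[OF k(1)] by blast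
  let ?M = "transpose D ** M ** D"
  have col: "?M $ i $ 0 = 0" for i
  proof -
    have "?M $ i $ 0 = (\<Sum>l\<in>UNIV. D $ l $ i * (M *v k) $ l)"
      by (simp add: matrix_matrix_mult_def transpose_def matrix_vector_mult_def D sum_3' algebra_simps)
    then show ?thesis by (simp add: k)
  qed
  then have row: "?M $ 0 $ i = 0" for i
    using sym_matD[OF sym_congruence[OF sym], of D 0 i] by simp
  \<comment> \<open>All entries of the middle conic now have weight 2, and a = 3 lifts the worst
    weight of the first conic, that of y0^2, to 6 - 4 = 2.\<close>
  define b where "b j = (if j = 0 then - 2 else 1 :: int)" for j :: 3
  have "\<not> git_semistable (quad (transpose D ** P ** D) ?M 0)"
  proof (rule not_semistable_if_weights[where a = 3 and b = b])
    show "0 < b j + b k" if "?M $ j $ k \<noteq> 0" for j k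
      using that row[of k] col[of j] by (cases "j = 0"; cases "k = 0") (auto simp: b_def)
  qed (auto simp: b_def)
  moreover have "gact (mat 1) D (quad P M 0) = quad (transpose D ** P ** D) ?M 0"
    by (simp add: quad_def lx_def sum_2' mat_def)
  moreover have "git_semistable (gact (mat 1) D (quad P M 0)) \<longleftrightarrow> git_semistable (quad P M 0)"
    by (rule semistable_gact) (simp_all add: D)
  ultimately show ?thesis by simp
qed

text \<open>Without an x1^2 term the cubic does not involve z. Hence l2 = 0, and only l1 = -3 det Q
  contributes to the discriminant.\<close>

lemma invariant_no_square:
  "quad_invariant P Q 0 = - 9 * (det Q)\<^sup>2"
proof -
  obtain p q r s t u v w m n where F: "\<forall>x y z. det_form P Q 0 x y z =
     p * x^3 + q * y^3 + r * z^3 + s * (x^2 * y) + t * (x * y^2) + u * (x^2 * z) + v * (x * z^2)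
       + w * (y^2 * z) + m * (y * z^2) + n * (x * y * z)"
    using cubic_det_form[of P Q 0] unfolding cubic_form_def by (elim exE that)
  have red: "det_form P Q 0 x y z = det_form P Q 0 x y 0" for x y z
    by (simp add: det_form_def comb_def)
  then have "det_form P Q 0 x y z = p * x^3 + q * y^3 + 0 * z^3 + s * (x^2 * y) + t * (x * y^2) + 0 * (x^2 * z)
      + 0 * (x * z^2) + 0 * (y^2 * z) + 0 * (y * z^2) + 0 * (x * y * z)" for x y z
    by (subst red) (simp add: F)
  then have "quad_invariant P Q 0 = 4 * (4 * 0 - t) * (4 * 0 - 0) - (2 * 0 - 3 * q)\<^sup>2"
    by (rule invariant_coeffs)
  moreover have "det Q = q"
  proof -
    have "det_form P Q 0 0 1 0 = q" using F by simp
    moreover have "comb 0 P 1 Q 0 0 = Q" by (simp add: comb_def vec_eq_iff)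
    ultimately show ?thesis by (simp add: det_form_def)
  qed
  ultimately show ?thesis by (simp add: power2_eq_square)
qed

text \<open>On the normal form the invariant is decisive: nonzero it proves semi-stability, and when
  it vanishes the middle conic is singular and destabilizes.\<close>

lemma linear_factor_semistable_iff:
  assumes "u \<noteq> 0" "sym_mat P" "sym_mat Q"
  shows "git_semistable (lx u * (X 0 * qf P + X 1 * qf Q)) \<longleftrightarrow> det (zero_fibre u P Q) \<noteq> 0"
proof -
  have sym: "sym_mat (zero_fibre u P Q)"
    using assms by (simp add: sym_comb)
  obtain C P' where C: "det C = 1" "sym_mat P'"
    "gact C (mat 1) (lx u * (X 0 * qf P + X 1 * qf Q)) = quad P' (zero_fibre u P Q) 0"
    using linear_factor_normal_form[OF assms] .
  have "git_semistable (lx u * (X 0 * qf P + X 1 * qf Q)) \<longleftrightarrow> git_semistable (quad P' (zero_fibre u P Q) 0)"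
    using semistable_gact[OF C(1) det_I, of "lx u * (X 0 * qf P + X 1 * qf Q)"] unfolding C(3) by (rule HOL.sym)
  also have "\<dots> \<longleftrightarrow> det (zero_fibre u P Q) \<noteq> 0"
    using semistable_if_invariant[OF C(2) sym, of 0] singular_zero_fibre_not_semistable[OF sym]
    by (auto simp: invariant_no_square)
  finally show ?thesis .
qed

lemma infinite_nonzero: "infinite {t :: complex. t \<noteq> 0}"
proof -
  have "UNIV = insert 0 {t :: complex. t \<noteq> 0}" by auto
  then show ?thesis using infinite_UNIV_char_0[where 'a = complex] by (metis finite_insert)
qed

lemma infinite_stabilizer_if_torus:
  assumes "\<And>t. t \<noteq> 0 \<Longrightarrow> det (D t) = 1 \<and> gact (diag2 t) (D t) h = h"
  shows "infinite {(C, D). det C = 1 \<and> det D = 1 \<and> gact C D h = h}"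
proof
  assume "finite {(C, D). det C = 1 \<and> det D = 1 \<and> gact C D h = h}"
  moreover have "(\<lambda>t. (diag2 t, D t)) ` {t. t \<noteq> 0} \<subseteq> {(C, D). det C = 1 \<and> det D = 1 \<and> gact C D h = h}"
    using assms by (auto simp: det_diag2)
  moreover have "inj_on (\<lambda>t. (diag2 t, D t)) {t. t \<noteq> 0}"
  proof (rule inj_onI)
    fix s t assume "(diag2 s, D s) = (diag2 t, D t)"
    then have "diag2 s $ 0 $ 0 = diag2 t $ 0 $ 0" by simp
    then show "s = t" by (simp add: diag2_def)
  qed
  ultimately show False using infinite_nonzero by (meson finite_imageD finite_subset)
qed

text \<open>Weights (1, -1) on x and 0 on y remove the x0^2 part and leave x0 x1 times a smooth
  conic in hyperbolic normal form. The torus of SL_2 fixes x0 x1 and hence this limit.\<close>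

lemma linear_factor_degenerates:
  assumes u: "u \<noteq> 0" and PQ: "sym_mat P" "sym_mat Q" and det: "det (zero_fibre u P Q) \<noteq> 0"
  defines "f \<equiv> lx u * (X 0 * qf P + X 1 * qf Q)"
  shows "\<not> git_stable f"
    and "\<exists>\<alpha> \<beta>. \<alpha> \<noteq> 0 \<and> \<beta> \<noteq> 0 \<and> degenerates f (X 0 * X 1 * (Const \<alpha> * Y 0 * Y 2 + Const \<beta> * (Y 1)\<^sup>2))"
proof -
  have sym: "sym_mat (zero_fibre u P Q)"
    using PQ by (simp add: sym_comb)
  obtain C P' where C: "det C = 1" "sym_mat P'" "gact C (mat 1) f = quad P' (zero_fibre u P Q) 0"
    unfolding f_def using linear_factor_normal_form[OF u PQ] .
  obtain D h k where D: "det D = 1" "h \<noteq> 0" "k \<noteq> 0" "transpose D ** zero_fibre u P Q ** D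
      = (\<chi> i j. if i = 1 \<and> j = 1 then k else if i = 0 \<and> j = 2 \<or> i = 2 \<and> j = 0 then h else 0)" (is "?T = ?N")
    using nondegenerate_normal_form[OF sym det] .
  have "gact (mat 1) D (gact C (mat 1) f) = quad (transpose D ** P' ** D) ?N 0"
    unfolding C(3) D(4)[symmetric] by (simp add: quad_def lx_def sum_2' mat_def)
  then have eq: "orbit f = orbit (quad (transpose D ** P' ** D) ?N 0)"
    using orbit_gact[of C "mat 1" f] orbit_gact[of "mat 1" D "gact C (mat 1) f"] C(1) D(1) by simp
  have "quad (weight_limit (2 * 1) (\<lambda>_. 0) 0 (transpose D ** P' ** D)) (weight_limit 0 (\<lambda>_. 0) 0 ?N)
      (weight_limit (- 2 * 1) (\<lambda>_. 0) 0 0) \<in> V_closure (orbit f)"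
    unfolding eq by (rule one_parameter_limit) auto
  moreover have "weight_limit (2 * 1) (\<lambda>_. 0) 0 (transpose D ** P' ** D) = 0"
    "weight_limit (- 2 * 1) (\<lambda>_. 0) 0 0 = 0" "weight_limit 0 (\<lambda>_. 0) 0 ?N = ?N"
    by (simp_all add: weight_limit_def vec_eq_iff)
  ultimately have lim: "quad 0 ?N 0 \<in> V_closure (orbit f)" by (simp only:)
  have ss: "git_semistable (quad 0 ?N 0)"
    by (rule semistable_if_invariant)
      (use D in \<open>auto simp: invariant_no_square det_3' intro!: sym_matI\<close>)
  \<comment> \<open>The hyperbolic entry h occurs at (0,2) and at (2,0), so \<alpha> is 2 h.\<close>
  have quad: "quad 0 ?N 0 = X 0 * X 1 * (Const (2 * h) * Y 0 * Y 2 + Const k * (Y 1)\<^sup>2)"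
  proof -
    have "Const 2 = 2" by (metis Const_1 Const_add one_add_one)
    then have "qf ?N = Const (2 * h) * Y 0 * Y 2 + Const k * (Y 1)\<^sup>2"
      by (simp add: qf_def sum_3' Const_mult power2_eq_square algebra_simps)
    then show ?thesis by (simp add: quad_def)
  qed
  have "git_semistable f"
    unfolding f_def using linear_factor_semistable_iff[OF u PQ] det by blast
  with ss lim have "degenerates f (quad 0 ?N 0)" by (simp add: degenerates_def)
  with D(2,3) show "\<exists>\<alpha> \<beta>. \<alpha> \<noteq> 0 \<and> \<beta> \<noteq> 0 \<and> degenerates f (X 0 * X 1 * (Const \<alpha> * Y 0 * Y 2 + Const \<beta> * (Y 1)\<^sup>2))"
    unfolding quad by (intro exI[of _ "2 * h"] exI[of _ k]) simp
  show "\<not> git_stable f"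
  proof (rule not_stable_if_infinite_stabilizer[OF lim infinite_stabilizer_if_torus])
    fix t :: complex assume t: "t \<noteq> 0"
    have "diag3 (\<lambda>_. 1) = mat 1" by (simp add: diag3_def mat_def)
    then show "det (mat 1 :: complex^3^3) = 1 \<and> gact (diag2 t) (mat 1) (quad 0 ?N 0) = quad 0 ?N 0"
      using gact_diag_quad[of t "\<lambda>_. 1" 0 ?N 0] t
      by simp (intro arg_cong3[where f = quad]; simp add: vec_eq_iff)
  qed
qed

section \<open>The smoothness conditions\<close>

lemma partial_0 [simp]: "partial v 0 = 0"
  using partial_Const[of v 0] by simp

lemma fibre_simps [simp]:
  "fibre \<alpha> (X i) = Const (\<alpha> $ i)" "fibre \<alpha> (p + q) = fibre \<alpha> p + fibre \<alpha> q"
  "fibre \<alpha> (p * q) = fibre \<alpha> p * fibre \<alpha> q" "fibre \<alpha> (qf M) = qf M" "fibre \<alpha> (ly v) = ly v"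
  by (simp_all add: fibre_def qf_def ly_def)

text \<open>The gradient at y is 2 N y, which is nonzero for y nonzero because \<open>N\<close> has
  trivial kernel.\<close>

lemma smooth_plane_curve_qf:
  assumes "sym_mat N" "det N \<noteq> 0"
  shows "smooth_plane_curve (qf N)"
proof -
  have "\<exists>j. peval 0 y (partial (Inr j) (qf N)) \<noteq> 0" if "y \<noteq> 0" for y
  proof -
    have "N *v y \<noteq> 0" using that assms(2) det_eq_0_iff_kernel by blast
    then show ?thesis by (auto simp: peval_partial_qf[OF assms(1)] vec_eq_iff)
  qed
  moreover from this[of "axis 0 1"] have "qf N \<noteq> 0"
    by (auto simp: axis_eq_0_iff)
  ultimately show ?thesis by (simp add: smooth_plane_curve_def)
qed

lemma zero_of_linear_form:
  assumes "u \<noteq> (0 :: complex^2)" "u $ 0 * x $ 0 + u $ 1 * x $ 1 = 0"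
  obtains c where "x $ 0 = c * - u $ 1" "x $ 1 = c * u $ 0"
proof (cases "u $ 0 = 0")
  case True
  with assms have "u $ 1 \<noteq> 0" by (simp add: vec2_eq_0)
  with True assms(2) show ?thesis by (intro that[of "- x $ 0 / u $ 1"]) auto
next
  case False
  with assms(2) show ?thesis
    by (intro that[of "x $ 1 / u $ 0"]) (auto simp: field_simps add_eq_0_iff)
qed

lemma zero_fibre_as_fibre: "fibre (\<chi> i. if i = 0 then - u $ 1 else u $ 0) (X 0 * qf P + X 1 * qf Q)
    = qf (zero_fibre u P Q)"
  by (simp add: qf_comb)

text \<open>The discriminant of the pencil of conics is a binary cubic form; its value at the zero
  of u is nonzero, so it can define the open set of smooth fibres.\<close>

lemma generic_fibres_smooth_if_det:
  assumes u: "u \<noteq> 0" and PQ: "sym_mat P" "sym_mat Q" and det: "det (zero_fibre u P Q) \<noteq> 0"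
  shows "generic_fibres_smooth (X 0 * qf P + X 1 * qf Q)"
proof -
  obtain p q r s t k v w m n where F: "\<forall>x y z. det_form P Q 0 x y z =
     p * x^3 + q * y^3 + r * z^3 + s * (x^2 * y) + t * (x * y^2) + k * (x^2 * z) + v * (x * z^2)
       + w * (y^2 * z) + m * (y * z^2) + n * (x * y * z)"
    using cubic_det_form[of P Q 0] unfolding cubic_form_def by (elim exE that)
  define h where "h = Const p * (X 0 * X 0 * X 0) + Const q * (X 1 * X 1 * X 1)
    + Const s * (X 0 * X 0 * X 1) + Const t * (X 0 * X 1 * X 1)"
  have h: "peval \<alpha> 0 h = det (comb (\<alpha> $ 0) P (\<alpha> $ 1) Q 0 0)" for \<alpha>
    using F[rule_format, of "\<alpha> $ 0" "\<alpha> $ 1" 0]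
    by (simp add: h_def det_form_def power2_eq_square power3_eq_cube algebra_simps)
  have "X i * X j * X l \<in> bihom (1 + 1 + 1) (0 + 0 + 0)" for i j l
    by (intro bihom_mult bihom_X)
  then have "h \<in> bihom (1 + 1 + 1) (0 + 0 + 0)"
    unfolding h_def by (intro bihom_add bihom_Const_mult)
  moreover have "h \<noteq> 0"
    using h[of "\<chi> i. if i = 0 then - u $ 1 else u $ 0"] det by auto
  ultimately have "h \<in> linear_system (1 + 1 + 1) (0 + 0 + 0)"
    by (simp only: linear_system_def Diff_iff singleton_iff not_False_eq_True simp_thms)
  then have "h \<in> linear_system 3 0" by (simp add: numeral_3_eq_3)
  moreover have "smooth_plane_curve (fibre \<alpha> (X 0 * qf P + X 1 * qf Q))" if "peval \<alpha> 0 h \<noteq> 0" for \<alpha>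
  proof -
    have "fibre \<alpha> (X 0 * qf P + X 1 * qf Q) = qf (comb (\<alpha> $ 0) P (\<alpha> $ 1) Q 0 0)"
      by (simp add: qf_comb)
    then show ?thesis
      using smooth_plane_curve_qf[of "comb (\<alpha> $ 0) P (\<alpha> $ 1) Q 0 0"] that PQ h by (simp add: sym_comb)
  qed
  ultimately show ?thesis unfolding generic_fibres_smooth_def by blast
qed

lemma jacobian_rows: "jacobian (vector [g, h] :: cpoly^2) x y $ 1 $ v = peval x y (partial v g)"
  "jacobian (vector [g, h] :: cpoly^2) x y $ 0 $ v = peval x y (partial v h)"
proof -
  \<comment> \<open>\<open>vector\<close> fills the indices 1 and 2, and 2 is the element 0: row 1
    belongs to \<open>g\<close> and row 0 to \<open>h\<close>.\<close>
  have "(2::2) = 0" by simp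
  then have "(vector [g, h] :: cpoly^2) $ 0 = h" using vector_2(2)[of g h] by metis
  then show "jacobian (vector [g, h] :: cpoly^2) x y $ 1 $ v = peval x y (partial v g)"
    "jacobian (vector [g, h] :: cpoly^2) x y $ 0 $ v = peval x y (partial v h)"
    by (simp_all add: jacobian_def)
qed

lemma jacobian_entries:
  fixes u :: "complex^2"
  assumes PQ: "sym_mat P" "sym_mat Q"
  defines "J \<equiv> jacobian (vector [lx u, X 0 * qf P + X 1 * qf Q] :: cpoly^2)"
  shows "J x y $ 1 $ Inl i = u $ i" "J x y $ 1 $ Inr j = 0"
    "J x y $ 0 $ Inl 0 = peval x y (qf P)" "J x y $ 0 $ Inl 1 = peval x y (qf Q)"
    "J x y $ 0 $ Inr j = 2 * (comb (x $ 0) P (x $ 1) Q 0 0 *v y) $ j"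
  unfolding J_def jacobian_rows
  by (simp_all add: partial_lx partial_add partial_mult partial_qf_x peval_partial_qf PQ)
    (simp add: comb_def matrix_vector_mult_def sum_3' algebra_simps)

text \<open>On the zero of u the y-part of the gradient of the second equation is a nonzero multiple
  of N y, with N the zero fibre, while the gradient of u has no y-part. If N is invertible the rows
  are independent; at a kernel vector of N only x-parts remain, and these are parallel.\<close>

lemma smooth_curve_intersection_iff:
  assumes u: "u \<noteq> 0" and PQ: "sym_mat P" "sym_mat Q"
  shows "smooth_curve_intersection (lx u) (X 0 * qf P + X 1 * qf Q) \<longleftrightarrow> det (zero_fibre u P Q) \<noteq> 0"
proof
  let ?J = "jacobian (vector [lx u, X 0 * qf P + X 1 * qf Q] :: cpoly^2)"
  note J = jacobian_entries[OF PQ, of u]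
  {
    assume smooth: "smooth_curve_intersection (lx u) (X 0 * qf P + X 1 * qf Q)"
    show "det (zero_fibre u P Q) \<noteq> 0"
    proof
      assume "det (zero_fibre u P Q) = 0"
      then obtain y where y: "y \<noteq> 0" "zero_fibre u P Q *v y = 0" using det_eq_0_iff_kernel by blast
      define x :: "complex^2" where "x = (\<chi> i. if i = 0 then - u $ 1 else u $ 0)"
      have x: "x \<noteq> 0" "x $ 0 = - u $ 1" "x $ 1 = u $ 0"
        using u by (auto simp: x_def vec2_eq_0)
      have eval: "x $ 0 * peval x y (qf P) + x $ 1 * peval x y (qf Q) = peval x y (qf (zero_fibre u P Q))"
        by (simp add: qf_comb x)
      also have "\<dots> = 0" by (simp add: peval_qf y)
      finally have 0: "- u $ 1 * peval x y (qf P) + u $ 0 * peval x y (qf Q) = 0"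
        by (simp add: x)
      have "peval x y (lx u) = 0" "peval x y (X 0 * qf P + X 1 * qf Q) = 0"
        using 0 by (simp_all add: x sum_2')
      then have "rank (?J x y) = 2"
        using smooth x y unfolding smooth_curve_intersection_def by blast
      then have r: "?J x y $ 0 \<noteq> 0" "\<And>c. ?J x y $ 1 \<noteq> c *s ?J x y $ 0"
        by (auto simp: rank_2_iff)
      have Jr: "?J x y $ 0 $ Inr j = 0" for j
        by (simp add: J x y)
      \<comment> \<open>The values (P(y), Q(y)) are annihilated by (-u1, u0), hence are a multiple
        of u; \<open>u'\<close> is u rotated so that \<open>zero_of_linear_form\<close> returns this
        multiple.\<close>
      define u' x' :: "complex^2" where "u' = (\<chi> i. if i = 0 then u $ 1 else - u $ 0)"
        and "x' = (\<chi> i. if i = 0 then peval x y (qf P) else peval x y (qf Q))"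
      have "u' \<noteq> 0" "u' $ 0 * x' $ 0 + u' $ 1 * x' $ 1 = 0"
        using 0 u by (auto simp: u'_def x'_def vec2_eq_0)
      then obtain c where "x' $ 0 = c * - u' $ 1" "x' $ 1 = c * u' $ 0"
        by (rule zero_of_linear_form)
      then have c: "peval x y (qf P) = c * u $ 0" "peval x y (qf Q) = c * u $ 1"
        by (simp_all add: u'_def x'_def)
      have row: "?J x y $ 0 $ v = c * ?J x y $ 1 $ v" for v
      proof (cases v)
        case (Inl i)
        then show ?thesis using exhaust_2'[of i] by (elim disjE) (simp_all add: J c)
      next
        case (Inr j)
        then show ?thesis by (simp add: Jr J(2))
      qed
      then have "c \<noteq> 0" using r(1) by (auto simp: vec_eq_iff)
      then have "?J x y $ 1 = inverse c *s ?J x y $ 0"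
        by (simp add: vec_eq_iff row)
      with r(2) show False by blast
    qed
  next
    assume det: "det (zero_fibre u P Q) \<noteq> 0"
    show "smooth_curve_intersection (lx u) (X 0 * qf P + X 1 * qf Q)"
      unfolding smooth_curve_intersection_def
    proof (intro allI impI, elim conjE)
      fix x :: "complex^2" and y :: "complex^3"
      assume x: "x \<noteq> 0" and y: "y \<noteq> 0" and "peval x y (lx u) = 0"
      then obtain c where c: "x $ 0 = c * - u $ 1" "x $ 1 = c * u $ 0"
        using zero_of_linear_form[OF u, of x] by (auto simp: sum_2')
      with x have "c \<noteq> 0" by (auto simp: vec2_eq_0)
      have "comb (x $ 0) P (x $ 1) Q 0 0 *v y = c *s (zero_fibre u P Q *v y)"
        by (simp add: vec_eq_iff comb_def matrix_vector_mult_3 c algebra_simps)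
      moreover have "zero_fibre u P Q *v y \<noteq> 0" using det y det_eq_0_iff_kernel by blast
      ultimately obtain j where j: "(comb (x $ 0) P (x $ 1) Q 0 0 *v y) $ j \<noteq> 0"
        using \<open>c \<noteq> 0\<close> by (auto simp: vec_eq_iff)
      have "?J x y $ 0 \<noteq> 0"
        using j J(5)[of x y j] by (metis mult_eq_0_iff zero_index zero_neq_numeral)
      moreover have "?J x y $ 1 \<noteq> d *s ?J x y $ 0" for d
      proof
        assume eq: "?J x y $ 1 = d *s ?J x y $ 0"
        have "?J x y $ 1 $ Inr j = d * ?J x y $ 0 $ Inr j" by (simp add: eq)
        then have "d = 0" using j by (simp add: J)
        then have "?J x y $ 1 $ Inl i = 0" for i by (simp add: eq)
        then show False using u by (simp add: J vec_eq_iff)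
      qed
      ultimately show "rank (?J x y) = 2" by (simp add: rank_2_iff)
    qed
  }
qed

lemma lx_eq_0: "lx u = 0 \<longleftrightarrow> u = 0"
proof
  assume "lx u = 0"
  then have "peval (axis j 1) 0 (lx u) = 0" for j by simp
  then show "u = 0" by (simp add: axis_def if_distrib vec_eq_iff cong: if_cong)
qed (simp add: lx_def)

text \<open>Translates the geometric conditions of case (1) into the determinant that decides
  semi-stability.\<close>

lemma type1_factors_iff:
  assumes u: "u \<noteq> 0" and PQ: "sym_mat P" "sym_mat Q"
  shows "type1_factors (lx u) (X 0 * qf P + X 1 * qf Q) \<longleftrightarrow> det (zero_fibre u P Q) \<noteq> 0"
proof -
  have "X 0 * qf P + X 1 * qf Q \<in> linear_system 1 2" if det: "det (zero_fibre u P Q) \<noteq> 0"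
  proof -
    have "X i * qf M \<in> bihom (1 + 0) (0 + 2)" for i M by (intro bihom_mult bihom_X qf_bihom)
    then have "X i * qf M \<in> bihom 1 2" for i M by (simp only: add_0_left add_0_right)
    then have "X 0 * qf P + X 1 * qf Q \<in> bihom 1 2" by (intro bihom_add)
    moreover have "X 0 * qf P + X 1 * qf Q \<noteq> 0"
    proof
      assume "X 0 * qf P + X 1 * qf Q = 0"
      then have "qf (zero_fibre u P Q) = fibre (\<chi> i. if i = 0 then - u $ 1 else u $ 0) 0"
        by (simp only: zero_fibre_as_fibre[symmetric])
      also have "\<dots> = 0" by (simp add: fibre_def)
      finally show False
        using smooth_plane_curve_qf[OF _ det] PQ by (simp add: sym_comb smooth_plane_curve_def)
    qed
    ultimately show ?thesis by (simp add: linear_system_def)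
  qed
  then show ?thesis
    using smooth_curve_intersection_iff[OF assms] generic_fibres_smooth_if_det[OF assms] u
    unfolding type1_factors_def by (auto simp: linear_system_def lx_eq_0 simp del: One_nat_def)
qed

lemma type1_factorsE:
  assumes "type1_factors f1 f2"
  obtains u P Q where "u \<noteq> 0" "sym_mat P" "sym_mat Q" "f1 = lx u" "f2 = X 0 * qf P + X 1 * qf Q"
    "det (zero_fibre u P Q) \<noteq> 0"
proof -
  have "f1 \<in> bihom 1 0" "f1 \<noteq> 0" "f2 \<in> bihom 1 2"
    using assms by (auto simp: type1_factors_def linear_system_def)
  then obtain u P Q where *: "f1 = lx u" "sym_mat P" "sym_mat Q" "f2 = X 0 * qf P + X 1 * qf Q"
    using bihom_1_0 bihom_1_2 by blast
  moreover have "u \<noteq> 0" using \<open>f1 \<noteq> 0\<close> * by (auto simp: lx_eq_0)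
  ultimately show thesis using that type1_factors_iff[of u P Q] assms by blast
qed

section \<open>Products of two (1,1)-forms\<close>

definition sym_product :: "complex^3 \<Rightarrow> complex^3 \<Rightarrow> complex^3^3" where
  "sym_product v w = (\<chi> j k. (v $ j * w $ k + w $ j * v $ k) / 2)"

lemma sym_sym_product [simp]: "sym_mat (sym_product v w)"
  by (rule sym_matI) (simp add: sym_product_def algebra_simps)

lemma qf_sym_product: "qf (sym_product v w) = ly v * ly w"
proof -
  define S where "S a b = (\<Sum>j\<in>UNIV. \<Sum>k\<in>UNIV. Const (a $ j * b $ k / 2) * Y j * Y k)" for a b :: "complex^3"
  have "qf (sym_product v w) = S v w + S w v"
    by (simp add: qf_def sym_product_def S_def add_divide_distrib Const_add distrib_right sum.distrib)
  moreover have "S w v = S v w"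
    unfolding S_def by (subst sum.swap) (simp add: mult_ac)
  moreover have "S v w + S v w = ly v * ly w"
  proof -
    have "Const (c / 2) + Const (c / 2) = Const c" for c by (simp flip: Const_add)
    then have "Const (c / 2) * Y j * Y k + Const (c / 2) * Y j * Y k = Const c * Y j * Y k" for c j k
      by (metis distrib_right)
    then have "S v w + S v w = (\<Sum>j\<in>UNIV. \<Sum>k\<in>UNIV. Const (v $ j * w $ k) * Y j * Y k)"
      unfolding S_def sum.distrib[symmetric] by (intro sum.cong refl)
    then show ?thesis
      by (simp add: ly_def sum_product Const_mult mult_ac)
  qed
  ultimately show ?thesis by simp
qed

text \<open>With the line moved to y0, every monomial contains y0, so the weights 2, -1, -1 on y
  make all total weights at least 1.\<close>

lemma line_factor_not_semistable:
  assumes "v \<noteq> 0"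
  shows "\<not> git_semistable (ly v * ((X 0)\<^sup>2 * ly A + X 0 * X 1 * ly B + (X 1)\<^sup>2 * ly C))"
proof -
  obtain D :: "complex^3^3" where D: "det D = 1" "v v* D = axis 0 1"
    using SL3_linear_form[OF assms] .
  let ?S = "\<lambda>w. sym_product (axis 0 1) (w v* D)"
  define b where "b j = (if j = 0 then 2 else - 1 :: int)" for j :: 3
  have "\<not> git_semistable (quad (?S A) (?S B) (?S C))"
  proof -
    have "0 < b j + b k" if "?S w $ j $ k \<noteq> 0" for j k w
      using that by (cases "j = 0"; cases "k = 0") (auto simp: b_def sym_product_def axis_def)
    then show ?thesis
      by (intro not_semistable_if_weights[where a = 0 and b = b]) (auto simp: b_def)
  qed
  moreover have "gact (mat 1) D (ly v * ((X 0)\<^sup>2 * ly A + X 0 * X 1 * ly B + (X 1)\<^sup>2 * ly C))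
      = quad (?S A) (?S B) (?S C)"
    by (simp add: quad_def qf_sym_product D(2) lx_def sum_2' mat_def algebra_simps)
  moreover have "git_semistable (gact (mat 1) D (ly v * ((X 0)\<^sup>2 * ly A + X 0 * X 1 * ly B + (X 1)\<^sup>2 * ly C)))
      \<longleftrightarrow> git_semistable (ly v * ((X 0)\<^sup>2 * ly A + X 0 * X 1 * ly B + (X 1)\<^sup>2 * ly C))"
    by (rule semistable_gact) (simp_all add: D)
  ultimately show ?thesis by simp
qed

text \<open>The vanishing of all 2x2 minors also admits zero vectors. Its negation thus says that
  both forms define lines and that these lines differ.\<close>

definition proportional :: "complex^3 \<Rightarrow> complex^3 \<Rightarrow> bool" where
  "proportional v w \<longleftrightarrow> (\<forall>i j. v $ i * w $ j = v $ j * w $ i)"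

abbreviation pencil :: "complex^3 \<Rightarrow> complex^3 \<Rightarrow> complex^2 \<Rightarrow> complex^3" where
  "pencil L L' \<alpha> \<equiv> \<alpha> $ 0 *s L + \<alpha> $ 1 *s L'"

lemma proportionalE:
  assumes "proportional v w"
  obtains e c d where "e \<noteq> 0" "v = c *s e" "w = d *s e"
proof (cases "v = 0")
  case True
  show thesis
  proof (cases "w = 0")
    case True
    then show ?thesis
      using \<open>v = 0\<close> that[of "axis 0 1" 0 0] by (simp add: axis_eq_0_iff)
  next
    case False
    then show ?thesis using \<open>v = 0\<close> that[of w 0 1] by simp
  qed
next
  case False
  then obtain i where i: "v $ i \<noteq> 0" by (auto simp: vec_eq_iff)
  have "w = (w $ i / v $ i) *s v"
    using i assms by (simp add: vec_eq_iff proportional_def field_simps)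
  with False show ?thesis using that[of v 1 "w $ i / v $ i"] by simp
qed

lemma proportional_if_dependent:
  assumes "c *s v + d *s w = 0" "c \<noteq> 0 \<or> d \<noteq> 0"
  shows "proportional v w"
proof -
  have *: "c * v $ i = - (d * w $ i)" for i
    using assms(1) by (simp add: vec_eq_iff add_eq_0_iff)
  have "v $ i * w $ j = v $ j * w $ i" for i j
  proof -
    have "c * (v $ i * w $ j) = c * (v $ j * w $ i)"
      using *[of i] *[of j] by (metis mult.assoc mult.commute mult_minus_left)
    moreover have "d * (v $ i * w $ j) = d * (v $ j * w $ i)"
      using *[of i] *[of j] by (metis mult.assoc mult.commute mult_minus_left minus_equation_iff)
    ultimately show ?thesis using assms(2) by auto
  qed
  then show ?thesis by (simp add: proportional_def)
qed

lemma product_1_1_eq_quad: "(X 0 * ly L + X 1 * ly L') * (X 0 * ly M + X 1 * ly M')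
    = quad (sym_product L M) (comb 1 (sym_product L M') 1 (sym_product L' M) 0 0) (sym_product L' M')"
  by (simp add: quad_def qf_sym_product qf_comb power2_eq_square algebra_simps)

text \<open>After the substitution the coefficients of x0 and x1 are the fibres over the points
  given by the columns of \<open>C\<close>.\<close>

lemma gact_1_1: "gact C D (X 0 * ly L + X 1 * ly L')
    = X 0 * ly (pencil L L' (column 0 C) v* D) + X 1 * ly (pencil L L' (column 1 C) v* D)"
proof -
  have "(c *s v) v* D = c *s (v v* D)" for c v
    by (simp add: vec_eq_iff vector_matrix_mult_def sum_distrib_left mult_ac)
  moreover have "(v + w) v* D = v v* D + w v* D" for v w
    by (simp add: vec_eq_iff vector_matrix_mult_def sum.distrib distrib_right)
  ultimately show ?thesis
    by (simp add: lx_def sum_2' ly_add ly_scale column_def algebra_simps)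
qed

lemma SL2_first_column:
  fixes \<alpha> :: "complex^2"
  assumes "\<alpha> \<noteq> 0"
  obtains C :: "complex^2^2" where "det C = 1" "column 0 C = \<alpha>"
proof (cases "\<alpha> $ 0 = 0")
  case True
  with assms have "\<alpha> $ 1 \<noteq> 0" by (simp add: vec2_eq_0)
  with True show ?thesis
    by (intro that[of "\<chi> i k. if k = 0 then \<alpha> $ i else if i = 0 then - inverse (\<alpha> $ 1) else 0"])
      (simp_all add: det_2' column_def vec_eq_iff)
next
  case False
  then show ?thesis
    by (intro that[of "\<chi> i k. if k = 0 then \<alpha> $ i else if i = 0 then 0 else inverse (\<alpha> $ 0)"])
      (simp_all add: det_2' column_def vec_eq_iff)
qed

text \<open>Moving the point to [1,0] and the common line to y0 makes the x0^2 conic a multiple of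
  y0^2 and the x0 x1 conic divisible by y0.\<close>

lemma proportional_fibres_not_semistable:
  assumes \<alpha>: "\<alpha> \<noteq> 0" and par: "proportional (pencil L L' \<alpha>) (pencil M M' \<alpha>)"
  shows "\<not> git_semistable ((X 0 * ly L + X 1 * ly L') * (X 0 * ly M + X 1 * ly M'))"
proof -
  obtain C :: "complex^2^2" where C: "det C = 1" "column 0 C = \<alpha>"
    using SL2_first_column[OF \<alpha>] .
  obtain e c d where e: "e \<noteq> 0" "pencil L L' \<alpha> = c *s e" "pencil M M' \<alpha> = d *s e"
    using proportionalE[OF par] .
  obtain D :: "complex^3^3" where D: "det D = 1" "e v* D = axis 0 1"
    using SL3_linear_form[OF e(1)] .
  let ?f = "(X 0 * ly L + X 1 * ly L') * (X 0 * ly M + X 1 * ly M')"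
  let ?L = "pencil L L' (column 1 C) v* D" and ?M = "pencil M M' (column 1 C) v* D"
  have scale: "(c *s e) v* D = c *s axis 0 1" for c
    by (simp add: vec_eq_iff vector_matrix_mult_def sum_3' flip: D(2)) (simp add: algebra_simps)
  \<comment> \<open>With a = -3 the least weights are -6 + 8 for x0^2 y0^2, 4 - 2 for x0 x1 y0 y_k,
    and 6 - 4 for x1^2 y_j y_k: always 2.\<close>
  define b where "b j = (if j = 0 then 4 else - 2 :: int)" for j :: 3
  have "\<not> git_semistable (quad (sym_product (c *s axis 0 1) (d *s axis 0 1))
     (comb 1 (sym_product (c *s axis 0 1) ?M) 1 (sym_product ?L (d *s axis 0 1)) 0 0) (sym_product ?L ?M))"
  proof (rule not_semistable_if_weights[where a = "-3" and b = b])
    show "0 < 2 * - 3 + b j + b k" if "sym_product (c *s axis 0 1) (d *s axis 0 1) $ j $ k \<noteq> 0" for j k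
      using that by (cases "j = 0"; cases "k = 0") (auto simp: b_def sym_product_def axis_def)
    show "0 < b j + b k"
      if "comb 1 (sym_product (c *s axis 0 1) ?M) 1 (sym_product ?L (d *s axis 0 1)) 0 0 $ j $ k \<noteq> 0" for j k
      using that by (cases "j = 0"; cases "k = 0") (auto simp: b_def sym_product_def axis_def comb_def)
  qed (auto simp: b_def)
  moreover have "gact C D ?f = quad (sym_product (c *s axis 0 1) (d *s axis 0 1))
     (comb 1 (sym_product (c *s axis 0 1) ?M) 1 (sym_product ?L (d *s axis 0 1)) 0 0) (sym_product ?L ?M)"
    unfolding product_1_1_eq_quad[symmetric] gact_simps(7) gact_1_1 C(2) e scale ..
  moreover have "git_semistable (gact C D ?f) \<longleftrightarrow> git_semistable ?f"
    using C(1) D(1) by (rule semistable_gact)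
  ultimately show ?thesis by (simp only: simp_thms)
qed

lemma complex_quadratic_root: "\<exists>s::complex. s\<^sup>2 - q * s + c = 0"
proof -
  define s where "s = (q + csqrt (q\<^sup>2 - 4 * c)) / 2"
  have "2 * s - q = csqrt (q\<^sup>2 - 4 * c)" by (simp add: s_def field_simps)
  then have "(2 * s - q)\<^sup>2 = q\<^sup>2 - 4 * c" by simp
  then have "4 * (s\<^sup>2 - q * s + c) = 0" by (simp add: power2_eq_square algebra_simps)
  then have "s\<^sup>2 - q * s + c = 0" by (metis mult_eq_0_iff zero_neq_numeral)
  then show ?thesis ..
qed

lemma parallel_vectorsE:
  fixes \<gamma> \<delta> :: "complex^2"
  assumes "\<gamma> $ 0 * \<delta> $ 1 = \<gamma> $ 1 * \<delta> $ 0"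
  obtains e c d where "e \<noteq> 0" "\<gamma> = c *s e" "\<delta> = d *s e"
proof (cases "\<gamma> = 0")
  case True
  show thesis
  proof (cases "\<delta> = 0")
    case True
    then show ?thesis
      using \<open>\<gamma> = 0\<close> that[of "axis 0 1" 0 0] by (simp add: axis_eq_0_iff)
  next
    case False
    then show ?thesis using \<open>\<gamma> = 0\<close> that[of \<delta> 0 1] by simp
  qed
next
  case False
  then consider "\<gamma> $ 0 \<noteq> 0" | "\<gamma> $ 1 \<noteq> 0" by (auto simp: vec2_eq_0)
  then show ?thesis
  proof cases
    case 1
    then have "\<delta> = (\<delta> $ 0 / \<gamma> $ 0) *s \<gamma>"
      using assms by (simp add: vec_eq_iff forall_2' field_simps)
    then show ?thesis using False that[of \<gamma> 1 "\<delta> $ 0 / \<gamma> $ 0"] by simp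
  next
    case 2
    then have "\<delta> = (\<delta> $ 1 / \<gamma> $ 1) *s \<gamma>"
      using assms by (simp add: vec_eq_iff forall_2' field_simps)
    then show ?thesis using False that[of \<gamma> 1 "\<delta> $ 1 / \<gamma> $ 1"] by simp
  qed
qed

text \<open>Four vectors in a three-dimensional space are linearly dependent.\<close>

lemma pencils_meet:
  obtains \<alpha> \<beta> where "\<alpha> \<noteq> 0 \<or> \<beta> \<noteq> 0" "pencil L L' \<alpha> = pencil M M' \<beta>"
proof -
  \<comment> \<open>The columns are L, L', -M. A kernel vector is a relation among these three; if
    there is none, \<open>K\<close> is invertible and M' is expressed through them.\<close>
  define K :: "complex^3^3" where "K = (\<chi> i j. if j = 0 then L $ i else if j = 1 then L' $ i else - M $ i)"
  have K: "K *v x = x $ 0 *s L + x $ 1 *s L' - x $ 2 *s M" for x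
    by (simp add: vec_eq_iff matrix_vector_mult_3 K_def algebra_simps)
  let ?v = "\<lambda>a b. \<chi> i::2. if i = 0 then a else b"
  show thesis
  proof (cases "det K = 0")
    case True
    then obtain x where x: "x \<noteq> 0" "K *v x = 0" using det_eq_0_iff_kernel by blast
    have "x $ 0 *s L + x $ 1 *s L' = x $ 2 *s M" using x(2) by (simp add: K)
    then show ?thesis
      using x(1) by (intro that[of "?v (x $ 0) (x $ 1)" "?v (x $ 2) 0"]) (auto simp: vec2_eq_0 vec3_eq_0)
  next
    case False
    let ?x = "matrix_inv K *v M'"
    have "K *v ?x = M'" using matrix_inv_inverse(1)[OF False] by (simp add: matrix_vector_mul_assoc)
    then have "?x $ 0 *s L + ?x $ 1 *s L' = ?x $ 2 *s M + M'" by (simp add: K diff_eq_eq add.commute)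
    then show ?thesis
      by (intro that[of "?v (?x $ 0) (?x $ 1)" "?v (?x $ 2) 1"]) (auto simp: vec2_eq_0)
  qed
qed

lemma pencil_linear: "pencil L L' (c *s \<alpha> + d *s \<beta>) = c *s pencil L L' \<alpha> + d *s pencil L L' \<beta>"
  by (simp add: vec_eq_iff algebra_simps)

lemma pencil_scale: "pencil L L' (c *s \<alpha>) = c *s pencil L L' \<alpha>"
  by (simp add: vec_eq_iff algebra_simps)

text \<open>The scalar k remains because three independent forms can be moved to y0, y1, y2 by SL_3
  only up to a common factor.\<close>

definition type2_form :: "complex \<Rightarrow> cpoly" where
  "type2_form k = (Const k * X 0 * Y 2 + Const k * X 1 * Y 1) * (Const k * X 0 * Y 1 + Const k * X 1 * Y 0)"

lemma type2_normal_form: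
  assumes indep: "\<And>\<alpha>. \<alpha> \<noteq> 0 \<Longrightarrow> \<not> proportional (pencil L L' \<alpha>) (pencil M M' \<alpha>)"
  obtains C D k where "det C = 1" "det D = 1" "k \<noteq> 0"
    "gact C D ((X 0 * ly L + X 1 * ly L') * (X 0 * ly M + X 1 * ly M')) = type2_form k"
proof -
  obtain \<alpha> \<beta> where ab: "\<alpha> \<noteq> 0 \<or> \<beta> \<noteq> 0" "pencil L L' \<alpha> = pencil M M' \<beta>"
    by (rule pencils_meet)
  let ?\<Delta> = "\<beta> $ 0 * \<alpha> $ 1 - \<beta> $ 1 * \<alpha> $ 0"
  \<comment> \<open>If \<alpha> and \<beta> were multiples of one point e, their relation would make
    the two fibres over e proportional.\<close>
  have \<Delta>: "?\<Delta> \<noteq> 0"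
  proof
    assume "?\<Delta> = 0"
    then have "\<beta> $ 0 * \<alpha> $ 1 = \<beta> $ 1 * \<alpha> $ 0" by simp
    then obtain e c d where e: "e \<noteq> 0" "\<beta> = c *s e" "\<alpha> = d *s e"
      by (rule parallel_vectorsE)
    have "d *s pencil L L' e + (- c) *s pencil M M' e = 0"
      using ab(2) by (simp only: e pencil_scale) simp
    moreover have "d \<noteq> 0 \<or> - c \<noteq> 0" using ab(1) e by auto
    ultimately show False using indep[OF e(1)] proportional_if_dependent by blast
  qed
  \<comment> \<open>Rescales both points by the same factor, which keeps the relation and makes the
    determinant of \<open>C\<close> equal to 1.\<close>
  define s where "s = csqrt (inverse ?\<Delta>)"
  have s2: "s\<^sup>2 * ?\<Delta> = 1" using \<Delta> by (simp add: s_def)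
  then have s: "s \<noteq> 0" by auto
  define a b where "a = s *s \<alpha>" and "b = s *s \<beta>"
  have det_ab: "b $ 0 * a $ 1 - b $ 1 * a $ 0 = 1"
    using s2 by (simp add: a_def b_def power2_eq_square algebra_simps)
  have ab': "pencil L L' a = pencil M M' b"
    unfolding a_def b_def pencil_scale by (simp only: ab(2))
  define C :: "complex^2^2" where "C = (\<chi> i k. if k = 0 then b $ i else a $ i)"
  have C: "det C = 1" "column 0 C = b" "column 1 C = a"
    using det_ab by (simp_all add: C_def det_2' column_def vec_eq_iff algebra_simps)
  define R :: "complex^3^3" where
    "R = (\<chi> i. if i = 0 then pencil M M' a else if i = 1 then pencil L L' a else pencil L L' b)"
  have R: "det R \<noteq> 0"
  proof
    assume "det R = 0"
    then have "det (transpose R) = 0" by (simp add: det_transpose)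
    then obtain x where x: "x \<noteq> 0" "transpose R *v x = 0" using det_eq_0_iff_kernel by blast
    have "transpose R *v x = x $ 0 *s pencil M M' a + x $ 1 *s pencil L L' a + x $ 2 *s pencil L L' b"
      by (simp add: vec_eq_iff matrix_vector_mult_3 transpose_def R_def algebra_simps)
    with x have rel: "x $ 0 *s pencil M M' a + x $ 1 *s pencil L L' a + x $ 2 *s pencil L L' b = 0" by simp
    \<comment> \<open>As L(a) = M(b), the term x1 L(a) splits into r L(a) + (x1 - r) M(b), and the
      relation reads L(\<gamma>) + M(\<delta>) = 0. This r makes \<gamma> and \<delta> parallel, so
      the relation lives over a single point.\<close>
    obtain r where r: "r\<^sup>2 - x $ 1 * r + x $ 0 * x $ 2 = 0" using complex_quadratic_root by blast
    define \<gamma> \<delta> where "\<gamma> = r *s a + x $ 2 *s b" and "\<delta> = x $ 0 *s a + (x $ 1 - r) *s b"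
    have "\<gamma> $ 0 * \<delta> $ 1 - \<gamma> $ 1 * \<delta> $ 0
        = (b $ 0 * a $ 1 - b $ 1 * a $ 0) * (r\<^sup>2 - x $ 1 * r + x $ 0 * x $ 2)"
      by (simp add: \<gamma>_def \<delta>_def power2_eq_square algebra_simps)
    then have "\<gamma> $ 0 * \<delta> $ 1 = \<gamma> $ 1 * \<delta> $ 0" using r by simp
    then obtain e c d where e: "e \<noteq> 0" "\<gamma> = c *s e" "\<delta> = d *s e"
      by (rule parallel_vectorsE)
    have "pencil L L' \<gamma> + pencil M M' \<delta>
        = x $ 0 *s pencil M M' a + (r *s pencil L L' a + (x $ 1 - r) *s pencil M M' b) + x $ 2 *s pencil L L' b"
      unfolding \<gamma>_def \<delta>_def pencil_linear by (simp add: add_ac)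
    also have "r *s pencil L L' a + (x $ 1 - r) *s pencil M M' b = x $ 1 *s pencil L L' a"
      unfolding ab' by (simp add: vec_eq_iff algebra_simps)
    finally have "c *s pencil L L' e + d *s pencil M M' e = 0"
      using rel by (simp only: e pencil_scale)
    with indep[OF e(1)] have "c = 0" "d = 0" using proportional_if_dependent by blast+
    with e have 0: "\<gamma> = 0" "\<delta> = 0" by simp_all
    have coord: "p = 0 \<and> q = 0" if "p *s a + q *s b = 0" for p q
    proof -
      have eqs: "p * a $ 0 + q * b $ 0 = 0" "p * a $ 1 + q * b $ 1 = 0"
        using that by (simp_all add: vec_eq_iff)
      have "p * (b $ 0 * a $ 1 - b $ 1 * a $ 0) = b $ 0 * (p * a $ 1 + q * b $ 1) - b $ 1 * (p * a $ 0 + q * b $ 0)"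
        "q * (b $ 0 * a $ 1 - b $ 1 * a $ 0) = a $ 1 * (p * a $ 0 + q * b $ 0) - a $ 0 * (p * a $ 1 + q * b $ 1)"
        by (simp_all add: algebra_simps)
      then show ?thesis unfolding eqs det_ab by simp
    qed
    have "r = 0" "x $ 2 = 0" "x $ 0 = 0" "x $ 1 - r = 0"
      using coord[of r "x $ 2"] coord[of "x $ 0" "x $ 1 - r"] 0 by (simp_all add: \<gamma>_def \<delta>_def)
    then show False using x(1) by (simp add: vec3_eq_0)
  qed
  \<comment> \<open>k times the inverse of \<open>R\<close> has determinant k^3 / det R, which must
    be 1.\<close>
  obtain k where k: "k ^ 3 = det R"
  proof -
    have "(exp (Ln (det R) / 3)) ^ 3 = det R"
      using R by (simp flip: exp_of_nat_mult)
    with that show thesis by blast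
  qed
  then have k0: "k \<noteq> 0" using R by auto
  define D :: "complex^3^3" where "D = (\<chi> i j. k * matrix_inv R $ i $ j)"
  have RD: "(R $ i) v* D = k *s axis i 1" for i
  proof -
    have "((R $ i) v* D) $ j = k * (R ** matrix_inv R) $ i $ j" for j
      by (simp add: vector_matrix_mult_def matrix_matrix_mult_def D_def sum_distrib_left mult_ac)
    then show ?thesis
      using matrix_inv_inverse(1)[OF R] by (auto simp: vec_eq_iff mat_def axis_def)
  qed
  have "det D = k ^ 3 * det (matrix_inv R)"
    by (simp add: D_def det_3' power3_eq_cube algebra_simps)
  also have "\<dots> = det (R ** matrix_inv R)" by (simp add: det_mul k)
  finally have D: "det D = 1" using matrix_inv_inverse(1)[OF R] by simp
  have rows: "pencil M M' a v* D = k *s axis 0 1" "pencil L L' a v* D = k *s axis 1 1"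
    "pencil L L' b v* D = k *s axis 2 1"
    using RD[of 0] RD[of 1] RD[of 2] by (simp_all add: R_def)
  have "gact C D ((X 0 * ly L + X 1 * ly L') * (X 0 * ly M + X 1 * ly M')) = type2_form k"
    unfolding gact_simps(7) gact_1_1 C rows ab'[symmetric] type2_form_def ly_scale ly_axis
    by (simp only: mult.left_commute mult.assoc)
  with C(1) D k0 that show thesis by blast
qed

lemma type2_form_eq_quad: "type2_form k = quad (sym_product (k *s axis 2 1) (k *s axis 1 1))
    (comb 1 (sym_product (k *s axis 2 1) (k *s axis 0 1)) 1 (sym_product (k *s axis 1 1) (k *s axis 1 1)) 0 0)
    (sym_product (k *s axis 1 1) (k *s axis 0 1))"
  unfolding product_1_1_eq_quad[symmetric] type2_form_def ly_scale ly_axis by (simp add: mult_ac)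

lemma type2_form_semistable:
  assumes "k \<noteq> 0"
  shows "git_semistable (type2_form k)"
proof -
  let ?P = "sym_product (k *s axis 2 1) (k *s axis 1 1)"
  let ?Q = "comb 1 (sym_product (k *s axis 2 1) (k *s axis 0 1)) 1 (sym_product (k *s axis 1 1) (k *s axis 1 1)) 0 0"
  let ?R = "sym_product (k *s axis 1 1) (k *s axis 0 1)"
  \<comment> \<open>The cubic is (k^6 / 4) (x y z - y^3), written with all ten coefficients to match
    \<open>invariant_coeffs\<close>.\<close>
  have "det_form ?P ?Q ?R x y z = 0 * x^3 + (- (k^6) / 4) * y^3 + 0 * z^3 + 0 * (x^2 * y) + 0 * (x * y^2)
     + 0 * (x^2 * z) + 0 * (x * z^2) + 0 * (y^2 * z) + 0 * (y * z^2) + (k^6 / 4) * (x * y * z)" for x y z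
    by (simp add: det_form_def det_3' comb_def sym_product_def axis_def power3_eq_cube
        eval_nat_numeral field_simps)
  then have "quad_invariant ?P ?Q ?R = 4 * (4 * 0 - 0) * (4 * 0 - 0) - (2 * (k^6 / 4) - 3 * (- (k^6) / 4))\<^sup>2"
    by (rule invariant_coeffs)
  also have "\<dots> \<noteq> 0" using assms by simp
  finally show ?thesis
    unfolding type2_form_eq_quad by (intro semistable_if_invariant) (auto intro!: sym_comb)
qed

lemma type2_form_infinite_stabilizer:
  "infinite {(C, D). det C = 1 \<and> det D = 1 \<and> gact C D (type2_form k) = type2_form k}"
proof -
  \<comment> \<open>Weights (1, -1) on x and (2, 0, -2) on y give the two factors weights -1 and 1,
    which cancel in the product.\<close>
  define d where "d t j = (if j = 0 then t\<^sup>2 else if j = 1 then 1 else (inverse t)\<^sup>2)" for t :: complex and j :: 3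
  have "det (diag3 (d t)) = 1 \<and> gact (diag2 t) (diag3 (d t)) (type2_form k) = type2_form k"
    if t: "t \<noteq> 0" for t
  proof
    show "det (diag3 (d t)) = 1" using t by (simp add: det_diag3 d_def flip: power_mult_distrib)
    have inv: "Const t * Const (inverse t) = 1" using t by (simp flip: Const_mult)
    have X: "lx (diag2 t $ 0) = Const t * X 0" "lx (diag2 t $ 1) = Const (inverse t) * X 1"
      by (simp_all add: lx_def sum_2' diag2_def)
    have Y: "ly (diag3 (d t) $ 0) = Const t * (Const t * Y 0)" "ly (diag3 (d t) $ 1) = Y 1"
      "ly (diag3 (d t) $ 2) = Const (inverse t) * (Const (inverse t) * Y 2)"
      by (simp_all add: ly_def sum_3' diag3_def d_def power2_eq_square Const_mult mult_ac)
    have "gact (diag2 t) (diag3 (d t)) (type2_form k)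
      = (Const k * (Const t * X 0) * (Const (inverse t) * (Const (inverse t) * Y 2)) + Const k * (Const (inverse t) * X 1) * Y 1)
      * (Const k * (Const t * X 0) * Y 1 + Const k * (Const (inverse t) * X 1) * (Const t * (Const t * Y 0)))"
      by (simp add: type2_form_def X Y)
    also have "\<dots> = type2_form k"
      unfolding type2_form_def using inv by algebra
    finally show "gact (diag2 t) (diag3 (d t)) (type2_form k) = type2_form k" .
  qed
  then show ?thesis
    by (rule infinite_stabilizer_if_torus)
qed

section \<open>Reducible (2,2)-forms\<close>

lemma bihom_degree_unique: "p \<in> bihom a b \<Longrightarrow> p \<in> bihom c d \<Longrightarrow> p \<noteq> 0 \<Longrightarrow> a = c \<and> b = d"
proof -
  assume p: "p \<in> bihom a b" "p \<in> bihom c d" "p \<noteq> 0"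
  then have "\<not> (\<forall>m. Poly_Mapping.lookup p m = Poly_Mapping.lookup 0 m)"
    using poly_mapping_eqI by blast
  then obtain m where "m \<in> Poly_Mapping.keys p" by (auto simp: in_keys_iff)
  with p(1,2) show ?thesis by (auto simp: bihom_def)
qed

lemma bihom_0_0_unit: "p \<in> bihom 0 0 \<Longrightarrow> p \<noteq> 0 \<Longrightarrow> p dvd 1"
proof -
  assume "p \<in> bihom 0 0" "p \<noteq> 0"
  then obtain c where "p = Const c" "c \<noteq> 0" using bihom_0_0 Const_0 by metis
  then have "p * Const (inverse c) = 1" by (simp flip: Const_mult)
  then show ?thesis by (metis dvd_triv_left)
qed

lemma binary_quadratic_factor:
  obtains u w where "Const a * (X 0)\<^sup>2 + Const b * (X 0 * X 1) + Const c * (X 1)\<^sup>2 = lx u * lx w"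
proof -
  define v where "v r s = (\<chi> i::2. if i = 0 then r else (s :: complex))" for r s
  have v: "lx (v r s) = Const r * X 0 + Const s * X 1" for r s by (simp add: lx_def sum_2' v_def)
  show thesis
  proof (cases "a = 0")
    case True
    then show ?thesis
      by (intro that[of "v 0 1" "v b c"]) (simp add: v power2_eq_square algebra_simps)
  next
    case False
    obtain r where "r\<^sup>2 - (- b / a) * r + c / a = 0" using complex_quadratic_root by blast
    then have "a * r\<^sup>2 + b * r + c = 0"
      using False by (simp add: field_simps)
    then have c: "c = - r * (b + a * r)"
      by algebra
    show ?thesis
      by (intro that[of "v 1 (- r)" "v a (b + a * r)"])
        (simp add: v c power2_eq_square Const_mult Const_add Const_diff Const_uminus algebra_simps)
  qed
qed

text \<open>Both factors are bihomogeneous. A factor of bidegree (0,0) is a unit, which leaves seven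
  possible bidegrees for the first factor; up to exchanging the factors four types remain.\<close>

lemma reducible_cases:
  assumes f: "f \<in> linear_system 2 2" and red: "\<not> irreducible f"
  obtains (linear) u P Q where "u \<noteq> 0" "sym_mat P" "sym_mat Q" "f = lx u * (X 0 * qf P + X 1 * qf Q)"
  | (line) v A B C where "v \<noteq> 0" "f = ly v * ((X 0)\<^sup>2 * ly A + X 0 * X 1 * ly B + (X 1)\<^sup>2 * ly C)"
  | (bilinear) L L' M M' where "f = (X 0 * ly L + X 1 * ly L') * (X 0 * ly M + X 1 * ly M')"
proof -
  have fV: "f \<in> V" and f0: "f \<noteq> 0" using f by (auto simp: linear_system_def)
  have "\<not> f dvd 1"
  proof
    assume "f dvd 1"
    then obtain g where g: "f * g = 1" by (metis dvdE)
    have "f * g \<in> bihom 0 0" using bihom_Const[of 1] by (simp add: g)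
    then obtain a1 a2 b1 b2 where "f \<in> bihom a1 b1" "a1 + a2 = 0" "b1 + b2 = 0"
      using g by (metis bihom_factors zero_neq_one)
    then show False using bihom_degree_unique[OF fV _ f0, of a1 b1] by simp
  qed
  then obtain p q where pq: "f = p * q" "\<not> p dvd 1" "\<not> q dvd 1"
    using red f0 by (auto simp: irreducible_def)
  have nz: "p \<noteq> 0" "q \<noteq> 0" using f0 pq by auto
  obtain a b c d where deg: "p \<in> bihom a b" "q \<in> bihom c d" "a + c = 2" "b + d = 2"
    using bihom_factors[of p q 2 2] fV f0 pq(1) by metis
  have lin: thesis if "g \<in> bihom 1 0" "h \<in> bihom 1 2" "f = g * h" "g \<noteq> 0" for g h
  proof -
    from that obtain u where "g = lx u" using bihom_1_0 by blast
    moreover from that obtain P Q where "sym_mat P" "sym_mat Q" "h = X 0 * qf P + X 1 * qf Q"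
      using bihom_1_2 by blast
    ultimately show thesis using that linear[of u P Q] by (auto simp: lx_eq_0)
  qed
  have line': thesis if "g \<in> bihom 0 1" "h \<in> bihom 2 1" "f = g * h" "g \<noteq> 0" for g h
  proof -
    from that obtain v where "g = ly v" using bihom_0_1 by blast
    moreover from that obtain A B C where "h = (X 0)\<^sup>2 * ly A + X 0 * X 1 * ly B + (X 1)\<^sup>2 * ly C"
      using bihom_2_1 by blast
    ultimately show thesis using that line[of v A B C] by (auto simp: ly_eq_0_iff)
  qed
  \<comment> \<open>Over the complex numbers a binary quadratic form splits, so the type (2,0) +
    (0,2) is absorbed into the case of a (1,0)-factor.\<close>
  have quadric: thesis if "g \<in> bihom 2 0" "h \<in> bihom 0 2" "f = g * h" "g \<noteq> 0" for g h
  proof -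
    from that obtain r s t where "g = Const r * (X 0)\<^sup>2 + Const s * (X 0 * X 1) + Const t * (X 1)\<^sup>2"
      using bihom_2_0 by blast
    then obtain u w where uw: "g = lx u * lx w" using binary_quadratic_factor by metis
    have "lx w * h \<in> bihom (1 + 0) (0 + 2)" using that by (intro bihom_mult lx_bihom)
    then have "lx w * h \<in> bihom 1 2" by (simp only: add_0_left add_0_right)
    from lin[OF lx_bihom this] show thesis using that uw by (auto simp: mult.assoc)
  qed
  have "\<not> (a = 0 \<and> b = 0)" "\<not> (c = 0 \<and> d = 0)"
    using deg(1,2) nz pq(2,3) bihom_0_0_unit by blast+
  moreover have "a \<in> {0,1,2}" "b \<in> {0,1,2}" "c = 2 - a" "d = 2 - b" using deg(3,4) by auto
  ultimately consider "a = 1 \<and> b = 0" | "c = 1 \<and> d = 0" | "a = 0 \<and> b = 1" | "c = 0 \<and> d = 1"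
    | "a = 1 \<and> b = 1" | "a = 2 \<and> b = 0" | "c = 2 \<and> d = 0" by auto
  then show thesis
  proof cases
    case 1
    with deg show ?thesis using lin[of p q] pq(1) nz by auto
  next
    case 2
    with deg show ?thesis using lin[of q p] pq(1) nz by (auto simp: mult.commute)
  next
    case 3
    with deg show ?thesis using line'[of p q] pq(1) nz by auto
  next
    case 4
    with deg show ?thesis using line'[of q p] pq(1) nz by (auto simp: mult.commute)
  next
    case 5
    with deg have "p \<in> bihom 1 1" "q \<in> bihom 1 1" by auto
    then show ?thesis using bihom_1_1 bilinear pq(1) by metis
  next
    case 6
    with deg show ?thesis using quadric[of p q] pq(1) nz by auto
  next
    case 7
    with deg show ?thesis using quadric[of q p] pq(1) nz by (auto simp: mult.commute)
  qed
qed

section \<open>Different lines as non-proportional forms\<close>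

lemma plane_zeros_ly: "plane_zeros (ly v) = {y. y \<noteq> 0 \<and> (\<Sum>j\<in>UNIV. v $ j * y $ j) = 0}"
  by (simp add: plane_zeros_def)

lemma plane_zeros_neq_iff:
  assumes "v \<noteq> 0" "w \<noteq> 0"
  shows "plane_zeros (ly v) \<noteq> plane_zeros (ly w) \<longleftrightarrow> \<not> proportional v w"
proof
  assume neq: "plane_zeros (ly v) \<noteq> plane_zeros (ly w)"
  show "\<not> proportional v w"
  proof
    assume "proportional v w"
    then obtain e c d where e: "v = c *s e" "w = d *s e" by (rule proportionalE)
    with assms have "c \<noteq> 0" "d \<noteq> 0" by auto
    then show False
      using neq unfolding plane_zeros_ly e
      by (simp add: mult.assoc flip: sum_distrib_left)
  qed
next
  assume "\<not> proportional v w"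
  then obtain i j where ij: "v $ i * w $ j \<noteq> v $ j * w $ i" by (auto simp: proportional_def)
  \<comment> \<open>A point on the line of w by construction; the value of v there is a nonzero
    minor.\<close>
  define y where "y = w $ j *s axis i 1 - w $ i *s axis j (1::complex)"
  have pair: "(\<Sum>k\<in>UNIV. u $ k * y $ k) = u $ i * w $ j - u $ j * w $ i" for u
  proof -
    have "u $ k * y $ k = (if k = i then u $ k * w $ j else 0) - (if k = j then u $ k * w $ i else 0)" for k
      by (simp add: y_def axis_def algebra_simps)
    then show ?thesis by (simp add: sum_subtractf)
  qed
  have "y \<noteq> 0" using pair[of v] ij by auto
  then have "y \<in> plane_zeros (ly w)" "y \<notin> plane_zeros (ly v)"
    using ij by (auto simp: plane_zeros_ly pair mult.commute)
  then show "plane_zeros (ly v) \<noteq> plane_zeros (ly w)" by blast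
qed

lemma type2_factors_iff:
  "type2_factors (X 0 * ly L + X 1 * ly L') (X 0 * ly M + X 1 * ly M')
    \<longleftrightarrow> (\<forall>\<alpha>. \<alpha> \<noteq> 0 \<longrightarrow> \<not> proportional (pencil L L' \<alpha>) (pencil M M' \<alpha>))"
proof -
  have fibre: "fibre \<alpha> (X 0 * ly L + X 1 * ly L') = ly (pencil L L' \<alpha>)" for \<alpha> L L'
    by (simp add: ly_add ly_scale)
  have lin: "ly v \<in> linear_system 0 1 \<longleftrightarrow> v \<noteq> 0" for v
    using ly_bihom[of v] by (simp add: linear_system_def ly_eq_0_iff del: One_nat_def)
  have nz: "v \<noteq> 0" "w \<noteq> 0" if "\<not> proportional v w" for v w
    using that by (auto simp: proportional_def)
  have mem: "X 0 * ly L + X 1 * ly L' \<in> linear_system 1 1" if "pencil L L' (axis 0 1) \<noteq> 0" for L L'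
  proof -
    have "X i * ly v \<in> bihom (1 + 0) (0 + 1)" for i v by (intro bihom_mult bihom_X ly_bihom)
    then have "X i * ly v \<in> bihom 1 1" for i v by (simp only: add_0_left add_0_right)
    then have "X 0 * ly L + X 1 * ly L' \<in> bihom 1 1" by (intro bihom_add)
    moreover have "X 0 * ly L + X 1 * ly L' \<noteq> 0"
    proof
      assume "X 0 * ly L + X 1 * ly L' = 0"
      then have "ly (pencil L L' (axis 0 1)) = fibre (axis 0 1) 0" using fibre by metis
      then show False using that by (simp add: fibre_def ly_eq_0_iff)
    qed
    ultimately show ?thesis by (simp add: linear_system_def)
  qed
  show ?thesis
  proof
    assume "type2_factors (X 0 * ly L + X 1 * ly L') (X 0 * ly M + X 1 * ly M')"
    then show "\<forall>\<alpha>. \<alpha> \<noteq> 0 \<longrightarrow> \<not> proportional (pencil L L' \<alpha>) (pencil M M' \<alpha>)"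
      unfolding type2_factors_def fibres_different_lines_def fibre lin
      using plane_zeros_neq_iff by blast
  next
    assume indep: "\<forall>\<alpha>. \<alpha> \<noteq> 0 \<longrightarrow> \<not> proportional (pencil L L' \<alpha>) (pencil M M' \<alpha>)"
    have "\<not> proportional (pencil L L' (axis 0 1)) (pencil M M' (axis 0 1))"
      by (rule indep[rule_format]) (simp add: axis_eq_0_iff)
    from mem[OF nz(1)[OF this]] mem[OF nz(2)[OF this]]
    have "X 0 * ly L + X 1 * ly L' \<in> linear_system 1 1" "X 0 * ly M + X 1 * ly M' \<in> linear_system 1 1" .
    moreover have "pencil L L' \<alpha> \<noteq> 0 \<and> pencil M M' \<alpha> \<noteq> 0
        \<and> plane_zeros (ly (pencil L L' \<alpha>)) \<noteq> plane_zeros (ly (pencil M M' \<alpha>))" if "\<alpha> \<noteq> 0" for \<alpha>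
    proof -
      have "\<not> proportional (pencil L L' \<alpha>) (pencil M M' \<alpha>)" using indep that by blast
      with nz[OF this] show ?thesis using plane_zeros_neq_iff by blast
    qed
    ultimately show "type2_factors (X 0 * ly L + X 1 * ly L') (X 0 * ly M + X 1 * ly M')"
      unfolding type2_factors_def fibres_different_lines_def fibre lin by blast
  qed
qed

section \<open>The two semi-stable types and the theorem\<close>

lemma type2_factors_consequences:
  assumes "type2_factors f1 f2"
  shows "git_semistable (f1 * f2)" "\<not> git_stable (f1 * f2)" "\<exists>k. degenerates (f1 * f2) (type2_form k)"
proof -
  have "f1 \<in> bihom 1 1" "f2 \<in> bihom 1 1" using assms by (auto simp: type2_factors_def linear_system_def)
  then obtain L L' M M' where f: "f1 = X 0 * ly L + X 1 * ly L'" "f2 = X 0 * ly M + X 1 * ly M'"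
    using bihom_1_1 by metis
  have "\<not> proportional (pencil L L' \<alpha>) (pencil M M' \<alpha>)" if "\<alpha> \<noteq> 0" for \<alpha>
    using assms that unfolding f type2_factors_iff by blast
  then obtain C D k where k: "det C = 1" "det D = 1" "k \<noteq> 0" "gact C D (f1 * f2) = type2_form k"
    unfolding f by (rule type2_normal_form)
  have orbit: "orbit (type2_form k) = orbit (f1 * f2)"
    using orbit_gact[OF k(1,2), of "f1 * f2"] by (simp only: k(4))
  show ss: "git_semistable (f1 * f2)"
    using type2_form_semistable[OF k(3)] by (simp add: git_semistable_def orbit)
  \<comment> \<open>Here the degenerate form lies in the orbit itself, so no limit is taken.\<close>
  have closure: "type2_form k \<in> V_closure (orbit (f1 * f2))"
    using orbit_self[of "type2_form k"] unfolding orbit V_closure_def by (auto simp: type2_form_eq_quad)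
  then show "\<exists>k. degenerates (f1 * f2) (type2_form k)"
    using ss type2_form_semistable[OF k(3)] by (auto simp: degenerates_def)
  show "\<not> git_stable (f1 * f2)"
    using not_stable_if_infinite_stabilizer[OF closure type2_form_infinite_stabilizer] .
qed

lemma type1_factors_consequences:
  assumes "type1_factors f1 f2"
  shows "git_semistable (f1 * f2)" "\<not> git_stable (f1 * f2)"
    "\<exists>\<alpha> \<beta>. \<alpha> \<noteq> 0 \<and> \<beta> \<noteq> 0 \<and> degenerates (f1 * f2) (X 0 * X 1 * (Const \<alpha> * Y 0 * Y 2 + Const \<beta> * (Y 1)\<^sup>2))"
proof -
  obtain u P Q where u: "u \<noteq> 0" "sym_mat P" "sym_mat Q" and f: "f1 = lx u" "f2 = X 0 * qf P + X 1 * qf Q"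
    and det: "det (zero_fibre u P Q) \<noteq> 0"
    using type1_factorsE[OF assms] .
  show "git_semistable (f1 * f2)" "\<not> git_stable (f1 * f2)"
    "\<exists>\<alpha> \<beta>. \<alpha> \<noteq> 0 \<and> \<beta> \<noteq> 0 \<and> degenerates (f1 * f2) (X 0 * X 1 * (Const \<alpha> * Y 0 * Y 2 + Const \<beta> * (Y 1)\<^sup>2))"
    unfolding f
    using linear_factor_semistable_iff[OF u] linear_factor_degenerates[OF u det] det by blast+
qed

lemma semistable_reducible_types:
  assumes "f \<in> linear_system 2 2" "\<not> irreducible f" "git_semistable f"
  shows "(\<exists>f1 f2. f = f1 * f2 \<and> type1_factors f1 f2) \<or> (\<exists>f1 f2. f = f1 * f2 \<and> type2_factors f1 f2)"
  using assms(1,2)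
proof (cases rule: reducible_cases)
  case (linear u P Q)
  then have "det (zero_fibre u P Q) \<noteq> 0"
    using assms(3) linear_factor_semistable_iff[of u P Q] by simp
  with linear show ?thesis using type1_factors_iff[of u P Q] by blast
next
  case (line v A B C)
  with assms(3) show ?thesis using line_factor_not_semistable[of v A B C] by simp
next
  case (bilinear L L' M M')
  have "\<not> proportional (pencil L L' \<alpha>) (pencil M M' \<alpha>)" if "\<alpha> \<noteq> 0" for \<alpha>
    using proportional_fibres_not_semistable[OF that, of L L' M M'] assms(3) bilinear by blast
  with bilinear show ?thesis using type2_factors_iff[of L L' M M'] by blast
qed

theorem theorem6p6:
  fixes f :: cpoly
  assumes "f \<in> linear_system 2 2" and "\<not> irreducible f"
  shows "\<not> git_stable f \<and>
         (strictly_semistable f \<longleftrightarrow>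
           (\<exists>f1 f2. f = f1 * f2 \<and> type1_factors f1 f2) \<or>
           (\<exists>f1 f2. f = f1 * f2 \<and> type2_factors f1 f2)) \<and>
         (\<forall>f1 f2. f = f1 * f2 \<and> type1_factors f1 f2 \<longrightarrow>
           (\<exists>\<alpha> \<beta>. \<alpha> \<noteq> 0 \<and> \<beta> \<noteq> 0 \<and>
              degenerates f (X 0 * X 1 * (Const \<alpha> * Y 0 * Y 2 + Const \<beta> * (Y 1)\<^sup>2)))) \<and>
         (\<forall>f1 f2. f = f1 * f2 \<and> type2_factors f1 f2 \<longrightarrow>
           (\<exists>\<alpha>\<^sub>2 \<beta>\<^sub>1 \<gamma>\<^sub>1 \<delta>\<^sub>0. degenerates f
              ((Const \<alpha>\<^sub>2 * X 0 * Y 2 + Const \<beta>\<^sub>1 * X 1 * Y 1) *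
               (Const \<gamma>\<^sub>1 * X 0 * Y 1 + Const \<delta>\<^sub>0 * X 1 * Y 0))))"
proof (intro conjI allI impI)
  show unstable: "\<not> git_stable f"
  proof (cases "git_semistable f")
    case True
    then show ?thesis
      using semistable_reducible_types[OF assms True] type1_factors_consequences(2)
        type2_factors_consequences(2) by blast
  next
    case False
    then show ?thesis
      using not_stable_if_not_semistable assms(1) by (auto simp: linear_system_def)
  qed
  show "strictly_semistable f \<longleftrightarrow> (\<exists>f1 f2. f = f1 * f2 \<and> type1_factors f1 f2) \<or>
      (\<exists>f1 f2. f = f1 * f2 \<and> type2_factors f1 f2)"
    using semistable_reducible_types[OF assms] unstable type1_factors_consequences(1)
      type2_factors_consequences(1) unfolding strictly_semistable_def by blast
next
  fix f1 f2 assume "f = f1 * f2 \<and> type1_factors f1 f2"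
  then show "\<exists>\<alpha> \<beta>. \<alpha> \<noteq> 0 \<and> \<beta> \<noteq> 0 \<and>
      degenerates f (X 0 * X 1 * (Const \<alpha> * Y 0 * Y 2 + Const \<beta> * (Y 1)\<^sup>2))"
    using type1_factors_consequences(3) by blast
next
  fix f1 f2 assume "f = f1 * f2 \<and> type2_factors f1 f2"
  then show "\<exists>\<alpha>\<^sub>2 \<beta>\<^sub>1 \<gamma>\<^sub>1 \<delta>\<^sub>0. degenerates f
      ((Const \<alpha>\<^sub>2 * X 0 * Y 2 + Const \<beta>\<^sub>1 * X 1 * Y 1) *
       (Const \<gamma>\<^sub>1 * X 0 * Y 1 + Const \<delta>\<^sub>0 * X 1 * Y 0))"
    using type2_factors_consequences(3)[of f1 f2] unfolding type2_form_def by blast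
qed

end
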